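(* Let $A=(\alpha_{ij})$ be a real $m\times n$ matrix with $\operatorname{rank} A=m<n$, let $b=(\beta_1,\ldots,\beta_m)\in\mathbb{R}^m$, and suppose that the polyhedron $$P=\Bigl\{x=(\xi_1,\ldots,\xi_n)\in\mathbb{R}^n:\ \sum_{j=1}^n\alpha_{ij}\xi_j=\beta_i \ \text{ for } i=1,\ldots,m,\quad \xi_j\ge 0\ \text{ for } j=1,\ldots,n\Bigr\}$$ is bounded and has a non-empty relative interior, that is, contains a point with all coordinates strictly positive. Let $z=(\zeta_1,\ldots,\zeta_n)$ be the analytic center of $P$. Let $B$ be the $m\times n$ matrix obtained by multiplying the $j$-th column of $A$ by $\zeta_j$ for $j=1,\ldots,n$, and let $$\mathcal{E}(A,b)=e^{n}\,\zeta_1\cdots\zeta_n\,\frac{\sqrt{\det AA^T}}{\sqrt{\det BB^T}}.$$ Then the following hold. (1) There is a unique number $\alpha_0$ in the interval $(0,1)$ satisfying $$\frac{1}{2\pi}\int_{-\infty}^{+\infty}(1+s^2)^{-\frac{1}{2\alpha_0}}\,ds=1,\qquad \alpha_0\approx 0.7148659168,$$ and $$\operatorname{vol} P\ \le\ \Bigl(\frac{1}{\sqrt{\alpha_0}}\Bigr)^m\mathcal{E}(A,b)\ \le\ (1.19)^m\,\mathcal{E}(A,b).$$ (2) We have $$\operatorname{vol} P\ \ge\ \frac{2\,\Gamma\left(\frac{m+2}{2}\right)}{\pi^{m/2}\,e^{(m+2)/2}\,(m+2)^{m/2}}\,\mathcal{E}(A,b).$$ (3) For any $0<\epsilon<1/2$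 there is $\gamma(\epsilon)>0$, depending only on $\epsilon$ (and not on $m$, $n$, $A$, $b$), such that $$\operatorname{vol} P\ \ge\ \exp\left\{-\gamma(\epsilon)\sqrt{m}\,\ln^4(m+1)\right\}\Bigl(\frac{1}{\sqrt{2\pi e}}\Bigr)^m\mathcal{E}(A,b)\ \ge\ \exp\left\{-\gamma(\epsilon)\sqrt{m}\,\ln^4(m+1)\right\}(0.24)^m\,\mathcal{E}(A,b).$$
   Context: Here $m\ge 1$. Under the stated hypotheses $P$ is an $(n-m)$-dimensional polytope, and $\operatorname{vol} P$ denotes its $(n-m)$-dimensional volume in its affine span (the affine subspace defined by $Ax=b$), with respect to the Euclidean structure inherited from $\mathbb{R}^n$. The analytic center of $P$ is the point $z\in P$ at which the function $$f(x)=n+\sum_{j=1}^n\ln\xi_j,\qquad x=(\xi_1,\ldots,\xi_n),\ \xi_j>0,$$ attains its maximum over the points of $P$ with strictly positive coordinates. Since $f$ is strictly concave, this point exists and is unique under the hypotheses, and $\zeta_j>0$ for all $j$. Note $e^{f(z)}=e^n\zeta_1\cdots\zeta_n$. $\Gamma$ is the Gamma function. *)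

theory Defs
  imports
    "HOL-Analysis.Finite_Product_Measure"
    "HOL-Analysis.Lebesgue_Measure"
    "HOL-Analysis.Gamma_Function"
    "Jordan_Normal_Form.DL_Rank"
begin

no_notation vec_nth (infixl "$" 90)
no_notation inner (infixl "\<bullet>" 70)

definition affine_solutions :: "real mat \<Rightarrow> real Matrix.vec \<Rightarrow> real Matrix.vec set" where
  "affine_solutions A b = {x \<in> carrier_vec (dim_col A). A *\<^sub>v x = b}"

definition polyhedron :: "real mat \<Rightarrow> real Matrix.vec \<Rightarrow> real Matrix.vec set" where
  "polyhedron A b = {x \<in> affine_solutions A b. \<forall>j < dim_col A. 0 \<le> x $ j}"

definition interior_points :: "real mat \<Rightarrow> real Matrix.vec \<Rightarrow> real Matrix.vec set" where
  "interior_points A b = {x \<in> polyhedron A b. \<forall>j < dim_col A. 0 < x $ j}"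

definition bounded_vecs :: "real Matrix.vec set \<Rightarrow> bool" where
  "bounded_vecs S \<longleftrightarrow> (\<exists>M. \<forall>x \<in> S. sqrt (x \<bullet> x) \<le> M)"

definition polytope_data :: "nat \<Rightarrow> nat \<Rightarrow> real mat \<Rightarrow> real Matrix.vec \<Rightarrow> bool" where
  "polytope_data m n A b \<longleftrightarrow>
     1 \<le> m \<and> m < n \<and> A \<in> carrier_mat m n \<and> b \<in> carrier_vec m \<and> vec_space.rank m A = m \<and>
     bounded_vecs (polyhedron A b) \<and> interior_points A b \<noteq> {}"

text \<open>
  A pair \<open>(p, U)\<close> is an isometric chart of a \<open>k\<close>-dimensional affine subspace \<open>L\<close> of
  \<open>n\<close>-dimensional Euclidean space if the columns of the \<open>n \<times> k\<close> matrix \<open>U\<close> are orthonormal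
  and \<open>y \<mapsto> p + U y\<close> maps \<open>k\<close>-dimensional space onto \<open>L\<close>.
\<close>

definition isometric_chart ::
  "nat \<Rightarrow> nat \<Rightarrow> real Matrix.vec set \<Rightarrow> real Matrix.vec \<times> real mat \<Rightarrow> bool" where
  "isometric_chart n k L = (\<lambda>(p, U).
     p \<in> carrier_vec n \<and> U \<in> carrier_mat n k \<and> transpose_mat U * U = 1\<^sub>m k \<and>
     (\<lambda>y. p + U *\<^sub>v y) ` carrier_vec k = L)"

text \<open>
  The \<open>k\<close>-dimensional volume of a subset of \<open>L\<close> is the \<open>k\<close>-dimensional Lebesgue measure of
  its preimage under an isometric chart. Two charts of \<open>L\<close> differ by a rigid motion of
  \<open>k\<close>-dimensional space, so the choice made by \<open>SOME\<close> does not affect the value.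
\<close>

definition affine_volume ::
  "nat \<Rightarrow> nat \<Rightarrow> real Matrix.vec set \<Rightarrow> real Matrix.vec set \<Rightarrow> real" where
  "affine_volume n k L S =
     (let (p, U) = (SOME c. isometric_chart n k L c);
          M = (\<Pi>\<^sub>M i \<in> {..<k}. (lborel :: real measure))
      in measure M {y \<in> space M. p + U *\<^sub>v Matrix.vec k y \<in> S})"

definition vol :: "real mat \<Rightarrow> real Matrix.vec \<Rightarrow> real" where
  "vol A b =
     affine_volume (dim_col A) (dim_col A - dim_row A) (affine_solutions A b) (polyhedron A b)"

definition analytic_center :: "real mat \<Rightarrow> real Matrix.vec \<Rightarrow> real Matrix.vec" where
  "analytic_center A b =
     arg_max_on (\<lambda>x. real (dim_col A) + (\<Sum>j < dim_col A. ln (x $ j))) (interior_points A b)"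

definition scale_cols :: "real mat \<Rightarrow> real Matrix.vec \<Rightarrow> real mat" where
  "scale_cols A z = mat (dim_row A) (dim_col A) (\<lambda>(i, j). z $ j * A $$ (i, j))"

definition vol_estimate :: "real mat \<Rightarrow> real Matrix.vec \<Rightarrow> real" where
  "vol_estimate A b =
     (let z = analytic_center A b; B = scale_cols A z
      in exp (real (dim_col A)) * (\<Prod>j < dim_col A. z $ j) *
         sqrt (Determinant.det (A * transpose_mat A)) / sqrt (Determinant.det (B * transpose_mat B)))"

end

theory Submission
  imports Defs "HOL-Probability.Distributions" "HOL-Real_Asymp.Real_Asymp"
begin

text \<open>
  Write k = n - m, let z be the analytic center and let the orthonormal columns of U span the kernel
  of A. Put W = diag(z)^(-1) U. The points of the affine span of the polytope are z + U h; measured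
  in units of the z_j their coordinates are 1 + W h. That z maximises the sum of the logarithms
  means that the columns of W sum to 0 (\<open>analytic_center_stationary\<close>). So the coordinates of
  1 + W h always add up to n, and the density of n independent standard exponential variables is the
  constant e^(-n) on the polytope. Therefore vol P = e^n M(1), where M(x) is the mass which this law
  puts on the fibre x + range W (\<open>fiber_mass\<close>). A determinant identity
  (\<open>det_gram_kernel_identity\<close>) gives E(A,b) = e^n / sqrt (det (W^T W)). Everything follows from

    (2 pi e)^(-m/2) \<le> M(1) sqrt (det (W^T W)) \<le> 1.

  Upper bound (\<open>fiber_mass_upper\<close>). By the Prekopa-Leindler inequality M is log-concave, so
  M(1) M(2 x - 1) \<le> M(x)^2. Both sides are integrated against a weight that is a unit Gaussian along
  every fibre. On the left the integral is explicit. On the right it measures the overlap of the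
  exponential density with its translates by W h, which is a product of Laplace kernels; the outcome
  is that M(1) is at most the integral of exp (-2 |y|) over y = W h, with the l1 norm. Replacing
  the factors exp (-2 |s|) one by one by the Gaussians exp (-pi s^2) of the same mass can only increase
  such an integral (\<open>laplace_le_gauss_section\<close>), because the remaining factors are even and
  log-concave. The resulting Gaussian integral is 1 / sqrt (det (W^T W)).

  Lower bound (\<open>fiber_mass_lower\<close>). Since ln M is concave and the exponential law has mean 1 and
  variance 1 in each coordinate, Jensen's inequality bounds the mean of exp (-d(x)^2 / 2) / M(x) from
  below by e^(-m/2) / M(1), where d(x) is the distance between the fibres of x and of 1; here d^2 is a
  quadratic form with mean n - k = m. The factor 1 / M(x) gives every fibre the same weight, so this mean is a
  Gaussian integral that can be computed.

  Consequently (2 pi e)^(-m/2) E \<le> vol P \<le> E. As \<alpha>0 < 1, this contains the first claim; the constant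
  in the second claim is at most (2 pi e)^(-m/2) because Gamma(a) \<le> a^(a-1) for a = (m+2)/2 and
  e \<ge> 2; and the third claim holds with \<gamma> = 1. For the equation that defines \<alpha>0, the integral of
  (1 + s^2)^(-x) is sqrt pi times Gamma(x - 1/2) / Gamma(x), a strictly decreasing function of x
  whose values are enclosed by convergents of Brouncker's continued fraction.
\<close>

no_notation vec_nth (infixl "$" 90)
no_notation inner (infixl "\<bullet>" 70)
hide_const (open) Order.top Determinants.det
notation transpose_mat ("(_\<^sup>T)" [1000])

section \<open>The Prekopa-Leindler inequality\<close>

text \<open>
  If A has a greatest point a and B a least point b, then the sets (1 - t) A + t b and (1 - t) a + t B
  lie in C and meet only in (1 - t) a + t b, so their measures add up to at most that of C. Cutting A
  above at one of its points and B below at one of its points creates this situation, and the cut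
  sets exhaust A and B in measure.
\<close>
lemma brunn_minkowski_real:
  fixes A B C :: "real set"
  assumes [measurable]: "A \<in> sets borel" "B \<in> sets borel" "C \<in> sets borel"
    and ne: "A \<noteq> {}" "B \<noteq> {}"
    and t: "0 < t" "t < 1"
    and sub: "\<And>x y. x \<in> A \<Longrightarrow> y \<in> B \<Longrightarrow> (1 - t) * x + t * y \<in> C"
  shows "ennreal (1 - t) * emeasure lborel A + ennreal t * emeasure lborel B \<le> emeasure lborel C"
proof -
  have piece: "ennreal (1 - t) * emeasure lborel (A \<inter> {..a}) + ennreal t * emeasure lborel (B \<inter> {b..})
      \<le> emeasure lborel C" if ab: "a \<in> A" "b \<in> B" for a b
  proof -
    define A' where "A' = A \<inter> {..a}"
    define B' where "B' = B \<inter> {b..}"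
    have [measurable]: "A' \<in> sets borel" "B' \<in> sets borel" by (auto simp: A'_def B'_def)
    define p where "p = (1 - t) * a + t * b"
    have *: "emeasure lborel {s. (s - d) / c \<in> S} = ennreal c * emeasure lborel S"
      if "c > 0" and [measurable]: "S \<in> sets borel" for c d :: real and S
    proof -
      have "emeasure lborel {s. (s - d) / c \<in> S} = (\<integral>\<^sup>+ s. indicator S ((s - d) / c) \<partial>lborel)"
      proof -
        have "(\<lambda>s. indicator S ((s - d) / c) :: ennreal) = indicator {s. (s - d) / c \<in> S}"
          by (auto simp: indicator_def)
        then show ?thesis by simp
      qed
      also have "\<dots> = ennreal c * (\<integral>\<^sup>+ s. indicator S ((d + c * s - d) / c) \<partial>lborel)"
        by (subst nn_integral_real_affine[where c = c and t = d]) (use that in auto)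
      also have "\<dots> = ennreal c * emeasure lborel S" using that by simp
      finally show ?thesis .
    qed
    have "ennreal (1 - t) * emeasure lborel A' + ennreal t * emeasure lborel B'
        = emeasure lborel {s. (s - t * b) / (1 - t) \<in> A'} + emeasure lborel {s. (s - (1 - t) * a) / t \<in> B'}"
      using t by (simp add: *)
    also have "\<dots> = emeasure lborel ({s. (s - t * b) / (1 - t) \<in> A'}) + emeasure lborel ({s. (s - (1 - t) * a) / t \<in> B'} - {p})"
    proof -
      have "emeasure lborel ({s. (s - (1 - t) * a) / t \<in> B'} - {p}) = emeasure lborel {s. (s - (1 - t) * a) / t \<in> B'}"
        by (intro emeasure_Diff_null_set) (auto simp: null_sets_def)
      then show ?thesis by simp
    qed
    also have "\<dots> = emeasure lborel ({s. (s - t * b) / (1 - t) \<in> A'} \<union> ({s. (s - (1 - t) * a) / t \<in> B'} - {p}))"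
    proof (intro plus_emeasure)
      have "s \<le> p" if "(s - t * b) / (1 - t) \<le> a" for s using that t by (simp add: p_def field_simps)
      moreover have "s \<ge> p" if "(s - (1 - t) * a) / t \<ge> b" for s using that t by (simp add: p_def field_simps)
      ultimately show "{s. (s - t * b) / (1 - t) \<in> A'} \<inter> ({s. (s - (1 - t) * a) / t \<in> B'} - {p}) = {}"
        unfolding A'_def B'_def by force
    qed auto
    also have "\<dots> \<le> emeasure lborel C"
    proof (intro emeasure_mono Un_least subsetI; clarsimp)
      fix s assume "(s - t * b) / (1 - t) \<in> A'"
      then show "s \<in> C" using sub[OF _ ab(2), of "(s - t * b) / (1 - t)"] t by (simp add: A'_def)
    next
      fix s assume "(s - (1 - t) * a) / t \<in> B'"
      then show "s \<in> C" using sub[OF ab(1), of "(s - (1 - t) * a) / t"] t by (simp add: B'_def)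
    qed
    finally show ?thesis by (simp add: A'_def B'_def)
  qed
  have upper: "emeasure lborel A = (SUP a\<in>A. emeasure lborel (A \<inter> {..a}))"
    if [measurable]: "A \<in> sets borel" and "A \<noteq> {}" for A :: "real set"
  proof (rule antisym)
    show "(SUP a\<in>A. emeasure lborel (A \<inter> {..a})) \<le> emeasure lborel A"
      by (intro SUP_least emeasure_mono) auto
    \<comment> \<open>an increasing sequence in A, cofinal in A up to a greatest point\<close>
    obtain X :: "nat \<Rightarrow> real" where X: "\<And>n. X n \<in> A" "incseq X" and cof: "\<And>a. a \<in> A \<Longrightarrow> (\<exists>n. a \<le> X n) \<or> (\<forall>x\<in>A. x \<le> a)"
    proof (cases "\<exists>a\<in>A. \<forall>x\<in>A. x \<le> a")
      case True
      then obtain a where "a \<in> A" "\<forall>x\<in>A. x \<le> a" by auto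
      then show ?thesis by (intro that[of "\<lambda>_. a"]) auto
    next
      case False
      have "\<exists>Y. (\<forall>n. Y n \<in> A) \<and> (\<forall>a\<in>A. \<exists>n. a \<le> Y (n::nat))"
      proof (cases "bdd_above A")
        case True
        have "\<exists>x\<in>A. Sup A - 1 / Suc n < x" for n :: nat
          using less_cSup_iff[OF \<open>A \<noteq> {}\<close> True, of "Sup A - 1 / Suc n"] by auto
        then obtain Y where Y: "\<And>n. Y n \<in> A" "\<And>n. Sup A - 1 / Suc n < Y n" by metis
        have "\<exists>n. a \<le> Y n" if "a \<in> A" for a
        proof -
          from False that obtain x where x: "x \<in> A" "a < x" by force
          then have "a < Sup A" using cSup_upper[OF x(1) True] by simp
          then obtain n where "inverse (of_nat (Suc n)) < Sup A - a" using reals_Archimedean[of "Sup A - a"] by auto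
          then have "a \<le> Y n" using Y(2)[of n] by (simp add: inverse_eq_divide)
          then show ?thesis ..
        qed
        with Y show ?thesis by blast
      next
        case False
        then have "\<exists>x\<in>A. real n < x" for n unfolding bdd_above_def by (meson not_le)
        then obtain Y where Y: "\<And>n. Y n \<in> A" "\<And>n. real n < Y n" by metis
        have "\<exists>n. a \<le> Y n" for a using Y(2) by (meson less_le_trans order.strict_implies_order real_arch_simple order_trans)
        with Y show ?thesis by blast
      qed
      then obtain Y where Y: "\<And>n. Y n \<in> A" "\<And>a. a \<in> A \<Longrightarrow> \<exists>n::nat. a \<le> Y n" by blast
      \<comment> \<open>running maxima make the cofinal sequence increasing\<close>
      define X where "X = (\<lambda>n. Max (Y ` {..n}))"
      have XA: "X n \<in> A" for n
        using Max_in[of "Y ` {..n}"] Y(1) unfolding X_def by (metis atMost_iff empty_iff finite_atMost finite_imageI image_iff image_is_empty le0)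
      have "incseq X" unfolding X_def by (intro incseq_SucI Max_mono) auto
      moreover have "Y n \<le> X n" for n by (auto simp: X_def)
      ultimately show ?thesis using XA Y(2) by (intro that[of X]) (auto, meson order_trans)
    qed
    have "emeasure lborel A = emeasure lborel (\<Union>n. A \<inter> {..X n})"
    proof (cases "\<forall>a\<in>A. \<exists>n. a \<le> X n")
      case True then have "(\<Union>n. A \<inter> {..X n}) = A" by auto
      then show ?thesis by simp
    next
      case False
      then obtain a where a: "a \<in> A" "\<And>n. \<not> a \<le> X n" by auto
      then have mx: "\<forall>x\<in>A. x \<le> a" using cof by blast
      have "A - {a} \<subseteq> (\<Union>n. A \<inter> {..X n})" using cof mx a by (force)
      then have "emeasure lborel (A - {a}) \<le> emeasure lborel (\<Union>n. A \<inter> {..X n})" by (intro emeasure_mono) auto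
      moreover have "emeasure lborel (A - {a}) = emeasure lborel A"
        by (intro emeasure_Diff_null_set) (auto simp: null_sets_def)
      moreover have "emeasure lborel (\<Union>n. A \<inter> {..X n}) \<le> emeasure lborel A" by (intro emeasure_mono) auto
      ultimately show ?thesis by simp
    qed
    also have "\<dots> = (SUP n. emeasure lborel (A \<inter> {..X n}))"
      using X(2) by (subst SUP_emeasure_incseq) (auto simp: incseq_def intro: order_trans)
    also have "\<dots> \<le> (SUP a\<in>A. emeasure lborel (A \<inter> {..a}))"
      using X(1) by (intro SUP_mono) auto
    finally show "emeasure lborel A \<le> (SUP a\<in>A. emeasure lborel (A \<inter> {..a}))" .
  qed
  have lower: "emeasure lborel B = (SUP b\<in>B. emeasure lborel (B \<inter> {b..}))"
  proof -
    have refl: "emeasure lborel (uminus ` S) = emeasure lborel S" if [measurable]: "S \<in> sets borel" for S :: "real set"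
    proof -
      have "uminus ` S = {s. - s \<in> S}" by force
      have "emeasure lborel (uminus ` S) = (\<integral>\<^sup>+ s. indicator S (- s) \<partial>lborel)"
      proof -
        have "(\<lambda>s. indicator S (- s) :: ennreal) = indicator {s. - s \<in> S}"
          by (auto simp: indicator_def)
        then show ?thesis by (simp add: \<open>uminus ` S = _\<close>)
      qed
      also have "\<dots> = (\<integral>\<^sup>+ s. indicator S s \<partial>lborel)"
        by (subst (2) nn_integral_real_affine[where c = "-1" and t = 0]) auto
      finally show ?thesis by simp
    qed
    have [measurable]: "uminus ` B \<in> sets borel"
    proof -
      have "uminus ` B = {s. - s \<in> B}" by force
      then show ?thesis by simp
    qed
    have "emeasure lborel B = emeasure lborel (uminus ` B)" by (simp add: refl)
    also have "\<dots> = (SUP b\<in>B. emeasure lborel (uminus ` B \<inter> {..-b}))"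
      using ne by (subst upper) (auto simp: image_image)
    also have "\<dots> = (SUP b\<in>B. emeasure lborel (B \<inter> {b..}))"
    proof (intro SUP_cong refl)
      fix b
      have "uminus ` B \<inter> {..-b} = uminus ` (B \<inter> {b..})" by force
      then show "emeasure lborel (uminus ` B \<inter> {..-b}) = emeasure lborel (B \<inter> {b..})"
        by (simp add: local.refl)
    qed simp
    finally show ?thesis .
  qed
  have "ennreal (1 - t) * emeasure lborel (A \<inter> {..a}) + ennreal t * emeasure lborel B \<le> emeasure lborel C"
    if "a \<in> A" for a
    unfolding lower using ne piece[OF that]
    by (simp add: SUP_mult_left_ennreal ennreal_SUP_add_right SUP_least)
  then show ?thesis
    unfolding upper[OF assms(1) ne(1)] using ne
    by (simp add: SUP_mult_left_ennreal ennreal_SUP_add_left[symmetric] SUP_least)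
qed


lemma nn_integral_layer_cake:
  fixes f :: "real \<Rightarrow> ennreal"
  assumes [measurable]: "f \<in> borel_measurable borel"
  shows "(\<integral>\<^sup>+ x. f x \<partial>lborel) = (\<integral>\<^sup>+ l. indicator {0<..} l * emeasure lborel {x. ennreal l < f x} \<partial>lborel)"
proof -
  have one: "f x = (\<integral>\<^sup>+ l. indicator {l. 0 < l \<and> ennreal l < f x} l \<partial>lborel)" for x
  proof (cases "f x" rule: ennreal_cases)
    case (real r)
    then have "{l. 0 < l \<and> ennreal l < f x} = {0<..<r}" by (auto simp: ennreal_less_iff)
    then show ?thesis using real by simp
  next
    case top
    have "{l. 0 < l \<and> ennreal l < f x} = (\<Union>n::nat. {0<..<real n})"
      using top by (auto simp: less_top[symmetric] intro: reals_Archimedean2)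
    then have "(\<integral>\<^sup>+ l. indicator {l. 0 < l \<and> ennreal l < f x} l \<partial>lborel) = emeasure lborel (\<Union>n::nat. {0<..<real n})"
      by simp
    also have "\<dots> = (SUP n::nat. emeasure lborel {0<..<real n})"
      by (intro SUP_emeasure_incseq[symmetric]) (auto simp: incseq_def)
    also have "\<dots> = (SUP n::nat. of_nat n)"
      by (simp add: ennreal_of_nat_eq_real_of_nat)
    also have "\<dots> = f x"
      unfolding top by (rule ennreal_SUP_of_nat_eq_top)
    finally show ?thesis ..
  qed
  have "(\<integral>\<^sup>+ x. f x \<partial>lborel) = (\<integral>\<^sup>+ x. (\<integral>\<^sup>+ l. indicator {l. 0 < l \<and> ennreal l < f x} l \<partial>lborel) \<partial>lborel)"
    using one by simp
  also have "\<dots> = (\<integral>\<^sup>+ l. (\<integral>\<^sup>+ x. indicator {l. 0 < l \<and> ennreal l < f x} l \<partial>lborel) \<partial>lborel)"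
    by (rule lborel_pair.Fubini'[symmetric]) measurable
  also have "\<dots> = (\<integral>\<^sup>+ l. indicator {0<..} l * emeasure lborel {x. ennreal l < f x} \<partial>lborel)"
  proof (intro nn_integral_cong)
    fix l :: real
    have "(\<lambda>x. indicator {l. 0 < l \<and> ennreal l < f x} l :: ennreal) = (\<lambda>x. indicator {0<..} l * indicator {x. ennreal l < f x} x)"
      by (auto simp: indicator_def)
    then show "(\<integral>\<^sup>+ x. indicator {l. 0 < l \<and> ennreal l < f x} l \<partial>lborel) = indicator {0<..} l * emeasure lborel {x. ennreal l < f x}"
      by (simp add: nn_integral_cmult)
  qed
  finally show ?thesis .
qed

text \<open>
  The form in which two functions with different suprema can be compared level by level: each level is
  expressed as a fraction of the supremum.
\<close>
lemma nn_integral_layer_cake_scaled: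
  fixes f :: "real \<Rightarrow> ennreal"
  assumes [measurable]: "f \<in> borel_measurable borel" and c: "0 < c"
  shows "(\<integral>\<^sup>+ x. f x \<partial>lborel) = ennreal c * (\<integral>\<^sup>+ l. indicator {0<..} l * emeasure lborel {x. ennreal (c * l) < f x} \<partial>lborel)"
proof -
  have [measurable]: "(\<lambda>l. emeasure lborel {x. ennreal l < f x}) \<in> borel_measurable borel"
    by (rule lborel.measurable_emeasure) measurable
  have "indicator {0<..} (0 + c * l) = (indicator {0<..} l :: ennreal)" for l
    using c by (auto simp: indicator_def zero_less_mult_iff)
  then show ?thesis
    unfolding nn_integral_layer_cake[OF assms(1)]
    by (subst nn_integral_real_affine[where c = c and t = 0]) (use c in auto)
qed

text \<open>
  Truncate f and g to bounded functions with suprema a and b and put c = a^(1-t) b^t. For 0 < l < 1 the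
  superlevel sets of the truncations at the levels a l and b l are nonempty and combine into the
  superlevel set of h at the level c l, so the one-dimensional Brunn-Minkowski inequality applies at
  each l. Integration over l and Young's inequality give the claim. Stating everything for real
  numbers strictly below the values and the integrals keeps powers of \<open>\<infinity>\<close> out of the statement.
\<close>
lemma prekopa_leindler_real:
  fixes f g h :: "real \<Rightarrow> ennreal"
  assumes [measurable]: "f \<in> borel_measurable borel" "g \<in> borel_measurable borel" "h \<in> borel_measurable borel"
    and t: "0 < t" "t < 1"
    and le: "\<And>x y a b. 0 < a \<Longrightarrow> 0 < b \<Longrightarrow> ennreal a < f x \<Longrightarrow> ennreal b < g y \<Longrightarrow>
      ennreal (a powr (1 - t) * b powr t) \<le> h ((1 - t) * x + t * y)"
    and pos: "0 < \<alpha>" "0 < \<beta>"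
    and \<alpha>: "ennreal \<alpha> < (\<integral>\<^sup>+ x. f x \<partial>lborel)" and \<beta>: "ennreal \<beta> < (\<integral>\<^sup>+ x. g x \<partial>lborel)"
  shows "ennreal (\<alpha> powr (1 - t) * \<beta> powr t) \<le> (\<integral>\<^sup>+ x. h x \<partial>lborel)"
proof -
  \<comment> \<open>cutting f off at a large height keeps its integral above \<alpha> and gives it a finite supremum, called a\<close>
  have trunc: "\<exists>f'\<in>borel_measurable borel. \<exists>a>0. (\<forall>x. f' x \<le> f x) \<and> ennreal \<alpha> < (\<integral>\<^sup>+ x. f' x \<partial>lborel)
      \<and> (\<forall>x. f' x \<le> ennreal a) \<and> (\<forall>r<a. \<exists>x. ennreal r < f' x)"
    if [measurable]: "f \<in> borel_measurable borel" and \<alpha>: "ennreal \<alpha> < (\<integral>\<^sup>+ x. f x \<partial>lborel)"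
    for f :: "real \<Rightarrow> ennreal" and \<alpha> :: real
  proof -
    have "(SUP n::nat. min (f x) (ennreal (real n))) = f x" for x
    proof (rule antisym[OF SUP_least])
      show "f x \<le> (SUP n::nat. min (f x) (ennreal (real n)))"
      proof (rule dense_le)
        fix y assume y: "y < f x"
        then have "y < top" by (meson less_le_trans top_greatest)
        then obtain n :: nat where "y < of_nat n" using ennreal_Ex_less_of_nat by blast
        then have "y \<le> min (f x) (ennreal (real n))" using y by (auto simp: ennreal_of_nat_eq_real_of_nat)
        then show "y \<le> (SUP n::nat. min (f x) (ennreal (real n)))" by (rule SUP_upper2[OF UNIV_I])
      qed
    qed auto
    then have "(\<integral>\<^sup>+ x. f x \<partial>lborel) = (\<integral>\<^sup>+ x. (SUP n::nat. min (f x) (ennreal (real n))) \<partial>lborel)" by simp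
    also have "\<dots> = (SUP n::nat. (\<integral>\<^sup>+ x. min (f x) (ennreal (real n)) \<partial>lborel))"
      by (intro nn_integral_monotone_convergence_SUP) (auto simp: incseq_def le_fun_def min_def intro: order_trans)
    finally obtain n :: nat where n: "ennreal \<alpha> < (\<integral>\<^sup>+ x. min (f x) (ennreal (real n)) \<partial>lborel)"
      using \<alpha> by (auto simp: less_SUP_iff)
    define f' where "f' = (\<lambda>x. min (f x) (ennreal (real n)))"
    define S where "S = (SUP x. f' x)"
    have S: "S \<le> ennreal (real n)" by (auto simp: S_def f'_def intro!: SUP_least)
    then have Sfin: "S < top" by (simp add: le_less_trans)
    have "S \<noteq> 0"
    proof
      assume "S = 0"
      then have "f' x = 0" for x using SUP_upper[of x UNIV f'] by (simp add: S_def)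
      then show False using n by (simp add: f'_def)
    qed
    then obtain a where a: "S = ennreal a" "0 < a"
      using Sfin by (cases S rule: ennreal_cases) (auto simp: less_le)
    have "\<exists>x. ennreal r < f' x" if "r < a" for r
    proof -
      have "ennreal r < S" using that a by (simp add: ennreal_lessI)
      then show ?thesis by (auto simp: S_def less_SUP_iff)
    qed
    moreover have "f' x \<le> ennreal a" for x using SUP_upper[of x UNIV f'] a by (simp add: S_def)
    ultimately show ?thesis using n a(2)
      by (intro bexI[of _ f'] exI[of _ a]) (auto simp: f'_def)
  qed
  obtain f' a where f'[measurable]: "f' \<in> borel_measurable borel" and f'2: "0 < a" "\<And>x. f' x \<le> f x"
    "ennreal \<alpha> < (\<integral>\<^sup>+ x. f' x \<partial>lborel)" "\<And>x. f' x \<le> ennreal a" "\<And>r. r < a \<Longrightarrow> \<exists>x. ennreal r < f' x"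
    using trunc[OF assms(1) \<alpha>] by blast
  obtain g' b where g'[measurable]: "g' \<in> borel_measurable borel" and g'2: "0 < b" "\<And>x. g' x \<le> g x"
    "ennreal \<beta> < (\<integral>\<^sup>+ x. g' x \<partial>lborel)" "\<And>x. g' x \<le> ennreal b" "\<And>r. r < b \<Longrightarrow> \<exists>x. ennreal r < g' x"
    using trunc[OF assms(2) \<beta>] by blast
  have emp: "{x. ennreal (c * l) < k x} = {}" if "\<And>x. k x \<le> ennreal c" "1 \<le> l" "0 < c" for c l and k :: "real \<Rightarrow> ennreal"
  proof -
    have "ennreal c \<le> ennreal (c * l)" using that by (intro ennreal_leI) simp
    then show ?thesis using that(1) by (auto simp: not_less) (meson leD order_trans)
  qed
  \<comment> \<open>the level of h that corresponds to the suprema of both truncations\<close>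
  define c where "c = a powr (1 - t) * b powr t"
  have c: "c > 0" using f'2(1) g'2(1) by (simp add: c_def)
  have level: "ennreal (1 - t) * emeasure lborel {x. ennreal (a * l) < f' x} + ennreal t * emeasure lborel {x. ennreal (b * l) < g' x}
      \<le> emeasure lborel {x. ennreal (c * l) < h x}" if l: "0 < l" "l < 1" for l
  proof (intro brunn_minkowski_real)
    show "{x. ennreal (a * l) < f' x} \<noteq> {}" using f'2(5)[of "a * l"] l f'2(1) by auto
    show "{x. ennreal (b * l) < g' x} \<noteq> {}" using g'2(5)[of "b * l"] l g'2(1) by auto
    fix x y assume x: "x \<in> {x. ennreal (a * l) < f' x}" and y: "y \<in> {x. ennreal (b * l) < g' x}"
    from x have "ennreal (a * l) < f x" using f'2(2) by (auto intro: less_le_trans)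
    then obtain r1 where r1: "ennreal (a * l) < ennreal r1" "ennreal r1 < f x" "0 \<le> r1"
      using ennreal_cases dense by (metis not_top_less top.not_eq_extremum)
    from y have "ennreal (b * l) < g y" using g'2(2) by (auto intro: less_le_trans)
    then obtain r2 where r2: "ennreal (b * l) < ennreal r2" "ennreal r2 < g y" "0 \<le> r2"
      using ennreal_cases dense by (metis not_top_less top.not_eq_extremum)
    have r1': "a * l < r1" and r2': "b * l < r2" using r1 r2 l f'2(1) g'2(1) by (auto simp: ennreal_less_iff)
    have al: "0 < a * l" "0 < b * l" using l f'2(1) g'2(1) by auto
    have "c * l = (a powr (1 - t) * b powr t) * (l powr (1 - t) * l powr t)"
      using l by (simp add: c_def flip: powr_add)
    also have "\<dots> = (a * l) powr (1 - t) * (b * l) powr t"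
      using l f'2(1) g'2(1) by (simp add: powr_mult)
    also have "\<dots> < r1 powr (1 - t) * r2 powr t"
      using r1' r2' al t by (intro mult_strict_mono powr_less_mono2) auto
    finally have "ennreal (c * l) < ennreal (r1 powr (1 - t) * r2 powr t)"
      using c l by (intro ennreal_lessI) (auto intro: le_less_trans[rotated])
    also have "\<dots> \<le> h ((1 - t) * x + t * y)"
      using r1' r2' al r1 r2 by (intro le) auto
    finally show "(1 - t) * x + t * y \<in> {x. ennreal (c * l) < h x}" by simp
  qed (use t in measurable)
  have [measurable]: "(\<lambda>l. emeasure lborel {x. ennreal (d * l) < k x}) \<in> borel_measurable borel"
    if [measurable]: "k \<in> borel_measurable borel" for k :: "real \<Rightarrow> ennreal" and d
    by (rule lborel.measurable_emeasure) measurable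
  have "\<alpha> powr (1 - t) * \<beta> powr t = c * ((\<alpha> / a) powr (1 - t) * (\<beta> / b) powr t)"
    using f'2(1) g'2(1) pos by (simp add: c_def powr_divide)
  also have "\<dots> \<le> c * ((1 - t) * (\<alpha> / a) + t * (\<beta> / b))"
    using Youngs_inequality_0[of "1 - t" t "\<alpha> / a" "\<beta> / b"] t pos f'2(1) g'2(1) c
    by (intro mult_left_mono) auto
  finally have "ennreal (\<alpha> powr (1 - t) * \<beta> powr t) \<le> ennreal (c * ((1 - t) * (\<alpha> / a) + t * (\<beta> / b)))"
    by (rule ennreal_leI)
  also have "\<dots> = ennreal c * (ennreal (1 - t) * (ennreal (1 / a) * ennreal \<alpha>) + ennreal t * (ennreal (1 / b) * ennreal \<beta>))"
    using t pos f'2(1) g'2(1) c by (simp add: ennreal_mult[symmetric] ennreal_plus[symmetric] del: ennreal_plus)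
  also have "\<dots> \<le> ennreal c * (ennreal (1 - t) * (ennreal (1 / a) * (\<integral>\<^sup>+ x. f' x \<partial>lborel)) + ennreal t * (ennreal (1 / b) * (\<integral>\<^sup>+ x. g' x \<partial>lborel)))"
    using f'2(3) g'2(3) by (intro mult_left_mono add_mono) auto
  also have "\<dots> = ennreal c * (ennreal (1 - t) * (\<integral>\<^sup>+ l. indicator {0<..} l * emeasure lborel {x. ennreal (a * l) < f' x} \<partial>lborel)
      + ennreal t * (\<integral>\<^sup>+ l. indicator {0<..} l * emeasure lborel {x. ennreal (b * l) < g' x} \<partial>lborel))"
    using f'2(1) g'2(1)
    by (simp add: nn_integral_layer_cake_scaled[OF f' f'2(1)] nn_integral_layer_cake_scaled[OF g' g'2(1)]
       mult.assoc[symmetric] ennreal_mult[symmetric])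
  also have "\<dots> = ennreal c * (\<integral>\<^sup>+ l. indicator {0<..} l * (ennreal (1 - t) * emeasure lborel {x. ennreal (a * l) < f' x} + ennreal t * emeasure lborel {x. ennreal (b * l) < g' x}) \<partial>lborel)"
    by (simp add: nn_integral_cmult[symmetric] nn_integral_add[symmetric] distrib_left mult.left_commute)
  also have "\<dots> \<le> ennreal c * (\<integral>\<^sup>+ l. indicator {0<..} l * emeasure lborel {x. ennreal (c * l) < h x} \<partial>lborel)"
  proof (rule mult_left_mono[OF nn_integral_mono])
    fix l :: real
    show "indicator {0<..} l * (ennreal (1 - t) * emeasure lborel {x. ennreal (a * l) < f' x} + ennreal t * emeasure lborel {x. ennreal (b * l) < g' x})
       \<le> indicator {0<..} l * emeasure lborel {x. ennreal (c * l) < h x}"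
    proof (cases "0 < l \<and> l < 1")
      case True then show ?thesis using level[of l] by simp
    next
      case False
      have "{x. ennreal (a * l) < f' x} = {}" "{x. ennreal (b * l) < g' x} = {}" if "0 < l"
        using emp[where k = f' and c = a, OF f'2(4) _ f'2(1)] emp[where k = g' and c = b, OF g'2(4) _ g'2(1)] False that by auto
      then show ?thesis by (cases "0 < l") simp_all
    qed
  qed simp
  also have "\<dots> = (\<integral>\<^sup>+ x. h x \<partial>lborel)" by (rule nn_integral_layer_cake_scaled[symmetric]) (use c in auto)
  finally show ?thesis .
qed

interpretation lborel_PiM: product_sigma_finite "\<lambda>_. lborel :: real measure"
  by standard

text \<open>
  Induction on the coordinates: by the one-dimensional case, the partial integrals over one coordinate
  satisfy the hypothesis in the remaining ones.
\<close>
theorem prekopa_leindler: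
  fixes f g h :: "('i \<Rightarrow> real) \<Rightarrow> ennreal"
  assumes "finite I"
    and [measurable]: "f \<in> borel_measurable (PiM I (\<lambda>_. lborel))" "g \<in> borel_measurable (PiM I (\<lambda>_. lborel))"
      "h \<in> borel_measurable (PiM I (\<lambda>_. lborel))"
    and t: "0 < t" "t < 1"
    and le: "\<And>x y a b. x \<in> space (PiM I (\<lambda>_. lborel)) \<Longrightarrow> y \<in> space (PiM I (\<lambda>_. lborel)) \<Longrightarrow> 0 < a \<Longrightarrow> 0 < b \<Longrightarrow>
      ennreal a < f x \<Longrightarrow> ennreal b < g y \<Longrightarrow>
      ennreal (a powr (1 - t) * b powr t) \<le> h (\<lambda>i. (1 - t) * x i + t * y i)"
    and pos: "0 < \<alpha>" "0 < \<beta>"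
    and \<alpha>: "ennreal \<alpha> < (\<integral>\<^sup>+ x. f x \<partial>PiM I (\<lambda>_. lborel))" and \<beta>: "ennreal \<beta> < (\<integral>\<^sup>+ x. g x \<partial>PiM I (\<lambda>_. lborel))"
  shows "ennreal (\<alpha> powr (1 - t) * \<beta> powr t) \<le> (\<integral>\<^sup>+ x. h x \<partial>PiM I (\<lambda>_. lborel))"
  using assms(1-4) le pos \<alpha> \<beta>
proof (induction I arbitrary: f g h \<alpha> \<beta> rule: finite_induct)
  case empty
  have "(\<lambda>i::'i. (1 - t) * undefined + t * undefined) = (\<lambda>_. undefined :: real)" by (auto simp: algebra_simps)
  then show ?case using empty.prems(4)[of "\<lambda>_. undefined" "\<lambda>_. undefined" \<alpha> \<beta>] empty.prems(5-)
    by (simp add: lborel_PiM.nn_integral_empty space_PiM)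
next
  case (insert i I)
  note [measurable] = insert.prems(1-3)
  have ins: "(\<integral>\<^sup>+ x. k x \<partial>PiM (insert i I) (\<lambda>_. lborel)) = (\<integral>\<^sup>+ x. (\<integral>\<^sup>+ s. k (x(i := s)) \<partial>lborel) \<partial>PiM I (\<lambda>_. lborel))"
    if "k \<in> borel_measurable (PiM (insert i I) (\<lambda>_. lborel))" for k :: "('i \<Rightarrow> real) \<Rightarrow> ennreal"
    using that insert.hyps by (intro lborel_PiM.product_nn_integral_insert) auto
  have meas1: "(\<lambda>s. k (x(i := s))) \<in> borel_measurable borel"
    if [measurable]: "k \<in> borel_measurable (PiM (insert i I) (\<lambda>_. lborel))" and x: "x \<in> space (PiM I (\<lambda>_. lborel))"
    for k :: "('i \<Rightarrow> real) \<Rightarrow> ennreal" and x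
  proof -
    have "(\<lambda>s. x(i := s)) \<in> measurable lborel (PiM (insert i I) (\<lambda>_. lborel))"
      using x by (intro measurable_component_update) (auto simp: insert.hyps)
    from measurable_compose[OF this that(1)] show ?thesis by simp
  qed
  have meas2: "(\<lambda>x. \<integral>\<^sup>+ s. k (x(i := s)) \<partial>lborel) \<in> borel_measurable (PiM I (\<lambda>_. lborel))"
    if [measurable]: "k \<in> borel_measurable (PiM (insert i I) (\<lambda>_. lborel))" for k :: "('i \<Rightarrow> real) \<Rightarrow> ennreal"
    by measurable
  show ?case
    unfolding ins[OF insert.prems(3)]
  proof (rule insert.IH[OF meas2[OF insert.prems(1)] meas2[OF insert.prems(2)] meas2[OF insert.prems(3)] _ insert.prems(5,6)
        insert.prems(7)[unfolded ins[OF insert.prems(1)]] insert.prems(8)[unfolded ins[OF insert.prems(2)]]])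
    fix x y :: "'i \<Rightarrow> real" and a b :: real
    assume xy: "x \<in> space (PiM I (\<lambda>_. lborel))" "y \<in> space (PiM I (\<lambda>_. lborel))" and ab: "0 < a" "0 < b"
      and af: "ennreal a < (\<integral>\<^sup>+ s. f (x(i := s)) \<partial>lborel)" and bg: "ennreal b < (\<integral>\<^sup>+ s. g (y(i := s)) \<partial>lborel)"
    have z: "(\<lambda>i. (1 - t) * x i + t * y i) \<in> space (PiM I (\<lambda>_. lborel))"
      using xy by (auto simp: space_PiM PiE_def extensional_def algebra_simps)
    show "ennreal (a powr (1 - t) * b powr t) \<le> (\<integral>\<^sup>+ s. h ((\<lambda>i. (1 - t) * x i + t * y i)(i := s)) \<partial>lborel)"
    proof (rule prekopa_leindler_real[OF meas1 meas1 meas1 t _ ab af bg])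
      fix u v a b :: real
      assume *: "0 < a" "0 < b" "ennreal a < f (x(i := u))" "ennreal b < g (y(i := v))"
      have eq: "(\<lambda>j. (1 - t) * (x(i := u)) j + t * (y(i := v)) j) = (\<lambda>i. (1 - t) * x i + t * y i)(i := (1 - t) * u + t * v)"
        by auto
      have "x(i := u) \<in> space (PiM (insert i I) (\<lambda>_. lborel))" "y(i := v) \<in> space (PiM (insert i I) (\<lambda>_. lborel))"
        using xy by (auto simp: space_PiM PiE_def extensional_def)
      from insert.prems(4)[OF this *] show "ennreal (a powr (1 - t) * b powr t) \<le> h ((\<lambda>i. (1 - t) * x i + t * y i)(i := (1 - t) * u + t * v))"
        unfolding eq .
    qed (use xy z insert.prems in auto)
  qed
qed

section \<open>Gaussian factors dominate Laplace factors\<close>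

abbreviation lborel_on :: "'i set \<Rightarrow> ('i \<Rightarrow> real) measure" where
  "lborel_on I \<equiv> PiM I (\<lambda>_. lborel)"

lemma nn_integral_lborel_on_affine:
  fixes f :: "('i \<Rightarrow> real) \<Rightarrow> ennreal"
  assumes "finite I" "f \<in> borel_measurable (lborel_on I)" "\<And>i. i \<in> I \<Longrightarrow> c i \<noteq> 0"
  shows "(\<integral>\<^sup>+ x. f x \<partial>lborel_on I) =
    ennreal (\<Prod>i\<in>I. \<bar>c i\<bar>) * (\<integral>\<^sup>+ x. f (\<lambda>i\<in>I. a i + c i * x i) \<partial>lborel_on I)"
  using assms
proof (induction I arbitrary: f rule: finite_induct)
  case empty
  then show ?case by (simp add: lborel_PiM.nn_integral_empty restrict_def del: nn_integral_const)
next
  case (insert i I)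
  note [measurable] = insert.prems(1)
  have [measurable]: "(\<lambda>x. f (\<lambda>j\<in>insert i I. a j + c j * x j)) \<in> borel_measurable (lborel_on (insert i I))"
    by (rule measurable_compose[OF _ insert.prems(1)]) measurable
  define g where "g = (\<lambda>x. \<integral>\<^sup>+ s. f (x(i := a i + c i * s)) \<partial>lborel)"
  have [measurable]: "g \<in> borel_measurable (lborel_on I)"
    unfolding g_def by measurable
  have meas1: "(\<lambda>s. f (x(i := s))) \<in> borel_measurable borel" if x: "x \<in> space (lborel_on I)" for x
  proof -
    have "(\<lambda>s. x(i := s)) \<in> measurable lborel (lborel_on (insert i I))"
      using x by (intro measurable_component_update) (auto simp: insert.hyps)
    from measurable_compose[OF this insert.prems(1)] show ?thesis unfolding measurable_lborel2 .
  qed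
  have "(\<integral>\<^sup>+ x. f x \<partial>lborel_on (insert i I)) = (\<integral>\<^sup>+ x. (\<integral>\<^sup>+ s. f (x(i := s)) \<partial>lborel) \<partial>lborel_on I)"
    using insert by (intro lborel_PiM.product_nn_integral_insert) auto
  also have "\<dots> = (\<integral>\<^sup>+ x. ennreal \<bar>c i\<bar> * g x \<partial>lborel_on I)"
  proof (intro nn_integral_cong)
    fix x assume "x \<in> space (lborel_on I)"
    from meas1[OF this] show "(\<integral>\<^sup>+ s. f (x(i := s)) \<partial>lborel) = ennreal \<bar>c i\<bar> * g x"
      unfolding g_def using insert.prems(2)[of i] by (subst nn_integral_real_affine[where c = "c i" and t = "a i"]) auto
  qed
  also have "\<dots> = ennreal \<bar>c i\<bar> * (ennreal (\<Prod>i\<in>I. \<bar>c i\<bar>) * (\<integral>\<^sup>+ x. g (\<lambda>i\<in>I. a i + c i * x i) \<partial>lborel_on I))"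
    using insert.prems by (simp add: nn_integral_cmult) (subst insert.IH[of g], auto)
  also have "\<dots> = ennreal (\<Prod>i\<in>insert i I. \<bar>c i\<bar>) * (\<integral>\<^sup>+ x. g (\<lambda>i\<in>I. a i + c i * x i) \<partial>lborel_on I)"
    using insert.hyps by (simp add: ennreal_mult prod_nonneg mult.assoc)
  also have "(\<integral>\<^sup>+ x. g (\<lambda>i\<in>I. a i + c i * x i) \<partial>lborel_on I)
      = (\<integral>\<^sup>+ x. (\<integral>\<^sup>+ s. f (\<lambda>j\<in>insert i I. a j + c j * (x(i := s)) j) \<partial>lborel) \<partial>lborel_on I)"
    unfolding g_def
  proof (intro nn_integral_cong arg_cong[where f = f])
    fix x s
    show "(\<lambda>i\<in>I. a i + c i * x i)(i := a i + c i * s) = (\<lambda>j\<in>insert i I. a j + c j * (x(i := s)) j)"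
      using insert.hyps by (auto simp: fun_eq_iff)
  qed
  also have "\<dots> = (\<integral>\<^sup>+ x. f (\<lambda>j\<in>insert i I. a j + c j * x j) \<partial>lborel_on (insert i I))"
    using insert by (intro lborel_PiM.product_nn_integral_insert[symmetric]) auto
  finally show ?case .
qed

lemma nn_integral_lborel_on_translate:
  fixes f :: "('i \<Rightarrow> real) \<Rightarrow> ennreal"
  assumes "finite I" "f \<in> borel_measurable (lborel_on I)"
  shows "(\<integral>\<^sup>+ x. f (\<lambda>i\<in>I. x i + a i) \<partial>lborel_on I) = (\<integral>\<^sup>+ x. f x \<partial>lborel_on I)"
  using nn_integral_lborel_on_affine[OF assms, of "\<lambda>_. 1" a] by (simp add: add.commute)

lemma nn_integral_lborel_on_uminus:
  fixes f :: "('i \<Rightarrow> real) \<Rightarrow> ennreal"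
  assumes "finite I" "f \<in> borel_measurable (lborel_on I)"
  shows "(\<integral>\<^sup>+ x. f (\<lambda>i\<in>I. - x i) \<partial>lborel_on I) = (\<integral>\<^sup>+ x. f x \<partial>lborel_on I)"
  using nn_integral_lborel_on_affine[OF assms, of "\<lambda>_. -1" "\<lambda>_. 0"] by simp

lemma nn_integral_lborel_on_scale:
  fixes f :: "('i \<Rightarrow> real) \<Rightarrow> ennreal"
  assumes "finite I" "f \<in> borel_measurable (lborel_on I)" "0 < c"
  shows "(\<integral>\<^sup>+ x. f x \<partial>lborel_on I) = ennreal (c ^ card I) * (\<integral>\<^sup>+ x. f (\<lambda>i\<in>I. c * x i) \<partial>lborel_on I)"
  using nn_integral_lborel_on_affine[OF assms(1,2), of "\<lambda>_. c" "\<lambda>_. 0"] assms(3) by simp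

lemma nn_integral_exp_neg_Ici: "(\<integral>\<^sup>+ s. ennreal (if 0 \<le> s then exp (- s) else 0) \<partial>lborel) = 1"
proof -
  have "(\<integral>\<^sup>+ s. ennreal (if 0 \<le> s then exp (- s) else 0) \<partial>lborel) = (\<integral>\<^sup>+ x. ennreal (x ^ 0 * exp (- x)) * indicator {0..} x \<partial>lborel)"
    by (intro nn_integral_cong) (auto simp: indicator_def)
  also have "\<dots> = 1" by (subst nn_intergal_power_times_exp_Ici) simp
  finally show ?thesis .
qed

lemma nn_integral_exp_neg_abs: "(\<integral>\<^sup>+ s. ennreal (exp (- \<bar>s\<bar>)) \<partial>lborel) = 2"
proof -
  define e where "e = (\<lambda>s::real. ennreal (if 0 \<le> s then exp (- s) else 0))"
  have [measurable]: "e \<in> borel_measurable borel" by (simp add: e_def)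
  have "(\<integral>\<^sup>+ s. ennreal (exp (- \<bar>s\<bar>)) \<partial>lborel) = (\<integral>\<^sup>+ s. e s + e (- s) \<partial>lborel)"
    by (intro nn_integral_cong_AE eventually_mono[OF AE_lborel_singleton[of 0]]) (auto simp: e_def)
  also have "\<dots> = (\<integral>\<^sup>+ s. e s \<partial>lborel) + (\<integral>\<^sup>+ s. e (0 + (-1) * s) \<partial>lborel)"
    by (simp add: nn_integral_add)
  also have "(\<integral>\<^sup>+ s. e (0 + (-1) * s) \<partial>lborel) = (\<integral>\<^sup>+ s. e s \<partial>lborel)"
    by (subst (2) nn_integral_real_affine[where c = "-1" and t = 0]) auto
  finally show ?thesis using nn_integral_exp_neg_Ici by (simp add: e_def)
qed

lemma nn_integral_gauss: assumes "c > 0" shows "(\<integral>\<^sup>+ s. ennreal (exp (- c * s\<^sup>2)) \<partial>lborel) = ennreal (sqrt (pi / c))"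
proof -
  have s: "has_bochner_integral lborel (\<lambda>x. normal_density 0 (sqrt (1 / (2 * c))) x) 1"
    using assms by (simp add: has_bochner_integral_iff)
  have "exp (- c * x\<^sup>2) = sqrt (pi / c) * normal_density 0 (sqrt (1 / (2 * c))) x" for x
    using assms by (simp add: normal_density_def real_sqrt_mult real_sqrt_divide power_divide power_mult_distrib)
  then have "has_bochner_integral lborel (\<lambda>x. exp (- c * x\<^sup>2)) (sqrt (pi / c))"
    using has_bochner_integral_mult_right[OF s, of "sqrt (pi / c)"] by simp
  then show ?thesis
    by (subst nn_integral_eq_integral) (auto simp: has_bochner_integral_iff)
qed

text \<open>
  Slice by the value r of the linear form. The slice integral G of exp (-c) is even and, by
  Prekopa-Leindler, decreasing in |r|. The functions p(r) = exp (-2 |r|) and q(r) = exp (-pi r^2) both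
  have integral 1, and q \<ge> p exactly for |r| \<le> s0 = 2 / pi. Hence (q - p) (G - G(s0)) \<ge> 0 pointwise, and
  integrating gives the claim.
\<close>
lemma laplace_le_gauss_section:
  fixes w :: "'i \<Rightarrow> real" and c :: "('i \<Rightarrow> real) \<Rightarrow> real"
  assumes I: "finite I"
    and [measurable]: "c \<in> borel_measurable (lborel_on I)"
    and conv: "\<And>x y t. 0 < t \<Longrightarrow> t < 1 \<Longrightarrow> c (\<lambda>i. (1 - t) * x i + t * y i) \<le> (1 - t) * c x + t * c y"
    and even: "\<And>x. c (\<lambda>i\<in>I. - x i) = c x"
  shows "(\<integral>\<^sup>+ x. ennreal (exp (- 2 * \<bar>\<Sum>i\<in>I. w i * x i\<bar>)) * ennreal (exp (- c x)) \<partial>lborel_on I)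
    \<le> (\<integral>\<^sup>+ x. ennreal (exp (- pi * (\<Sum>i\<in>I. w i * x i)\<^sup>2)) * ennreal (exp (- c x)) \<partial>lborel_on I)"
proof (cases "\<forall>i\<in>I. w i = 0")
  case True
  then show ?thesis by simp
next
  case False
  then obtain i where i: "i \<in> I" "w i \<noteq> 0" by auto
  define I' where "I' = I - {i}"
  have I': "I = insert i I'" "i \<notin> I'" "finite I'" using i I by (auto simp: I'_def)
  define \<sigma> where "\<sigma> x = (\<Sum>j\<in>I'. w j * x j)" for x :: "'i \<Rightarrow> real"
  have [measurable]: "\<sigma> \<in> borel_measurable (lborel_on I')" unfolding \<sigma>_def by measurable
  \<comment> \<open>the point with coordinates x outside i at which the linear form takes the value r\<close>
  define K where "K r x = x(i := (r - \<sigma> x) / w i)" for r x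
  interpret P: sigma_finite_measure "lborel_on I'" using I' by (intro lborel_PiM.sigma_finite)
  have [measurable]: "(\<lambda>(r, x). K r x) \<in> measurable (lborel \<Otimes>\<^sub>M lborel_on I') (lborel_on I)"
    unfolding K_def I'(1) by measurable
  have [measurable]: "(\<lambda>(x, r). K r x) \<in> measurable (lborel_on I' \<Otimes>\<^sub>M lborel) (lborel_on I)"
    unfolding K_def I'(1) by measurable
  have [measurable]: "K r \<in> measurable (lborel_on I') (lborel_on I)" for r
    unfolding K_def I'(1) by measurable
  define G where "G r = (\<integral>\<^sup>+ x. ennreal (exp (- c (K r x))) \<partial>lborel_on I')" for r
  have [measurable]: "G \<in> borel_measurable borel"
  proof -
    have "(\<lambda>r. \<integral>\<^sup>+ x. ennreal (exp (- c (K r x))) \<partial>lborel_on I') \<in> borel_measurable lborel"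
      by measurable
    then show ?thesis unfolding G_def measurable_lborel2 .
  qed
  have slice: "(\<integral>\<^sup>+ x. ennreal (\<phi> (\<Sum>i\<in>I. w i * x i)) * ennreal (exp (- c x)) \<partial>lborel_on I)
      = ennreal (1 / \<bar>w i\<bar>) * (\<integral>\<^sup>+ r. ennreal (\<phi> r) * G r \<partial>lborel)"
    if [measurable]: "\<phi> \<in> borel_measurable borel" for \<phi> :: "real \<Rightarrow> real"
  proof -
    have meas1: "(\<lambda>s. k (x(i := s))) \<in> borel_measurable borel"
      if [measurable]: "k \<in> borel_measurable (lborel_on I)" and x: "x \<in> space (lborel_on I')"
      for k :: "('i \<Rightarrow> real) \<Rightarrow> ennreal" and x
    proof -
      have "(\<lambda>s. x(i := s)) \<in> measurable lborel (lborel_on I)"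
        unfolding I'(1) using x by (intro measurable_component_update) (auto simp: I')
      from measurable_compose[OF this that(1)] show ?thesis unfolding measurable_lborel2 .
    qed
    have "(\<integral>\<^sup>+ x. ennreal (\<phi> (\<Sum>i\<in>I. w i * x i)) * ennreal (exp (- c x)) \<partial>lborel_on I)
      = (\<integral>\<^sup>+ x. (\<integral>\<^sup>+ s. ennreal (\<phi> (\<Sum>j\<in>I. w j * (x(i := s)) j)) * ennreal (exp (- c (x(i := s)))) \<partial>lborel) \<partial>lborel_on I')"
      unfolding I'(1) using I' by (intro lborel_PiM.product_nn_integral_insert) (auto simp flip: I'(1))
    also have "\<dots> = (\<integral>\<^sup>+ x. ennreal (1 / \<bar>w i\<bar>) * (\<integral>\<^sup>+ r. ennreal (\<phi> r) * ennreal (exp (- c (K r x))) \<partial>lborel) \<partial>lborel_on I')"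
    proof (intro nn_integral_cong)
      fix x assume x: "x \<in> space (lborel_on I')"
      have lin: "(\<Sum>j\<in>I. w j * (x(i := - \<sigma> x / w i + 1 / w i * r)) j) = r" for r
      proof -
        have "(\<Sum>j\<in>I'. w j * (x(i := - \<sigma> x / w i + 1 / w i * r)) j) = \<sigma> x"
          unfolding \<sigma>_def using I'(2) by (intro sum.cong) auto
        then show ?thesis unfolding I'(1) using I' i(2) by (simp add: field_simps)
      qed
      have K: "x(i := - \<sigma> x / w i + 1 / w i * r) = K r x" for r
        unfolding K_def using i by (simp add: field_simps)
      have "(\<integral>\<^sup>+ s. ennreal (\<phi> (\<Sum>j\<in>I. w j * (x(i := s)) j)) * ennreal (exp (- c (x(i := s)))) \<partial>lborel)
        = ennreal \<bar>1 / w i\<bar> * (\<integral>\<^sup>+ r. ennreal (\<phi> (\<Sum>j\<in>I. w j * (x(i := - \<sigma> x / w i + 1 / w i * r)) j))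
           * ennreal (exp (- c (x(i := - \<sigma> x / w i + 1 / w i * r)))) \<partial>lborel)"
        using i meas1[OF _ x, of "\<lambda>x. ennreal (\<phi> (\<Sum>j\<in>I. w j * x j)) * ennreal (exp (- c x))"]
        by (intro nn_integral_real_affine) auto
      then show "(\<integral>\<^sup>+ s. ennreal (\<phi> (\<Sum>j\<in>I. w j * (x(i := s)) j)) * ennreal (exp (- c (x(i := s)))) \<partial>lborel)
        = ennreal (1 / \<bar>w i\<bar>) * (\<integral>\<^sup>+ r. ennreal (\<phi> r) * ennreal (exp (- c (K r x))) \<partial>lborel)"
        unfolding lin unfolding K by simp
    qed
    also have "\<dots> = ennreal (1 / \<bar>w i\<bar>) * (\<integral>\<^sup>+ x. (\<integral>\<^sup>+ r. ennreal (\<phi> r) * ennreal (exp (- c (K r x))) \<partial>lborel) \<partial>lborel_on I')"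
      by (intro nn_integral_cmult) measurable
    also have "(\<integral>\<^sup>+ x. (\<integral>\<^sup>+ r. ennreal (\<phi> r) * ennreal (exp (- c (K r x))) \<partial>lborel) \<partial>lborel_on I')
      = (\<integral>\<^sup>+ r. (\<integral>\<^sup>+ x. ennreal (\<phi> r) * ennreal (exp (- c (K r x))) \<partial>lborel_on I') \<partial>lborel)"
    proof -
      interpret pair_sigma_finite "lborel_on I'" "lborel :: real measure" ..
      show ?thesis by (intro Fubini'[symmetric]) measurable
    qed
    also have "\<dots> = (\<integral>\<^sup>+ r. ennreal (\<phi> r) * G r \<partial>lborel)"
      unfolding G_def by (intro nn_integral_cong nn_integral_cmult) measurable
    finally show ?thesis .
  qed
  have G_even: "G (- r) = G r" for r
  proof -
    have "G (- r) = (\<integral>\<^sup>+ x. ennreal (exp (- c (K (- r) (\<lambda>i\<in>I'. - x i)))) \<partial>lborel_on I')"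
      unfolding G_def using I'(3) by (intro nn_integral_lborel_on_uminus[symmetric]) measurable
    also have "\<dots> = G r"
      unfolding G_def
    proof (intro nn_integral_cong)
      fix x assume "x \<in> space (lborel_on I')"
      have "\<sigma> (\<lambda>i\<in>I'. - x i) = - \<sigma> x" by (simp add: \<sigma>_def sum_negf)
      then have "K (- r) (\<lambda>i\<in>I'. - x i) = (\<lambda>i\<in>I. - K r x i)"
        using i I' by (auto simp: K_def fun_eq_iff field_simps)
      then show "ennreal (exp (- c (K (- r) (\<lambda>i\<in>I'. - x i)))) = ennreal (exp (- c (K r x)))"
        by (simp add: even)
    qed
    finally show ?thesis .
  qed
  have G_mono: "G r' \<le> G r" if r: "\<bar>r\<bar> < r'" for r r'
  proof (rule dense_le)
    fix z assume z: "z < G r'"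
    show "z \<le> G r"
    proof (cases "z = 0")
      case False
      have "z < top" using z by (meson less_le_trans top_greatest)
      then obtain \<alpha> where \<alpha>: "z = ennreal \<alpha>" "0 < \<alpha>" using False by (cases z rule: ennreal_cases) (auto simp: less_le)
      \<comment> \<open>r is the convex combination of r' and -r' with this weight\<close>
      define t where "t = (r' - r) / (2 * r')"
      have t: "0 < t" "t < 1" using r by (auto simp: t_def field_simps)
      have rt: "r = (1 - t) * r' + t * (- r')" using r by (auto simp: t_def field_simps)
      have "ennreal (\<alpha> powr (1 - t) * \<alpha> powr t) \<le> (\<integral>\<^sup>+ x. ennreal (exp (- c (K r x))) \<partial>lborel_on I')"
      proof (rule prekopa_leindler[OF I'(3) _ _ _ t _ \<alpha>(2) \<alpha>(2)])
        show "ennreal \<alpha> < (\<integral>\<^sup>+ x. ennreal (exp (- c (K r' x))) \<partial>lborel_on I')"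
          using z by (simp add: \<alpha> G_def)
        show "ennreal \<alpha> < (\<integral>\<^sup>+ x. ennreal (exp (- c (K (- r') x))) \<partial>lborel_on I')"
          using z G_even[of r'] by (simp add: \<alpha> G_def)
        fix x y a b assume ab: "0 < a" "0 < (b::real)" "ennreal a < ennreal (exp (- c (K r' x)))" "ennreal b < ennreal (exp (- c (K (- r') y)))"
        have Klin: "K r (\<lambda>i. (1 - t) * x i + t * y i) = (\<lambda>i. (1 - t) * K r' x i + t * K (- r') y i)"
        proof -
          have eq: "\<sigma> (\<lambda>i. (1 - t) * x i + t * y i) = (1 - t) * \<sigma> x + t * \<sigma> y"
            by (simp add: \<sigma>_def sum.distrib sum_distrib_left distrib_left mult.left_commute)
          have "(r - ((1 - t) * A + t * B)) / w i = (1 - t) * ((r' - A) / w i) + t * ((- r' - B) / w i)" for A B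
            using i by (simp add: rt field_simps)
          then show ?thesis by (auto simp: K_def fun_eq_iff eq)
        qed
        have "a powr (1 - t) * b powr t \<le> exp (- c (K r' x)) powr (1 - t) * exp (- c (K (- r') y)) powr t"
          using ab t by (intro mult_mono powr_mono2) (auto simp: ennreal_less_iff)
        also have "\<dots> = exp (- ((1 - t) * c (K r' x) + t * c (K (- r') y)))"
          by (simp add: powr_def exp_add[symmetric] algebra_simps)
        also have "\<dots> \<le> exp (- c (K r (\<lambda>i. (1 - t) * x i + t * y i)))"
          unfolding Klin using conv[OF t, of "K r' x" "K (- r') y"] by simp
        finally show "ennreal (a powr (1 - t) * b powr t) \<le> ennreal (exp (- c (K r (\<lambda>i. (1 - t) * x i + t * y i))))"
          by (rule ennreal_leI)
      qed measurable
      then show ?thesis using \<alpha> by (simp add: G_def flip: powr_add)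
    qed simp
  qed
  have G_mono': "G r' \<le> G r" if "\<bar>r\<bar> \<le> r'" for r r'
    using G_mono[of r r'] G_even[of r'] that by (cases "\<bar>r\<bar> = r'") (auto simp: abs_if split: if_splits)
  have G_mono'': "G r' \<le> G r" if "r \<le> \<bar>r'\<bar>" "0 \<le> r" for r r'
    using G_mono'[of r "\<bar>r'\<bar>"] G_even[of r'] that by (auto simp: abs_if split: if_splits)
  define p where "p r = exp (- 2 * \<bar>r\<bar>)" for r :: real
  define q where "q r = exp (- pi * r\<^sup>2)" for r :: real
  have [measurable]: "p \<in> borel_measurable borel" "q \<in> borel_measurable borel" unfolding p_def q_def by measurable
  have ip: "(\<integral>\<^sup>+ r. ennreal (p r) \<partial>lborel) = 1"
  proof -
    have "(2::ennreal) = ennreal \<bar>2\<bar> * (\<integral>\<^sup>+ r. ennreal (exp (- \<bar>0 + 2 * r\<bar>)) \<partial>lborel)"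
      unfolding nn_integral_exp_neg_abs[symmetric] by (rule nn_integral_real_affine) auto
    also have "\<dots> = 2 * (\<integral>\<^sup>+ r. ennreal (p r) \<partial>lborel)"
      by (simp add: p_def abs_mult)
    finally have "2 * 1 = 2 * (\<integral>\<^sup>+ r. ennreal (p r) \<partial>lborel)" by simp
    then show ?thesis by (subst (asm) ennreal_mult_cancel_left) auto
  qed
  have iq: "(\<integral>\<^sup>+ r. ennreal (q r) \<partial>lborel) = 1"
    unfolding q_def using nn_integral_gauss[of pi] by simp
  define s0 where "s0 = 2 / pi"
  have s0: "s0 > 0" by (simp add: s0_def)
  have pq1: "p r \<le> q r" if "\<bar>r\<bar> \<le> s0" for r
  proof -
    have "\<bar>r\<bar> * (pi * \<bar>r\<bar>) \<le> \<bar>r\<bar> * 2" using that by (intro mult_left_mono) (auto simp: s0_def field_simps)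
    moreover have "pi * r\<^sup>2 = \<bar>r\<bar> * (pi * \<bar>r\<bar>)" by (cases "0 \<le> r") (auto simp: power2_eq_square)
    ultimately have "pi * r\<^sup>2 \<le> 2 * \<bar>r\<bar>" by linarith
    then show ?thesis by (simp add: p_def q_def)
  qed
  have pq2: "q r \<le> p r" if "s0 \<le> \<bar>r\<bar>" for r
  proof -
    have "\<bar>r\<bar> * 2 \<le> \<bar>r\<bar> * (pi * \<bar>r\<bar>)" using that by (intro mult_left_mono) (auto simp: s0_def field_simps)
    moreover have "pi * r\<^sup>2 = \<bar>r\<bar> * (pi * \<bar>r\<bar>)" by (cases "0 \<le> r") (auto simp: power2_eq_square)
    ultimately have "2 * \<bar>r\<bar> \<le> pi * r\<^sup>2" by linarith
    then show ?thesis by (simp add: p_def q_def)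
  qed
  have rearr: "ennreal a * g1 + ennreal b * g2 \<le> ennreal b * g1 + ennreal a * g2" if "0 \<le> a" "a \<le> b" "g2 \<le> g1" for a b :: real and g1 g2 :: ennreal
  proof -
    obtain d where d: "b = a + d" "0 \<le> d" using \<open>a \<le> b\<close> by (metis add_diff_cancel_left' diff_ge_0_iff_ge le_add_diff_inverse)
    have "ennreal d * g2 \<le> ennreal d * g1" using that by (intro mult_left_mono) auto
    then show ?thesis using d that by (simp add: distrib_right add_mono add.assoc add.left_commute)
  qed
  \<comment> \<open>(q - p) (G - G(s0)) \<ge> 0, with every term on the side where it is positive\<close>
  have "(\<integral>\<^sup>+ r. ennreal (p r) * G r \<partial>lborel) + G s0 = (\<integral>\<^sup>+ r. ennreal (p r) * G r + ennreal (q r) * G s0 \<partial>lborel)"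
    by (simp add: nn_integral_add nn_integral_multc iq)
  also have "\<dots> \<le> (\<integral>\<^sup>+ r. ennreal (q r) * G r + ennreal (p r) * G s0 \<partial>lborel)"
  proof (intro nn_integral_mono)
    fix r
    show "ennreal (p r) * G r + ennreal (q r) * G s0 \<le> ennreal (q r) * G r + ennreal (p r) * G s0"
    proof (cases "\<bar>r\<bar> \<le> s0")
      case True
      then show ?thesis using rearr[OF _ pq1[OF True] G_mono'[OF True]] by (simp add: p_def)
    next
      case False
      then show ?thesis using rearr[OF _ pq2 G_mono''[of s0 r], of r] s0 by (simp add: q_def add.commute)
    qed
  qed
  also have "\<dots> = (\<integral>\<^sup>+ r. ennreal (q r) * G r \<partial>lborel) + G s0"
    by (simp add: nn_integral_add nn_integral_multc ip)
  finally have main: "(\<integral>\<^sup>+ r. ennreal (p r) * G r \<partial>lborel) + G s0 \<le> (\<integral>\<^sup>+ r. ennreal (q r) * G r \<partial>lborel) + G s0" .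
  have "(\<integral>\<^sup>+ r. ennreal (p r) * G r \<partial>lborel) \<le> (\<integral>\<^sup>+ r. ennreal (q r) * G r \<partial>lborel)"
  proof (cases "G s0 = top")
    case False
    then show ?thesis using main by (simp add: ennreal_add_left_cancel_le add.commute)
  next
    case True
    \<comment> \<open>G cannot be cancelled here, but it is then infinite on an interval\<close>
    have "top = (\<integral>\<^sup>+ r. top * indicator {-s0..s0} r \<partial>lborel)"
      using s0 by (subst nn_integral_cmult_indicator) (auto simp: ennreal_top_mult)
    also have "\<dots> \<le> (\<integral>\<^sup>+ r. ennreal (q r) * G r \<partial>lborel)"
    proof (intro nn_integral_mono)
      fix r
      show "top * indicator {-s0..s0} r \<le> ennreal (q r) * G r"
      proof (cases "\<bar>r\<bar> \<le> s0")
        case True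
        then have "G r = top" using G_mono'[OF True] \<open>G s0 = top\<close> by (simp add: top_unique)
        then show ?thesis by (simp add: q_def ennreal_mult_top)
      qed (auto simp: indicator_def)
    qed
    finally have "(\<integral>\<^sup>+ r. ennreal (q r) * G r \<partial>lborel) = top" by (simp add: top_unique)
    then show ?thesis by simp
  qed
  then show ?thesis
    using slice[of p] slice[of q] by (simp add: p_def q_def mult_left_mono)
qed

text \<open>
  The forms are treated one after the other. The exponent \<open>c m\<close> already carries Gaussian terms for the
  forms below m and still carries Laplace terms for the others; either kind is convex and even, so
  the previous lemma passes from m to m + 1.
\<close>
lemma laplace_le_gauss_subspace:
  fixes W :: "nat \<Rightarrow> nat \<Rightarrow> real"
  shows "(\<integral>\<^sup>+ h. ennreal (exp (- 2 * (\<Sum>j<n. \<bar>\<Sum>l<k. W j l * h l\<bar>))) \<partial>lborel_on {..<k})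
    \<le> (\<integral>\<^sup>+ h. ennreal (exp (- pi * (\<Sum>j<n. (\<Sum>l<k. W j l * h l)\<^sup>2))) \<partial>lborel_on {..<k})"
proof -
  define y where "y j h = (\<Sum>l<k. W j l * h l)" for j and h :: "nat \<Rightarrow> real"
  have [measurable]: "y j \<in> borel_measurable (lborel_on {..<k})" for j unfolding y_def by measurable
  define c where "c m h = 2 * (\<Sum>j\<in>{m..<n}. \<bar>y j h\<bar>) + pi * (\<Sum>j<m. (y j h)\<^sup>2)" for m h
  have [measurable]: "c m \<in> borel_measurable (lborel_on {..<k})" for m unfolding c_def by measurable
  have y_lin: "y j (\<lambda>i. (1 - t) * u i + t * v i) = (1 - t) * y j u + t * y j v" for j t u v
    by (simp add: y_def sum.distrib sum_distrib_left distrib_left mult.left_commute)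
  have y_neg: "y j (\<lambda>i\<in>{..<k}. - u i) = - y j u" for j u
    by (simp add: y_def sum_negf)
  have "(\<integral>\<^sup>+ h. ennreal (exp (- c 0 h)) \<partial>lborel_on {..<k}) \<le> (\<integral>\<^sup>+ h. ennreal (exp (- c m h)) \<partial>lborel_on {..<k})"
    if "m \<le> n" for m
    using that
  proof (induction m)
    case (Suc m)
    define d where "d h = 2 * (\<Sum>j\<in>{Suc m..<n}. \<bar>y j h\<bar>) + pi * (\<Sum>j<m. (y j h)\<^sup>2)" for h
    have c1: "c m h = 2 * \<bar>y m h\<bar> + d h" for h
      using Suc.prems by (simp add: c_def d_def sum.atLeast_Suc_lessThan)
    have c2: "c (Suc m) h = pi * (y m h)\<^sup>2 + d h" for h
      by (simp add: c_def d_def algebra_simps)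
    have "(\<integral>\<^sup>+ h. ennreal (exp (- 2 * \<bar>\<Sum>l<k. W m l * h l\<bar>)) * ennreal (exp (- d h)) \<partial>lborel_on {..<k})
      \<le> (\<integral>\<^sup>+ h. ennreal (exp (- pi * (\<Sum>l<k. W m l * h l)\<^sup>2)) * ennreal (exp (- d h)) \<partial>lborel_on {..<k})"
    proof (rule laplace_le_gauss_section)
      show "d \<in> borel_measurable (lborel_on {..<k})" unfolding d_def by measurable
      show "d (\<lambda>i\<in>{..<k}. - x i) = d x" for x by (simp add: d_def y_neg)
      fix u v :: "nat \<Rightarrow> real" and t :: real assume t: "0 < t" "t < 1"
      have abs: "\<bar>(1 - t) * a + t * b\<bar> \<le> (1 - t) * \<bar>a\<bar> + t * \<bar>b\<bar>" for a b
        using t abs_triangle_ineq[of "(1 - t) * a" "t * b"] by (simp add: abs_mult)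
      have sq: "((1 - t) * a + t * b)\<^sup>2 \<le> (1 - t) * a\<^sup>2 + t * b\<^sup>2" for a b
      proof -
        have "(1 - t) * a\<^sup>2 + t * b\<^sup>2 - ((1 - t) * a + t * b)\<^sup>2 = t * (1 - t) * (a - b)\<^sup>2"
          by (simp add: power2_eq_square algebra_simps)
        then show ?thesis using t by (smt (verit) mult_nonneg_nonneg zero_le_power2)
      qed
      have "d (\<lambda>i. (1 - t) * u i + t * v i) \<le> 2 * (\<Sum>j\<in>{Suc m..<n}. (1 - t) * \<bar>y j u\<bar> + t * \<bar>y j v\<bar>) + pi * (\<Sum>j<m. (1 - t) * (y j u)\<^sup>2 + t * (y j v)\<^sup>2)"
        unfolding d_def y_lin by (intro add_mono mult_left_mono sum_mono abs sq) auto
      also have "\<dots> = (1 - t) * d u + t * d v"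
        by (simp add: d_def sum.distrib flip: sum_distrib_left) (simp add: algebra_simps)
      finally show "d (\<lambda>i. (1 - t) * u i + t * v i) \<le> (1 - t) * d u + t * d v" .
    qed simp
    then have "(\<integral>\<^sup>+ h. ennreal (exp (- c m h)) \<partial>lborel_on {..<k}) \<le> (\<integral>\<^sup>+ h. ennreal (exp (- c (Suc m) h)) \<partial>lborel_on {..<k})"
      by (simp add: c1 c2 y_def[symmetric] ennreal_mult[symmetric] exp_add[symmetric])
    then show ?case using Suc by simp
  qed simp
  from this[of n] show ?thesis by (simp add: c_def y_def lessThan_atLeast0)
qed

section \<open>Fibre masses of the product exponential density\<close>

text \<open>The density of n independent standard exponential variables.\<close>
definition expd :: "nat \<Rightarrow> (nat \<Rightarrow> real) \<Rightarrow> real" where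
  "expd n x = (if \<forall>j<n. 0 \<le> x j then exp (- (\<Sum>j<n. x j)) else 0)"

definition lin_app :: "nat \<Rightarrow> (nat \<Rightarrow> nat \<Rightarrow> real) \<Rightarrow> (nat \<Rightarrow> real) \<Rightarrow> nat \<Rightarrow> real" where
  "lin_app k W h j = (\<Sum>l<k. W j l * h l)"

text \<open>
  The mass of the product exponential law on the fibre through x parallel to the range of W,
  measured in the coordinates h of that fibre.
\<close>
definition fiber_mass :: "nat \<Rightarrow> nat \<Rightarrow> (nat \<Rightarrow> nat \<Rightarrow> real) \<Rightarrow> (nat \<Rightarrow> real) \<Rightarrow> ennreal" where
  "fiber_mass n k W x = (\<integral>\<^sup>+ h. ennreal (expd n (\<lambda>j. x j + lin_app k W h j)) \<partial>lborel_on {..<k})"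

lemma expd_eq_prod: "ennreal (expd n x) = (\<Prod>j<n. ennreal (if 0 \<le> x j then exp (- x j) else 0))"
proof (cases "\<forall>j<n. 0 \<le> x j")
  case True
  then show ?thesis by (simp add: expd_def prod_ennreal exp_sum sum_negf[symmetric])
next
  case False
  then have "(\<Prod>j<n. ennreal (if 0 \<le> x j then exp (- x j) else 0)) = 0"
    by (intro prod_zero) auto
  with False show ?thesis by (auto simp: expd_def)
qed

lemma expd_nonneg [simp]: "0 \<le> expd n x"
  by (simp add: expd_def)

lemma expd_cong: "(\<And>j. j < n \<Longrightarrow> x j = y j) \<Longrightarrow> expd n x = expd n y"
  by (auto simp: expd_def)

lemma nn_integral_expd: "(\<integral>\<^sup>+ x. ennreal (expd n x) \<partial>lborel_on {..<n}) = 1"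
  unfolding expd_eq_prod by (subst lborel_PiM.product_nn_integral_prod) (auto simp: nn_integral_exp_neg_Ici)

lemma measurable_expd [measurable (raw)]:
  assumes "\<And>j. j < n \<Longrightarrow> (\<lambda>w. f w j) \<in> borel_measurable M"
  shows "(\<lambda>w. expd n (f w)) \<in> borel_measurable M"
proof -
  have [measurable]: "(\<lambda>w. f w j) \<in> borel_measurable M" if "j \<in> {..<n}" for j using assms that by auto
  have "(\<lambda>w. expd n (f w)) = (\<lambda>w. if \<forall>j\<in>{..<n}. 0 \<le> f w j then exp (- (\<Sum>j<n. f w j)) else 0)"
    by (auto simp: expd_def)
  also have "\<dots> \<in> borel_measurable M" by measurable
  finally show ?thesis .
qed

text \<open>The logarithm of the density is linear on the nonnegative orthant, which is convex.\<close>
lemma expd_log_concave: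
  assumes t: "0 < t" "t < 1" and ab: "0 < a" "0 < b" "a < expd n x" "b < expd n y"
  shows "a powr (1 - t) * b powr t \<le> expd n (\<lambda>j. (1 - t) * x j + t * y j)"
proof -
  have pos: "\<forall>j<n. 0 \<le> x j" "\<forall>j<n. 0 \<le> y j" using ab by (auto simp: expd_def split: if_splits)
  have "a powr (1 - t) * b powr t \<le> expd n x powr (1 - t) * expd n y powr t"
    using ab t by (intro mult_mono powr_mono2) auto
  also have "\<dots> = expd n (\<lambda>j. (1 - t) * x j + t * y j)"
  proof -
    have "\<forall>j<n. 0 \<le> (1 - t) * x j + t * y j" using pos t by simp
    then show ?thesis
      using pos by (simp add: expd_def powr_def sum.distrib flip: exp_add sum_distrib_left)
  qed
  finally show ?thesis .
qed

context
  fixes n k :: nat and W :: "nat \<Rightarrow> nat \<Rightarrow> real"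
begin

lemma measurable_lin_app [measurable (raw)]:
  assumes "\<And>l. l < k \<Longrightarrow> (\<lambda>w. f w l) \<in> borel_measurable M"
  shows "(\<lambda>w. lin_app k W (f w) j) \<in> borel_measurable M"
  unfolding lin_app_def using assms by (intro borel_measurable_sum borel_measurable_times) auto

lemma lin_app_lin: "lin_app k W (\<lambda>i. a * u i + b * v i) j = a * lin_app k W u j + b * lin_app k W v j"
  by (simp add: lin_app_def sum.distrib sum_distrib_left distrib_left mult.left_commute)

lemma lin_app_scale: "lin_app k W (\<lambda>i. a * u i) j = a * lin_app k W u j"
  by (simp add: lin_app_def sum_distrib_left mult.left_commute)

lemma lin_app_restrict [simp]: "lin_app k W (restrict h {..<k}) = lin_app k W h"
  by (simp add: lin_app_def fun_eq_iff)

lemma nn_integral_exp_l1_double: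
  "(\<integral>\<^sup>+ h. ennreal (exp (- (\<Sum>j<n. \<bar>lin_app k W h j\<bar>))) \<partial>lborel_on {..<k})
    = ennreal (2 ^ k) * (\<integral>\<^sup>+ h. ennreal (exp (- 2 * (\<Sum>j<n. \<bar>lin_app k W h j\<bar>))) \<partial>lborel_on {..<k})"
proof -
  have "\<bar>lin_app k W (\<lambda>l. 2 * h l) j\<bar> = 2 * \<bar>lin_app k W h j\<bar>" for h j
    by (simp add: lin_app_scale)
  then have "- (\<Sum>j<n. \<bar>lin_app k W (\<lambda>l. 2 * h l) j\<bar>) = - 2 * (\<Sum>j<n. \<bar>lin_app k W h j\<bar>)" for h
    by (simp only: sum_distrib_left[symmetric] mult_minus_left)
  then show ?thesis
    by (subst nn_integral_lborel_on_scale[where c = 2])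
       (auto simp only: lin_app_restrict card_lessThan, auto)
qed

lemma fiber_mass_cong: "(\<And>j. j < n \<Longrightarrow> x j = y j) \<Longrightarrow> fiber_mass n k W x = fiber_mass n k W y"
  unfolding fiber_mass_def by (intro nn_integral_cong arg_cong[where f = ennreal] expd_cong) auto

lemma measurable_fiber_mass [measurable]: "fiber_mass n k W \<in> borel_measurable (lborel_on {..<n})"
proof -
  interpret P: sigma_finite_measure "lborel_on {..<k}" by (intro lborel_PiM.sigma_finite) simp
  show ?thesis unfolding fiber_mass_def by measurable
qed

lemma fiber_mass_shift: "fiber_mass n k W (\<lambda>j. x j + lin_app k W a j) = fiber_mass n k W x"
proof -
  have "fiber_mass n k W x = (\<integral>\<^sup>+ h. ennreal (expd n (\<lambda>j. x j + lin_app k W (\<lambda>i\<in>{..<k}. h i + a i) j)) \<partial>lborel_on {..<k})"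
    unfolding fiber_mass_def by (intro nn_integral_lborel_on_translate[symmetric]) measurable
  also have "\<dots> = fiber_mass n k W (\<lambda>j. x j + lin_app k W a j)"
    using lin_app_lin[of 1 _ 1 a] by (simp add: fiber_mass_def algebra_simps)
  finally show ?thesis ..
qed

text \<open>
  An integral over part of the variables of a function that is log-concave in all of them is log-concave
  in the remaining ones; the fibre coordinates are integrated out by Prekopa-Leindler.
\<close>
lemma fiber_mass_log_concave:
  assumes t: "0 < t" "t < 1" and ab: "0 < a" "0 < b"
    "ennreal a < fiber_mass n k W x" "ennreal b < fiber_mass n k W y"
  shows "ennreal (a powr (1 - t) * b powr t) \<le> fiber_mass n k W (\<lambda>j. (1 - t) * x j + t * y j)"
  unfolding fiber_mass_def
proof (rule prekopa_leindler[OF _ _ _ _ t _ ab(1,2) ab(3,4)[unfolded fiber_mass_def]])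
  fix u v a b assume *: "0 < a" "0 < (b::real)" "ennreal a < ennreal (expd n (\<lambda>j. x j + lin_app k W u j))"
    "ennreal b < ennreal (expd n (\<lambda>j. y j + lin_app k W v j))"
  have eq: "(\<lambda>j. (1 - t) * x j + t * y j + lin_app k W (\<lambda>i. (1 - t) * u i + t * v i) j)
    = (\<lambda>j. (1 - t) * (x j + lin_app k W u j) + t * (y j + lin_app k W v j))"
    by (rule ext, simp only: lin_app_lin) (simp add: algebra_simps)
  show "ennreal (a powr (1 - t) * b powr t) \<le> ennreal (expd n (\<lambda>j. (1 - t) * x j + t * y j + lin_app k W (\<lambda>i. (1 - t) * u i + t * v i) j))"
    unfolding eq using * by (intro ennreal_leI expd_log_concave t) (auto simp: ennreal_less_iff)
qed measurable

text \<open>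
  Mass transport: either side integrates A(x) B(y) over all pairs of points x, y on a common fibre, once
  with x and once with y as the base point. This is Fubini and the translation invariance of Lebesgue
  measure.
\<close>
lemma fiber_exchange:
  fixes A B :: "(nat \<Rightarrow> real) \<Rightarrow> ennreal"
  assumes [measurable]: "A \<in> borel_measurable (lborel_on {..<n})" "B \<in> borel_measurable (lborel_on {..<n})"
    and A: "\<And>x. A (restrict x {..<n}) = A x" and B: "\<And>x. B (restrict x {..<n}) = B x"
  shows "(\<integral>\<^sup>+ x. A x * (\<integral>\<^sup>+ h. B (\<lambda>j. x j - lin_app k W h j) \<partial>lborel_on {..<k}) \<partial>lborel_on {..<n})
    = (\<integral>\<^sup>+ x. B x * (\<integral>\<^sup>+ h. A (\<lambda>j. x j + lin_app k W h j) \<partial>lborel_on {..<k}) \<partial>lborel_on {..<n})"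
proof -
  interpret P: sigma_finite_measure "lborel_on {..<k}" by (intro lborel_PiM.sigma_finite) simp
  interpret Q: sigma_finite_measure "lborel_on {..<n}" by (intro lborel_PiM.sigma_finite) simp
  interpret pair_sigma_finite "lborel_on {..<n}" "lborel_on {..<k}" ..
  have [measurable]: "(\<lambda>(x, h). C (\<lambda>j. x j + s * lin_app k W h j)) \<in> borel_measurable (lborel_on {..<n} \<Otimes>\<^sub>M lborel_on {..<k})"
    if C: "C \<in> borel_measurable (lborel_on {..<n})" "\<And>x. C (restrict x {..<n}) = C x" for C :: "(nat \<Rightarrow> real) \<Rightarrow> ennreal" and s
  proof -
    have "(\<lambda>w. C (\<lambda>j\<in>{..<n}. fst w j + s * lin_app k W (snd w) j)) \<in> borel_measurable (lborel_on {..<n} \<Otimes>\<^sub>M lborel_on {..<k})"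
      by (rule measurable_compose[OF _ C(1)]) measurable
    then show ?thesis by (simp add: C(2) split_beta)
  qed
  note joint = this
  have [measurable]: "(\<lambda>(x, h). B (\<lambda>j. x j - lin_app k W h j)) \<in> borel_measurable (lborel_on {..<n} \<Otimes>\<^sub>M lborel_on {..<k})"
    using joint[OF assms(2) B, of "-1"] by simp
  have [measurable]: "(\<lambda>(x, h). A (\<lambda>j. x j + lin_app k W h j)) \<in> borel_measurable (lborel_on {..<n} \<Otimes>\<^sub>M lborel_on {..<k})"
    using joint[OF assms(1) A, of 1] by simp
  have "(\<integral>\<^sup>+ x. A x * (\<integral>\<^sup>+ h. B (\<lambda>j. x j - lin_app k W h j) \<partial>lborel_on {..<k}) \<partial>lborel_on {..<n})
    = (\<integral>\<^sup>+ x. (\<integral>\<^sup>+ h. A x * B (\<lambda>j. x j - lin_app k W h j) \<partial>lborel_on {..<k}) \<partial>lborel_on {..<n})"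
    by (intro nn_integral_cong nn_integral_cmult[symmetric]) measurable
  also have "\<dots> = (\<integral>\<^sup>+ h. (\<integral>\<^sup>+ x. A x * B (\<lambda>j. x j - lin_app k W h j) \<partial>lborel_on {..<n}) \<partial>lborel_on {..<k})"
    by (intro Fubini'[symmetric]) measurable
  also have "\<dots> = (\<integral>\<^sup>+ h. (\<integral>\<^sup>+ x. A (\<lambda>j. x j + lin_app k W h j) * B x \<partial>lborel_on {..<n}) \<partial>lborel_on {..<k})"
  proof (rule nn_integral_cong)
    fix h assume h: "h \<in> space (lborel_on {..<k})"
    have [measurable]: "(\<lambda>x. B (\<lambda>j. x j - lin_app k W h j)) \<in> borel_measurable (lborel_on {..<n})"
    proof -
      have "(\<lambda>x. B (\<lambda>j\<in>{..<n}. x j - lin_app k W h j)) \<in> borel_measurable (lborel_on {..<n})"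
        by (rule measurable_compose[OF _ assms(2)]) measurable
      then show ?thesis by (simp add: B)
    qed
    have Bx: "B (\<lambda>j. restrict (\<lambda>j. x j + lin_app k W h j) {..<n} j - lin_app k W h j) = B x" for x
      by (subst B[symmetric], subst (2) B[symmetric], intro arg_cong[where f = B]) (auto simp: fun_eq_iff)
    have "(\<integral>\<^sup>+ x. A x * B (\<lambda>j. x j - lin_app k W h j) \<partial>lborel_on {..<n})
      = (\<integral>\<^sup>+ x. A (\<lambda>j\<in>{..<n}. x j + lin_app k W h j) * B (\<lambda>j. restrict (\<lambda>j. x j + lin_app k W h j) {..<n} j - lin_app k W h j) \<partial>lborel_on {..<n})"
      by (intro nn_integral_lborel_on_translate[symmetric]) measurable
    then show "(\<integral>\<^sup>+ x. A x * B (\<lambda>j. x j - lin_app k W h j) \<partial>lborel_on {..<n})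
      = (\<integral>\<^sup>+ x. A (\<lambda>j. x j + lin_app k W h j) * B x \<partial>lborel_on {..<n})"
      by (simp only: Bx A)
  qed
  also have "\<dots> = (\<integral>\<^sup>+ x. (\<integral>\<^sup>+ h. A (\<lambda>j. x j + lin_app k W h j) * B x \<partial>lborel_on {..<k}) \<partial>lborel_on {..<n})"
    by (intro Fubini') measurable
  also have "\<dots> = (\<integral>\<^sup>+ x. B x * (\<integral>\<^sup>+ h. A (\<lambda>j. x j + lin_app k W h j) \<partial>lborel_on {..<k}) \<partial>lborel_on {..<n})"
    by (intro nn_integral_cong, subst mult.commute, intro nn_integral_cmult) measurable
  finally show ?thesis .
qed

end

section \<open>The upper bound for the central fibre mass\<close>

lemma nn_integral_exp_overlap:
  "(\<integral>\<^sup>+ s. ennreal (if 0 \<le> s then exp (- s) else 0) * ennreal (if 0 \<le> s + y then exp (- (s + y)) else 0) \<partial>lborel)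
    = ennreal (exp (- \<bar>y\<bar>) / 2)"
proof -
  define f where "f s = ennreal (if 0 \<le> s then exp (- s) else 0)" for s :: real
  have [measurable]: "f \<in> borel_measurable borel" unfolding f_def by measurable
  have half: "(\<integral>\<^sup>+ s. ennreal (if 0 \<le> s then exp (- 2 * s) else 0) \<partial>lborel) = ennreal (1 / 2)"
  proof -
    have "(\<integral>\<^sup>+ s. ennreal (if 0 \<le> s then exp (- 2 * s) else 0) \<partial>lborel) = ennreal \<bar>1 / 2\<bar> * (\<integral>\<^sup>+ s. f s \<partial>lborel)"
      by (subst nn_integral_real_affine[where c = "1 / 2" and t = 0]) (auto simp: f_def intro!: arg_cong2[where f = "(*)"] nn_integral_cong)
    then show ?thesis using nn_integral_exp_neg_Ici by (simp add: f_def)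
  qed
  have pos: "(\<integral>\<^sup>+ s. f s * f (s + y) \<partial>lborel) = ennreal (exp (- y) / 2)" if "0 \<le> y" for y
  proof -
    have "(\<integral>\<^sup>+ s. f s * f (s + y) \<partial>lborel) = (\<integral>\<^sup>+ s. ennreal (exp (- y)) * ennreal (if 0 \<le> s then exp (- 2 * s) else 0) \<partial>lborel)"
      using that by (intro nn_integral_cong) (auto simp: f_def simp flip: ennreal_mult exp_add)
    also have "\<dots> = ennreal (exp (- y)) * ennreal (1 / 2)"
      by (subst nn_integral_cmult, measurable) (simp only: half)
    also have "\<dots> = ennreal (exp (- y) / 2)"
      by (subst ennreal_mult[symmetric]) auto
    finally show ?thesis .
  qed
  have "(\<integral>\<^sup>+ s. f s * f (s + y) \<partial>lborel) = ennreal (exp (- \<bar>y\<bar>) / 2)"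
  proof (cases "0 \<le> y")
    case False
    have "(\<integral>\<^sup>+ s. f s * f (s + y) \<partial>lborel) = (\<integral>\<^sup>+ s. f s * f (s + (- y)) \<partial>lborel)"
      by (subst nn_integral_real_affine[where c = 1 and t = "- y"]) (auto simp: mult.commute add.commute)
    with False pos[of "- y"] show ?thesis by simp
  qed (use pos in simp)
  then show ?thesis by (simp add: f_def)
qed

text \<open>
  Log-concavity above is stated for reals strictly below the values; this turns it into an inequality
  between products of possibly infinite values.
\<close>
lemma ennreal_mult_le_of_less:
  fixes u v c :: ennreal
  assumes "\<And>a b. 0 < a \<Longrightarrow> 0 < b \<Longrightarrow> ennreal a < u \<Longrightarrow> ennreal b < v \<Longrightarrow> ennreal (a * b) \<le> c"
  shows "u * v \<le> c"
proof -
  have real: "\<exists>a>0. z = ennreal a" if "z < w" "z \<noteq> 0" for z w :: ennreal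
  proof -
    have "z < top" using that(1) by (meson less_le_trans top_greatest)
    then show ?thesis using that(2) by (cases z rule: ennreal_cases) (auto simp: less_le)
  qed
  have sup: "w = Sup {..<w}" for w :: ennreal
    by (rule antisym[OF dense_le Sup_least]) (auto intro: Sup_upper less_imp_le)
  have "u * v = Sup {..<u} * v"
    using sup[of u] by (rule arg_cong[where f = "\<lambda>w. w * v"])
  also have "\<dots> = (SUP a\<in>{..<u}. a * v)"
    by (rule SUP_mult_right_ennreal[of "\<lambda>x. x" "{..<u}" v, unfolded image_ident])
  also have "\<dots> \<le> c"
  proof (rule SUP_least)
    fix a assume a: "a \<in> {..<u}"
    have "a * v = a * Sup {..<v}"
      using sup[of v] by (rule arg_cong)
    also have "\<dots> = (SUP b\<in>{..<v}. a * b)"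
      by (rule SUP_mult_left_ennreal[of a "\<lambda>x. x" "{..<v}", unfolded image_ident])
    also have "\<dots> \<le> c"
    proof (rule SUP_least)
      fix b assume b: "b \<in> {..<v}"
      show "a * b \<le> c"
      proof (cases "a = 0 \<or> b = 0")
        case False
        then obtain a' b' where "0 < a'" "a = ennreal a'" "0 < b'" "b = ennreal b'" using a b real by blast
        then show ?thesis using assms[of a' b'] a b by (simp add: ennreal_mult)
      qed auto
    qed
    finally show "a * v \<le> c" .
  qed
  finally show ?thesis .
qed

text \<open>
  L is the left inverse of W for which W L is symmetric, so that W L is the orthogonal projection onto
  the range of W, and \<zeta> is the Gaussian integral over that range in the coordinates h. Keeping \<zeta> as a
  parameter separates the probabilistic argument from the evaluation of \<zeta> as
  (2 pi)^(k/2) / sqrt (det (W^T W)).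
\<close>
locale gauss_section =
  fixes n k :: nat and W L :: "nat \<Rightarrow> nat \<Rightarrow> real" and \<zeta> :: real
  assumes LW: "\<And>l l'. l < k \<Longrightarrow> l' < k \<Longrightarrow> (\<Sum>j<n. L l j * W j l') = (if l = l' then 1 else 0)"
    and sym: "\<And>i j. i < n \<Longrightarrow> j < n \<Longrightarrow> (\<Sum>l<k. W i l * L l j) = (\<Sum>l<k. W j l * L l i)"
    and gauss: "(\<integral>\<^sup>+ h. ennreal (exp (- (1 / 2) * (\<Sum>j<n. (lin_app k W h j)\<^sup>2))) \<partial>lborel_on {..<k}) = ennreal \<zeta>"
    and \<zeta>_pos: "0 < \<zeta>"
begin

definition P :: "nat \<Rightarrow> nat \<Rightarrow> real" where "P i j = (\<Sum>l<k. W i l * L l j)"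

definition proj :: "(nat \<Rightarrow> real) \<Rightarrow> nat \<Rightarrow> real" where "proj x i = (\<Sum>j<n. P i j * x j)"

definition coord :: "(nat \<Rightarrow> real) \<Rightarrow> nat \<Rightarrow> real" where "coord x l = (\<Sum>j<n. L l j * x j)"

lemma proj_eq: "proj x = lin_app k W (coord x)"
proof
  fix i
  have "proj x i = (\<Sum>j<n. \<Sum>l<k. W i l * (L l j * x j))"
    by (simp add: proj_def P_def sum_distrib_right mult.assoc)
  also have "\<dots> = (\<Sum>l<k. \<Sum>j<n. W i l * (L l j * x j))" by (rule sum.swap)
  finally show "proj x i = lin_app k W (coord x) i"
    by (simp add: lin_app_def coord_def sum_distrib_left)
qed

lemma coord_lin: "coord (\<lambda>j. a * x j + b * y j) l = a * coord x l + b * coord y l"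
  by (simp add: coord_def sum.distrib sum_distrib_left distrib_left mult.left_commute)

lemma coord_lin_app: assumes "l < k" shows "coord (lin_app k W h) l = h l"
proof -
  have "coord (lin_app k W h) l = (\<Sum>j<n. \<Sum>l'<k. L l j * W j l' * h l')"
    by (simp add: coord_def lin_app_def sum_distrib_left mult.assoc)
  also have "\<dots> = (\<Sum>l'<k. \<Sum>j<n. L l j * W j l' * h l')" by (rule sum.swap)
  also have "\<dots> = (\<Sum>l'<k. (if l = l' then h l' else 0))"
    using assms by (intro sum.cong refl) (simp add: LW flip: sum_distrib_right)
  also have "\<dots> = h l" using assms by simp
  finally show ?thesis .
qed

lemma lin_app_cong: "(\<And>l. l < k \<Longrightarrow> g l = h l) \<Longrightarrow> lin_app k W g = lin_app k W h"
  by (rule ext) (simp add: lin_app_def)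

lemma proj_shift: "proj (\<lambda>j. x j + s * lin_app k W h j) = lin_app k W (\<lambda>l. coord x l + s * h l)"
proof -
  have "coord (\<lambda>j. x j + s * lin_app k W h j) l = coord x l + s * h l" if "l < k" for l
    using coord_lin[of 1 x s "lin_app k W h" l] coord_lin_app[OF that] by simp
  then show ?thesis unfolding proj_eq by (rule lin_app_cong)
qed

text \<open>
  A weight that restricts to a Gaussian probability density on every fibre, see \<open>wt_fiber\<close> with c = 1.
  It is centred so that the point 1 maximises it on its own fibre.
\<close>
definition wt :: "(nat \<Rightarrow> real) \<Rightarrow> ennreal" where
  "wt x = ennreal (1 / \<zeta>) * ennreal (exp (- (1 / 2) * (\<Sum>i<n. (proj (\<lambda>j. x j - 1) i)\<^sup>2)))"

lemma gauss_affine: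
  assumes "0 < c"
  shows "(\<integral>\<^sup>+ h. ennreal (exp (- (1 / 2) * (\<Sum>j<n. (lin_app k W (\<lambda>l. a l - c * h l) j)\<^sup>2))) \<partial>lborel_on {..<k}) = ennreal (\<zeta> / c ^ k)"
proof -
  define g where "g h = ennreal (exp (- (1 / 2) * (\<Sum>j<n. (lin_app k W h j)\<^sup>2)))" for h
  have [measurable]: "g \<in> borel_measurable (lborel_on {..<k})" unfolding g_def by measurable
  have "ennreal \<zeta> = (\<integral>\<^sup>+ h. g h \<partial>lborel_on {..<k})" by (simp only: g_def gauss)
  also have "\<dots> = ennreal (c ^ k) * (\<integral>\<^sup>+ h. g (\<lambda>l\<in>{..<k}. a l + (- c) * h l) \<partial>lborel_on {..<k})"
    using assms by (subst nn_integral_lborel_on_affine[where c = "\<lambda>_. - c" and a = a]) auto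
  also have "(\<integral>\<^sup>+ h. g (\<lambda>l\<in>{..<k}. a l + (- c) * h l) \<partial>lborel_on {..<k}) = (\<integral>\<^sup>+ h. g (\<lambda>l. a l - c * h l) \<partial>lborel_on {..<k})"
    by (simp add: g_def)
  finally have *: "ennreal \<zeta> = ennreal (c ^ k) * (\<integral>\<^sup>+ h. g (\<lambda>l. a l - c * h l) \<partial>lborel_on {..<k})" .
  have "ennreal (\<zeta> / c ^ k) = ennreal (1 / c ^ k) * ennreal \<zeta>"
    using assms \<zeta>_pos by (subst ennreal_mult[symmetric]) auto
  also have "\<dots> = ennreal (1 / c ^ k) * ennreal (c ^ k) * (\<integral>\<^sup>+ h. g (\<lambda>l. a l - c * h l) \<partial>lborel_on {..<k})"
    unfolding * mult.assoc ..
  also have "ennreal (1 / c ^ k) * ennreal (c ^ k) = 1"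
    using assms by (subst ennreal_mult[symmetric]) auto
  finally show ?thesis by (simp only: g_def mult_1)
qed

lemma wt_fiber:
  assumes "0 < c"
  shows "(\<integral>\<^sup>+ h. wt (\<lambda>j. c * (x j - lin_app k W h j) + b) \<partial>lborel_on {..<k}) = ennreal (1 / c ^ k)"
proof -
  have "proj (\<lambda>j. c * (x j - lin_app k W h j) + b - 1) = lin_app k W (\<lambda>l. coord (\<lambda>j. c * x j + b - 1) l - c * h l)" for h
    using proj_shift[of "\<lambda>j. c * x j + b - 1" "- c" h] by (simp add: algebra_simps)
  then have "(\<integral>\<^sup>+ h. wt (\<lambda>j. c * (x j - lin_app k W h j) + b) \<partial>lborel_on {..<k})
    = (\<integral>\<^sup>+ h. ennreal (1 / \<zeta>) * ennreal (exp (- (1 / 2) * (\<Sum>j<n. (lin_app k W (\<lambda>l. coord (\<lambda>j. c * x j + b - 1) l - c * h l) j)\<^sup>2))) \<partial>lborel_on {..<k})"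
    by (simp add: wt_def)
  also have "\<dots> = ennreal (1 / \<zeta>) * ennreal (\<zeta> / c ^ k)"
    by (subst nn_integral_cmult, measurable) (simp only: gauss_affine[OF assms])
  also have "\<dots> = ennreal (1 / c ^ k)" using assms \<zeta>_pos by (subst ennreal_mult[symmetric]) auto
  finally show ?thesis .
qed

lemma measurable_proj [measurable (raw)]:
  assumes "\<And>j. j < n \<Longrightarrow> (\<lambda>w. f w j) \<in> borel_measurable M"
  shows "(\<lambda>w. proj (f w) i) \<in> borel_measurable M"
  unfolding proj_def using assms by (intro borel_measurable_sum borel_measurable_times) auto

lemma measurable_wt [measurable (raw)]:
  assumes "\<And>j. j < n \<Longrightarrow> (\<lambda>w. f w j) \<in> borel_measurable M"
  shows "(\<lambda>w. wt (f w)) \<in> borel_measurable M"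
proof -
  have "(\<lambda>w. proj (\<lambda>j. f w j - 1) i) \<in> borel_measurable M" for i
    using assms by (intro measurable_proj) auto
  then show ?thesis unfolding wt_def by measurable
qed

lemma proj_cong: "(\<And>j. j < n \<Longrightarrow> x j = y j) \<Longrightarrow> proj x = proj y"
  by (auto simp: proj_def)

lemma wt_cong: assumes "\<And>j. j < n \<Longrightarrow> x j = y j" shows "wt x = wt y"
proof -
  have "proj (\<lambda>j. x j - 1) = proj (\<lambda>j. y j - 1)" using assms by (intro proj_cong) simp
  then show ?thesis by (simp add: wt_def)
qed

abbreviation "m \<equiv> fiber_mass n k W"

lemma m_restrict [simp]: "m (restrict x {..<n}) = m x"
  by (intro fiber_mass_cong) auto

lemma wt_restrict [simp]: "wt (restrict x {..<n}) = wt x"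
  by (intro wt_cong) auto

lemma expd_restrict [simp]: "expd n (restrict x {..<n}) = expd n x"
  by (intro expd_cong) auto

text \<open>Log-concavity at the midpoint x of 1 and 2 x - 1.\<close>
lemma m_midpoint: "m (\<lambda>_. 1) * m (\<lambda>j. 2 * x j - 1) \<le> (m x)\<^sup>2"
proof (rule ennreal_mult_le_of_less)
  fix a b :: real assume ab: "0 < a" "0 < b" "ennreal a < m (\<lambda>_. 1)" "ennreal b < m (\<lambda>j. 2 * x j - 1)"
  have mid: "(\<lambda>j. (1 - 1 / 2) * 1 + 1 / 2 * (2 * x j - 1)) = x"
    by (rule ext) (simp add: field_simps)
  have "ennreal (a powr (1 - 1 / 2) * b powr (1 / 2)) \<le> m (\<lambda>j. (1 - 1 / 2) * 1 + 1 / 2 * (2 * x j - 1))"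
    by (rule fiber_mass_log_concave[OF _ _ ab]) auto
  then have "ennreal (a powr (1 / 2) * b powr (1 / 2)) \<le> m x"
    unfolding mid by simp
  then have "(ennreal (a powr (1 / 2) * b powr (1 / 2)))\<^sup>2 \<le> (m x)\<^sup>2" by (rule power_mono) simp
  also have "(ennreal (a powr (1 / 2) * b powr (1 / 2)))\<^sup>2 = ennreal (a * b)"
    using ab by (simp add: ennreal_power power_mult_distrib powr_half_sqrt)
  finally show "ennreal (a * b) \<le> (m x)\<^sup>2" .
qed

text \<open>
  The fibre mass is constant on fibres and \<open>wt\<close> has integral 1 on each of them. Exchanging base points
  therefore collects the exponential density into a second factor \<open>m x\<close>.
\<close>
lemma mean_mass_eq_square:
  "(\<integral>\<^sup>+ x. ennreal (expd n x) * m x \<partial>lborel_on {..<n}) = (\<integral>\<^sup>+ x. wt x * (m x)\<^sup>2 \<partial>lborel_on {..<n})"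
proof -
  have "(\<integral>\<^sup>+ x. ennreal (expd n x) * m x * (\<integral>\<^sup>+ h. wt (\<lambda>j. x j - lin_app k W h j) \<partial>lborel_on {..<k}) \<partial>lborel_on {..<n})
    = (\<integral>\<^sup>+ x. wt x * (\<integral>\<^sup>+ h. ennreal (expd n (\<lambda>j. x j + lin_app k W h j)) * m (\<lambda>j. x j + lin_app k W h j) \<partial>lborel_on {..<k}) \<partial>lborel_on {..<n})"
    by (intro fiber_exchange) (auto)
  moreover have "(\<integral>\<^sup>+ h. ennreal (expd n (\<lambda>j. x j + lin_app k W h j)) * m (\<lambda>j. x j + lin_app k W h j) \<partial>lborel_on {..<k}) = (m x)\<^sup>2" for x
    unfolding fiber_mass_shift by (subst nn_integral_multc, measurable) (simp add: fiber_mass_def power2_eq_square)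
  moreover have "(\<integral>\<^sup>+ h. wt (\<lambda>j. x j - lin_app k W h j) \<partial>lborel_on {..<k}) = 1" for x
    using wt_fiber[of 1 x 0] by simp
  ultimately show ?thesis by simp
qed

lemma measurable_mass_reflected [measurable]:
  "(\<lambda>x. m (\<lambda>j. 2 * x j - 1)) \<in> borel_measurable (lborel_on {..<n})"
proof -
  have "(\<lambda>x. m (\<lambda>j\<in>{..<n}. 2 * x j - 1)) \<in> borel_measurable (lborel_on {..<n})"
    by (rule measurable_compose[OF _ measurable_fiber_mass]) measurable
  then show ?thesis by simp
qed

text \<open>
  The substitution of (x + 1) / 2 for x removes the reflection from the fibre mass and costs 2^(-n).
  Exchanging base points then integrates the dilated weight over fibres, which yields 2^k.
\<close>
lemma mass_reflected: "(\<integral>\<^sup>+ x. wt x * m (\<lambda>j. 2 * x j - 1) \<partial>lborel_on {..<n}) = ennreal ((1 / 2) ^ n * 2 ^ k)"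
proof -
  have arg: "wt (\<lambda>i\<in>{..<n}. 1 / 2 + 1 / 2 * x i) * m (\<lambda>j. 2 * (\<lambda>i\<in>{..<n}. 1 / 2 + 1 / 2 * x i) j - 1) = wt (\<lambda>j. 1 / 2 * x j + 1 / 2) * m x" for x
  proof -
    have "m (\<lambda>j. 2 * (\<lambda>i\<in>{..<n}. 1 / 2 + 1 / 2 * x i) j - 1) = m x"
      by (rule fiber_mass_cong) (simp add: algebra_simps)
    then show ?thesis by (simp add: add.commute)
  qed
  have s1: "(\<integral>\<^sup>+ x. wt x * m (\<lambda>j. 2 * x j - 1) \<partial>lborel_on {..<n})
    = ennreal ((1 / 2) ^ n) * (\<integral>\<^sup>+ x. wt (\<lambda>j. 1 / 2 * x j + 1 / 2) * m x \<partial>lborel_on {..<n})"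
    by (subst nn_integral_lborel_on_affine[where c = "\<lambda>_. 1 / 2" and a = "\<lambda>_. 1 / 2"]) (auto simp only: arg, auto)
  have s2: "(\<integral>\<^sup>+ x. wt (\<lambda>j. 1 / 2 * x j + 1 / 2) * m x \<partial>lborel_on {..<n})
    = (\<integral>\<^sup>+ x. ennreal (expd n x) * (\<integral>\<^sup>+ h. wt (\<lambda>j. 1 / 2 * (x j - lin_app k W h j) + 1 / 2) \<partial>lborel_on {..<k}) \<partial>lborel_on {..<n})"
    unfolding fiber_mass_def
  proof (rule fiber_exchange[symmetric])
    show "wt (\<lambda>j. 1 / 2 * restrict x {..<n} j + 1 / 2) = wt (\<lambda>j. 1 / 2 * x j + 1 / 2)" for x
      by (rule wt_cong) simp
    show "(\<lambda>x. ennreal (expd n x)) \<in> borel_measurable (lborel_on {..<n})" by measurable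
    show "(\<lambda>x. wt (\<lambda>j. 1 / 2 * x j + 1 / 2)) \<in> borel_measurable (lborel_on {..<n})" by measurable
  qed simp
  have s3: "(\<integral>\<^sup>+ x. ennreal (expd n x) * (\<integral>\<^sup>+ h. wt (\<lambda>j. 1 / 2 * (x j - lin_app k W h j) + 1 / 2) \<partial>lborel_on {..<k}) \<partial>lborel_on {..<n}) = ennreal (2 ^ k)"
  proof -
    have "(\<integral>\<^sup>+ h. wt (\<lambda>j. 1 / 2 * (x j - lin_app k W h j) + 1 / 2) \<partial>lborel_on {..<k}) = ennreal (2 ^ k)" for x
      by (subst wt_fiber) (auto simp: power_one_over)
    then show ?thesis
      by (simp only:, subst nn_integral_multc, measurable) (simp add: nn_integral_expd)
  qed
  show ?thesis unfolding s1 s2 s3 by (rule ennreal_mult[symmetric]) auto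
qed

text \<open>
  Fubini turns the mean of the fibre mass into an integral over h of the overlap of the exponential
  density with its translate by W h. In each coordinate this overlap is exp (-|y|) / 2. The last step
  rescales h by 2.
\<close>
lemma mean_mass_eq_laplace:
  "(\<integral>\<^sup>+ x. ennreal (expd n x) * m x \<partial>lborel_on {..<n})
    = ennreal ((1 / 2) ^ n * 2 ^ k) * (\<integral>\<^sup>+ h. ennreal (exp (- 2 * (\<Sum>j<n. \<bar>lin_app k W h j\<bar>))) \<partial>lborel_on {..<k})"
proof -
  interpret P: sigma_finite_measure "lborel_on {..<k}" by (intro lborel_PiM.sigma_finite) simp
  interpret Q: sigma_finite_measure "lborel_on {..<n}" by (intro lborel_PiM.sigma_finite) simp
  interpret pair_sigma_finite "lborel_on {..<n}" "lborel_on {..<k}" ..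
  have s1: "(\<integral>\<^sup>+ x. ennreal (expd n x) * m x \<partial>lborel_on {..<n})
    = (\<integral>\<^sup>+ x. (\<integral>\<^sup>+ h. ennreal (expd n x) * ennreal (expd n (\<lambda>j. x j + lin_app k W h j)) \<partial>lborel_on {..<k}) \<partial>lborel_on {..<n})"
    unfolding fiber_mass_def by (intro nn_integral_cong nn_integral_cmult[symmetric]) measurable
  have s2: "(\<integral>\<^sup>+ x. (\<integral>\<^sup>+ h. ennreal (expd n x) * ennreal (expd n (\<lambda>j. x j + lin_app k W h j)) \<partial>lborel_on {..<k}) \<partial>lborel_on {..<n})
    = (\<integral>\<^sup>+ h. (\<integral>\<^sup>+ x. ennreal (expd n x) * ennreal (expd n (\<lambda>j. x j + lin_app k W h j)) \<partial>lborel_on {..<n}) \<partial>lborel_on {..<k})"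
    by (intro Fubini'[symmetric]) measurable
  have s3: "(\<integral>\<^sup>+ h. (\<integral>\<^sup>+ x. ennreal (expd n x) * ennreal (expd n (\<lambda>j. x j + lin_app k W h j)) \<partial>lborel_on {..<n}) \<partial>lborel_on {..<k})
    = (\<integral>\<^sup>+ h. ennreal ((1 / 2) ^ n) * ennreal (exp (- (\<Sum>j<n. \<bar>lin_app k W h j\<bar>))) \<partial>lborel_on {..<k})"
  proof (rule nn_integral_cong)
    fix h
    have "(\<Prod>j<n. exp (- \<bar>lin_app k W h j\<bar>) / 2) = (1 / 2) ^ n * exp (- (\<Sum>j<n. \<bar>lin_app k W h j\<bar>))"
      by (simp add: prod_dividef exp_sum power_one_over flip: sum_negf)
    then have p3: "(\<Prod>j<n. ennreal (exp (- \<bar>lin_app k W h j\<bar>) / 2)) = ennreal ((1 / 2) ^ n) * ennreal (exp (- (\<Sum>j<n. \<bar>lin_app k W h j\<bar>)))"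
      by (subst prod_ennreal, simp, subst ennreal_mult[symmetric]) auto
    have p2: "(\<integral>\<^sup>+ x. (\<Prod>j<n. ennreal (if 0 \<le> x j then exp (- x j) else 0) * ennreal (if 0 \<le> x j + lin_app k W h j then exp (- (x j + lin_app k W h j)) else 0)) \<partial>lborel_on {..<n})
      = (\<Prod>j<n. ennreal (exp (- \<bar>lin_app k W h j\<bar>) / 2))"
      by (subst lborel_PiM.product_nn_integral_prod) (auto simp: nn_integral_exp_overlap)
    show "(\<integral>\<^sup>+ x. ennreal (expd n x) * ennreal (expd n (\<lambda>j. x j + lin_app k W h j)) \<partial>lborel_on {..<n})
      = ennreal ((1 / 2) ^ n) * ennreal (exp (- (\<Sum>j<n. \<bar>lin_app k W h j\<bar>)))"
      unfolding expd_eq_prod prod.distrib[symmetric] p2 p3 ..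
  qed
  have s4: "(\<integral>\<^sup>+ h. ennreal ((1 / 2) ^ n) * ennreal (exp (- (\<Sum>j<n. \<bar>lin_app k W h j\<bar>))) \<partial>lborel_on {..<k})
    = ennreal ((1 / 2) ^ n) * (\<integral>\<^sup>+ h. ennreal (exp (- (\<Sum>j<n. \<bar>lin_app k W h j\<bar>))) \<partial>lborel_on {..<k})"
    by (intro nn_integral_cmult) measurable
  note eq = trans[OF s1 trans[OF s2 trans[OF s3 s4]]]
  have split: "ennreal ((1 / 2) ^ n * 2 ^ k) = ennreal ((1 / 2) ^ n) * ennreal (2 ^ k)"
    by (rule ennreal_mult) auto
  show ?thesis
    unfolding eq split nn_integral_exp_l1_double[where n = n and k = k and W = W] mult.assoc ..
qed

text \<open>
  Integrating \<open>m_midpoint\<close> against the weight and cancelling the common factor 2^(k-n) bounds the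
  central mass by a Laplace integral. Its Gaussian majorant with exponent -pi |W h|^2 differs from \<zeta> by
  the dilation sqrt (2 pi) in k coordinates.
\<close>
theorem fiber_mass_upper: "m (\<lambda>_. 1) \<le> ennreal (\<zeta> / sqrt (2 * pi) ^ k)"
proof -
  define J where "J = (\<integral>\<^sup>+ h. ennreal (exp (- 2 * (\<Sum>j<n. \<bar>lin_app k W h j\<bar>))) \<partial>lborel_on {..<k})"
  have "ennreal ((1 / 2) ^ n * 2 ^ k) * m (\<lambda>_. 1) = (\<integral>\<^sup>+ x. wt x * m (\<lambda>j. 2 * x j - 1) \<partial>lborel_on {..<n}) * m (\<lambda>_. 1)"
    unfolding mass_reflected ..
  also have "\<dots> = (\<integral>\<^sup>+ x. wt x * (m (\<lambda>_. 1) * m (\<lambda>j. 2 * x j - 1)) \<partial>lborel_on {..<n})"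
    by (subst nn_integral_multc[symmetric], measurable) (simp only: mult_ac)
  also have "\<dots> \<le> (\<integral>\<^sup>+ x. wt x * (m x)\<^sup>2 \<partial>lborel_on {..<n})"
    by (intro nn_integral_mono mult_left_mono m_midpoint) simp
  also have "\<dots> = ennreal ((1 / 2) ^ n * 2 ^ k) * J"
    unfolding mean_mass_eq_square[symmetric] mean_mass_eq_laplace J_def ..
  finally have A: "m (\<lambda>_. 1) \<le> J" by (subst (asm) ennreal_mult_le_mult_iff) auto
  have B: "J \<le> (\<integral>\<^sup>+ h. ennreal (exp (- pi * (\<Sum>j<n. (lin_app k W h j)\<^sup>2))) \<partial>lborel_on {..<k})"
    unfolding J_def lin_app_def by (rule laplace_le_gauss_subspace)
  have C: "(\<integral>\<^sup>+ h. ennreal (exp (- pi * (\<Sum>j<n. (lin_app k W h j)\<^sup>2))) \<partial>lborel_on {..<k}) = ennreal (\<zeta> / sqrt (2 * pi) ^ k)"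
  proof -
    have sq: "(lin_app k W (\<lambda>l. 0 - sqrt (2 * pi) * h l) j)\<^sup>2 = 2 * pi * (lin_app k W h j)\<^sup>2" for h j
    proof -
      have "lin_app k W (\<lambda>l. 0 - sqrt (2 * pi) * h l) j = - sqrt (2 * pi) * lin_app k W h j"
        by (simp add: lin_app_def sum_distrib_left sum_negf mult.left_commute)
      then show ?thesis by (simp only: power_mult_distrib power2_minus) simp
    qed
    have half: "- (1 / 2) * (2 * pi * S) = - pi * S" for S :: real by simp
    have "- (1 / 2) * (\<Sum>j<n. (lin_app k W (\<lambda>l. 0 - sqrt (2 * pi) * h l) j)\<^sup>2) = - pi * (\<Sum>j<n. (lin_app k W h j)\<^sup>2)" for h
      unfolding sq sum_distrib_left[symmetric] half ..
    note eq = this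
    have "0 < sqrt (2 * pi)" by simp
    from gauss_affine[OF this, of "\<lambda>_. 0"] show ?thesis unfolding eq .
  qed
  from A B show ?thesis unfolding C by (rule order_trans)
qed

end

section \<open>Jensen's inequality under the product exponential law\<close>

lemma has_bochner_integral_exp_moment:
  "has_bochner_integral lborel (\<lambda>s. (if 0 < s then exp (- s) else 0) * s ^ i) (fact i :: real)"
proof (rule has_bochner_integral_nn_integral)
  have "(\<integral>\<^sup>+ s. ennreal ((if 0 < s then exp (- s) else 0) * s ^ i) \<partial>lborel)
    = (\<integral>\<^sup>+ s. ennreal (s ^ i * exp (- s)) * indicator {0..} s \<partial>lborel)"
    by (intro nn_integral_cong_AE eventually_mono[OF AE_lborel_singleton[of 0]]) (auto simp: indicator_def mult.commute)
  then show "(\<integral>\<^sup>+ s. ennreal ((if 0 < s then exp (- s) else 0) * s ^ i) \<partial>lborel) = ennreal (fact i)"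
    by (simp add: nn_intergal_power_times_exp_Ici)
qed auto

text \<open>Allows minorants with negative values, such as the quadratic one in the next lemma.\<close>
lemma ennreal_integral_le_nn_integral:
  fixes f :: "'a \<Rightarrow> real"
  assumes f: "integrable M f" and le: "\<And>x. x \<in> space M \<Longrightarrow> ennreal (f x) \<le> g x"
  shows "ennreal (integral\<^sup>L M f) \<le> integral\<^sup>N M g"
proof -
  have fin: "(\<integral>\<^sup>+ x. ennreal (f x) \<partial>M) < top"
    using f by (simp add: real_integrable_def less_top)
  have "integral\<^sup>L M f \<le> enn2real (\<integral>\<^sup>+ x. ennreal (f x) \<partial>M)"
    by (subst real_lebesgue_integral_def[OF f]) simp
  then have "ennreal (integral\<^sup>L M f) \<le> ennreal (enn2real (\<integral>\<^sup>+ x. ennreal (f x) \<partial>M))"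
    by (rule ennreal_leI)
  also have "\<dots> = (\<integral>\<^sup>+ x. ennreal (f x) \<partial>M)" using fin by simp
  also have "\<dots> \<le> integral\<^sup>N M g" by (rule nn_integral_mono) (rule le)
  finally show ?thesis .
qed

text \<open>
  Jensen's inequality for s under the standard exponential law. Bounding \<phi> by a supporting line at 1
  and using 1 + u \<le> exp u replaces the integrand by a quadratic polynomial in s - 1. As s has mean 1 and
  variance 1, the linear terms drop out and the square contributes r. The constants b and d will carry
  the contribution of the other coordinates.
\<close>
lemma exp_jensen_real:
  fixes \<phi> :: "real \<Rightarrow> real"
  assumes conc: "\<And>u v t. 0 < u \<Longrightarrow> 0 < v \<Longrightarrow> 0 < t \<Longrightarrow> t < 1 \<Longrightarrow> (1 - t) * \<phi> u + t * \<phi> v \<le> \<phi> ((1 - t) * u + t * v)"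
  shows "ennreal (exp (- (r + d) / 2 - \<phi> 1))
    \<le> (\<integral>\<^sup>+ s. ennreal ((if 0 < s then exp (- s) else 0) * exp (- (r * (s - 1)\<^sup>2 + b * (s - 1) + d) / 2 - \<phi> s)) \<partial>lborel)"
proof -
  have "convex_on {0<..} (\<lambda>s. - \<phi> s)"
  proof (rule convex_onI)
    fix t u v :: real assume "0 < t" "t < 1" "u \<in> {0<..}" "v \<in> {0<..}"
    then show "- \<phi> ((1 - t) *\<^sub>R u + t *\<^sub>R v) \<le> (1 - t) * - \<phi> u + t * - \<phi> v"
      using conc[of u v t] by simp
  qed (rule convex_real_interval)
  \<comment> \<open>c is the slope of a supporting line at 1\<close>
  then obtain c where c: "\<And>s. 0 < s \<Longrightarrow> \<phi> s \<le> \<phi> 1 + c * (s - 1)"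
  proof -
    assume cv: "convex_on {0<..} (\<lambda>s. - \<phi> s)"
    have "- \<phi> 1 + (INF t\<in>{1<..} \<inter> {0<..}. (- \<phi> 1 - - \<phi> t) / (1 - t)) * (s - 1) \<le> - \<phi> s" if "0 < s" for s
      using that by (intro convex_le_Inf_differential[OF cv]) (auto simp: interior_open)
    then show ?thesis
      by (intro that[of "- (INF t\<in>{1<..} \<inter> {0<..}. (- \<phi> 1 - - \<phi> t) / (1 - t))"]) (force simp: algebra_simps)
  qed
  define a where "a = - (r + d) / 2 - \<phi> 1"
  define f :: "real \<Rightarrow> real" where "f s = (if 0 < s then exp (- s) else 0)" for s
  \<comment> \<open>\<psi> is the density times the tangent exp a (1 + v - a) to exp at a, where v is the exponent with \<phi> replaced by its supporting line\<close>
  define \<psi> where "\<psi> s = exp a * (f s * s ^ 0 * (1 + b / 2 + c) + f s * s ^ 1 * (r - b / 2 - c) + f s * s ^ 2 * (- r / 2))" for s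
  have mom: "has_bochner_integral lborel (\<lambda>s. f s * s ^ i) (fact i)" for i
    using has_bochner_integral_exp_moment[of i] by (simp add: f_def)
  have "has_bochner_integral lborel \<psi> (exp a * (fact 0 * (1 + b / 2 + c) + fact 1 * (r - b / 2 - c) + fact 2 * (- r / 2)))"
    unfolding \<psi>_def by (intro has_bochner_integral_mult_right has_bochner_integral_add has_bochner_integral_mult_left mom)
  then have \<psi>: "has_bochner_integral lborel \<psi> (exp a)" by simp
  have "ennreal (integral\<^sup>L lborel \<psi>) \<le> (\<integral>\<^sup>+ s. ennreal (f s * exp (- (r * (s - 1)\<^sup>2 + b * (s - 1) + d) / 2 - \<phi> s)) \<partial>lborel)"
  proof (rule ennreal_integral_le_nn_integral)
    show "integrable lborel \<psi>" using \<psi> by (simp add: has_bochner_integral_iff)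
    fix s :: real
    show "ennreal (\<psi> s) \<le> ennreal (f s * exp (- (r * (s - 1)\<^sup>2 + b * (s - 1) + d) / 2 - \<phi> s))"
    proof (cases "0 < s")
      case True
      define v where "v = - (r * (s - 1)\<^sup>2 + b * (s - 1) + d) / 2 - (\<phi> 1 + c * (s - 1))"
      have "\<psi> s = f s * (exp a * (1 + (v - a)))"
        by (simp add: \<psi>_def v_def a_def power2_eq_square field_simps)
      also have "\<dots> \<le> f s * (exp a * exp (v - a))"
        by (intro mult_left_mono exp_ge_add_one_self) (auto simp: f_def)
      also have "\<dots> = f s * exp v" by (simp flip: exp_add)
      also have "\<dots> \<le> f s * exp (- (r * (s - 1)\<^sup>2 + b * (s - 1) + d) / 2 - \<phi> s)"
        using c[OF True] by (intro mult_left_mono) (auto simp: v_def f_def)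
      finally show ?thesis by (rule ennreal_leI)
    qed (simp add: \<psi>_def f_def)
  qed
  then show ?thesis using \<psi> by (simp add: has_bochner_integral_iff a_def f_def)
qed

text \<open>Coordinates over which no integral has been taken yet are held at their mean 1.\<close>
definition ext_one :: "nat set \<Rightarrow> (nat \<Rightarrow> real) \<Rightarrow> nat \<Rightarrow> real" where
  "ext_one I x j = (if j \<in> I then x j else 1)"

text \<open>
  Jensen's inequality for the product exponential law, with a quadratic form R and a function G that is
  concave in each coordinate separately. Coordinates are added one at a time: in the new coordinate the
  exponent is a quadratic polynomial plus a concave function, and \<open>exp_jensen_real\<close> shows that it
  contributes its diagonal coefficient \<open>R i i\<close>, while the mixed terms average out.
\<close>
lemma jensen_product_exponential:
  fixes R :: "nat \<Rightarrow> nat \<Rightarrow> real" and G :: "(nat \<Rightarrow> real) \<Rightarrow> real" and D :: "(nat \<Rightarrow> real) \<Rightarrow> ennreal"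
  assumes meas: "D \<in> borel_measurable (lborel_on {..<n})" and D: "\<And>x. D (restrict x {..<n}) = D x"
    and DG: "\<And>x. (\<And>j. j < n \<Longrightarrow> 0 < x j) \<Longrightarrow> D x = ennreal (exp (- G x))"
    and conc: "\<And>x i u v t. (\<And>j. j < n \<Longrightarrow> 0 < x j) \<Longrightarrow> 0 < u \<Longrightarrow> 0 < v \<Longrightarrow> 0 < t \<Longrightarrow> t < 1 \<Longrightarrow>
      (1 - t) * G (x(i := u)) + t * G (x(i := v)) \<le> G (x(i := (1 - t) * u + t * v))"
    and "finite I" "I \<subseteq> {..<n}"
  shows "ennreal (exp (- (\<Sum>i\<in>I. R i i) / 2)) * D (\<lambda>_. 1)
    \<le> (\<integral>\<^sup>+ x. (\<Prod>i\<in>I. ennreal (if 0 < x i then exp (- x i) else 0))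
        * ennreal (exp (- (\<Sum>i\<in>I. \<Sum>j\<in>I. R i j * (x i - 1) * (x j - 1)) / 2)) * D (ext_one I x) \<partial>lborel_on I)"
  using \<open>finite I\<close> \<open>I \<subseteq> {..<n}\<close>
proof (induction I rule: finite_induct)
  case empty
  have "ext_one {} = (\<lambda>x _. 1)" by (simp add: ext_one_def fun_eq_iff)
  then show ?case by (simp add: lborel_PiM.nn_integral_empty del: nn_integral_const)
next
  case (insert i I)
  define e :: "real \<Rightarrow> real" where "e s = (if 0 < s then exp (- s) else 0)" for s
  have [measurable]: "e \<in> borel_measurable borel" unfolding e_def by measurable
  have e_nonneg: "0 \<le> e s" for s by (simp add: e_def)
  define q where "q x = (\<Sum>i\<in>I. \<Sum>j\<in>I. R i j * (x i - 1) * (x j - 1))" for x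
  \<comment> \<open>coefficient of the term linear in the new coordinate\<close>
  define b where "b x = (\<Sum>j\<in>I. (R i j + R j i) * (x j - 1))" for x
  define F where "F J x = (\<Prod>j\<in>J. ennreal (e (x j)))
    * ennreal (exp (- (\<Sum>j\<in>J. \<Sum>l\<in>J. R j l * (x j - 1) * (x l - 1)) / 2)) * D (ext_one J x)" for J x
  have i: "i \<notin> I" "i < n" "finite I" "I \<subseteq> {..<n}" using insert by auto
  have [measurable]: "(\<lambda>x. D (ext_one J x)) \<in> borel_measurable (lborel_on J)" for J
  proof -
    have [measurable]: "(\<lambda>x. ext_one J x j) \<in> borel_measurable (lborel_on J)" for j
      unfolding ext_one_def by (cases "j \<in> J") auto
    have "(\<lambda>x. D (\<lambda>j\<in>{..<n}. ext_one J x j)) \<in> borel_measurable (lborel_on J)"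
      by (rule measurable_compose[OF _ meas]) measurable
    then show ?thesis by (simp add: D)
  qed
  have IH: "ennreal (exp (- (\<Sum>i\<in>I. R i i) / 2)) * D (\<lambda>_. 1)
    \<le> (\<integral>\<^sup>+ x. F I x \<partial>lborel_on I)"
    using insert by (simp add: e_def F_def)
  have "ennreal (exp (- (\<Sum>i\<in>insert i I. R i i) / 2)) * D (\<lambda>_. 1)
    = ennreal (exp (- R i i / 2)) * (ennreal (exp (- (\<Sum>i\<in>I. R i i) / 2)) * D (\<lambda>_. 1))"
  proof -
    have "exp (- (\<Sum>i\<in>insert i I. R i i) / 2) = exp (- R i i / 2) * exp (- (\<Sum>i\<in>I. R i i) / 2)"
      using i by (simp add: exp_add[symmetric] add_divide_distrib)
    then show ?thesis by (simp only: ennreal_mult[OF exp_ge_zero exp_ge_zero] mult.assoc)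
  qed
  also have "\<dots> \<le> ennreal (exp (- R i i / 2)) * (\<integral>\<^sup>+ x. F I x \<partial>lborel_on I)"
    by (rule mult_left_mono[OF IH]) simp
  also have "\<dots> = (\<integral>\<^sup>+ x. ennreal (exp (- R i i / 2)) * F I x \<partial>lborel_on I)"
    unfolding F_def by (rule nn_integral_cmult[symmetric]) measurable
  also have "\<dots> \<le> (\<integral>\<^sup>+ x. (\<integral>\<^sup>+ s. F (insert i I) (x(i := s)) \<partial>lborel) \<partial>lborel_on I)"
  proof (rule nn_integral_mono)
    fix x assume x: "x \<in> space (lborel_on I)"
    define pr where "pr = (\<Prod>j\<in>I. e (x j))"
    have FI: "F I x = (\<Prod>j\<in>I. ennreal (e (x j))) * ennreal (exp (- q x / 2)) * D (ext_one I x)"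
      by (simp add: F_def q_def)
    have pr: "(\<Prod>j\<in>I. ennreal (e (x j))) = ennreal pr" "0 \<le> pr"
      by (auto simp: pr_def prod_ennreal e_nonneg intro!: prod_nonneg)
    show "ennreal (exp (- R i i / 2)) * F I x
      \<le> (\<integral>\<^sup>+ s. F (insert i I) (x(i := s)) \<partial>lborel)"
    proof (cases "\<forall>j\<in>I. 0 < x j")
      case False
      then have "pr = 0" using i by (auto simp: pr_def e_def)
      then show ?thesis by (simp add: FI pr)
    next
      case True
      define g where "g = ext_one I x"
      have gpos: "0 < g j" for j using True by (auto simp: g_def ext_one_def)
      have gi: "g(i := 1) = g" using i by (auto simp: g_def ext_one_def fun_eq_iff)
      have quad: "(\<Sum>j\<in>insert i I. \<Sum>l\<in>insert i I. R j l * ((x(i := s)) j - 1) * ((x(i := s)) l - 1))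
        = R i i * (s - 1)\<^sup>2 + b x * (s - 1) + q x" for s
      proof -
        have "(\<Sum>l\<in>insert i I. R i l * ((x(i := s)) i - 1) * ((x(i := s)) l - 1))
          = R i i * (s - 1)\<^sup>2 + (\<Sum>l\<in>I. R i l * (s - 1) * (x l - 1))"
          using i by (simp add: power2_eq_square mult.assoc, intro sum.cong) auto
        moreover have "(\<Sum>l\<in>insert i I. R j l * ((x(i := s)) j - 1) * ((x(i := s)) l - 1))
          = R j i * (x j - 1) * (s - 1) + (\<Sum>l\<in>I. R j l * (x j - 1) * (x l - 1))" if "j \<in> I" for j
        proof -
          have "(\<Sum>l\<in>I. R j l * ((x(i := s)) j - 1) * ((x(i := s)) l - 1)) = (\<Sum>l\<in>I. R j l * (x j - 1) * (x l - 1))"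
            using i that by (intro sum.cong) auto
          then show ?thesis using i that by auto
        qed
        ultimately have "(\<Sum>j\<in>insert i I. \<Sum>l\<in>insert i I. R j l * ((x(i := s)) j - 1) * ((x(i := s)) l - 1))
          = R i i * (s - 1)\<^sup>2 + (\<Sum>l\<in>I. R i l * (s - 1) * (x l - 1)) + (\<Sum>j\<in>I. R j i * (x j - 1) * (s - 1) + (\<Sum>l\<in>I. R j l * (x j - 1) * (x l - 1)))"
          using i by (subst sum.insert) (auto intro!: sum.cong)
        moreover have "b x * (s - 1) = (\<Sum>l\<in>I. R i l * (s - 1) * (x l - 1)) + (\<Sum>j\<in>I. R j i * (x j - 1) * (s - 1))"
          unfolding b_def sum_distrib_right sum.distrib[symmetric] by (intro sum.cong refl) (simp add: algebra_simps)
        ultimately show ?thesis by (simp only: q_def sum.distrib add.assoc)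
      qed
      have Gi: "D (ext_one (insert i I) (x(i := s))) = ennreal (exp (- G (g(i := s))))" if "0 < s" for s
      proof -
        have "ext_one (insert i I) (x(i := s)) = g(i := s)" using i by (auto simp: g_def ext_one_def fun_eq_iff)
        moreover have "0 < (g(i := s)) j" for j using gpos that by simp
        ultimately show ?thesis by (simp add: DG)
      qed
      have integrand: "F (insert i I) (x(i := s))
        = ennreal pr * ennreal (e s * exp (- (R i i * (s - 1)\<^sup>2 + b x * (s - 1) + q x) / 2 - G (g(i := s))))" for s
      proof -
        have "(\<Prod>j\<in>insert i I. ennreal (e ((x(i := s)) j))) = ennreal (e s) * (\<Prod>j\<in>I. ennreal (e ((x(i := s)) j)))"
          using i by simp
        also have "(\<Prod>j\<in>I. ennreal (e ((x(i := s)) j))) = ennreal pr"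
          unfolding pr(1)[symmetric] using i by (intro prod.cong) auto
        finally have p: "(\<Prod>j\<in>insert i I. ennreal (e ((x(i := s)) j))) = ennreal (e s) * ennreal pr" .
        show ?thesis
        proof (cases "0 < s")
          case True
          have E: "e s * exp (- (R i i * (s - 1)\<^sup>2 + b x * (s - 1) + q x) / 2 - G (g(i := s)))
            = e s * (exp (- (R i i * (s - 1)\<^sup>2 + b x * (s - 1) + q x) / 2) * exp (- G (g(i := s))))"
            by (simp flip: exp_add)
          show ?thesis
            unfolding F_def p quad Gi[OF True] E
            by (simp only: ennreal_mult[OF e_nonneg mult_nonneg_nonneg[OF exp_ge_zero exp_ge_zero]]
                ennreal_mult[OF exp_ge_zero exp_ge_zero] mult_ac)
        next
          case False
          then have "e s = 0" by (simp add: e_def)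
          then show ?thesis unfolding F_def p by simp
        qed
      qed
      have "ennreal (exp (- (R i i + q x) / 2 - G (g(i := 1))))
        \<le> (\<integral>\<^sup>+ s. ennreal (e s * exp (- (R i i * (s - 1)\<^sup>2 + b x * (s - 1) + q x) / 2 - G (g(i := s)))) \<partial>lborel)"
        unfolding e_def by (rule exp_jensen_real) (rule conc, rule gpos)
      moreover have "ennreal (exp (- (R i i + q x) / 2 - G (g(i := 1)))) = ennreal (exp (- R i i / 2)) * (ennreal (exp (- q x / 2)) * D g)"
      proof -
        have "exp (- (R i i + q x) / 2 - G g) = exp (- R i i / 2) * (exp (- q x / 2) * exp (- G g))"
          by (simp add: exp_add[symmetric] add_divide_distrib)
        then show ?thesis unfolding gi DG[OF gpos] by (simp only: ennreal_mult[OF exp_ge_zero] mult_nonneg_nonneg exp_ge_zero)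
      qed
      ultimately have "ennreal pr * (ennreal (exp (- R i i / 2)) * (ennreal (exp (- q x / 2)) * D g))
        \<le> ennreal pr * (\<integral>\<^sup>+ s. ennreal (e s * exp (- (R i i * (s - 1)\<^sup>2 + b x * (s - 1) + q x) / 2 - G (g(i := s)))) \<partial>lborel)"
        by (intro mult_left_mono) auto
      also have "\<dots> \<le> (\<integral>\<^sup>+ s. ennreal pr * ennreal (e s * exp (- (R i i * (s - 1)\<^sup>2 + b x * (s - 1) + q x) / 2 - G (g(i := s)))) \<partial>lborel)"
      proof -
        have "(\<lambda>s. F (insert i I) (x(i := s))) \<in> borel_measurable lborel"
        proof -
          have "(\<lambda>s. x(i := s)) \<in> measurable lborel (lborel_on (insert i I))"
            using x by (intro measurable_component_update) (auto simp: i)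
          then show ?thesis
            by (rule measurable_compose[where N = "lborel_on (insert i I)" and g = "F (insert i I)"]) (unfold F_def, measurable)
        qed
        then have ms: "(\<lambda>s. ennreal pr * ennreal (e s * exp (- (R i i * (s - 1)\<^sup>2 + b x * (s - 1) + q x) / 2 - G (g(i := s))))) \<in> borel_measurable lborel"
          unfolding integrand .
        show ?thesis
        proof (cases "pr = 0")
          case False
          then have pp: "0 < pr" using pr by simp
          have "(\<lambda>s. ennreal (1 / pr) * (ennreal pr * ennreal (e s * exp (- (R i i * (s - 1)\<^sup>2 + b x * (s - 1) + q x) / 2 - G (g(i := s)))))) \<in> borel_measurable lborel"
            using ms by measurable
          moreover have "ennreal (1 / pr) * (ennreal pr * z) = z" for z
            unfolding mult.assoc[symmetric] using pp by (subst ennreal_mult[symmetric]) auto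
          ultimately have "(\<lambda>s. ennreal (e s * exp (- (R i i * (s - 1)\<^sup>2 + b x * (s - 1) + q x) / 2 - G (g(i := s))))) \<in> borel_measurable lborel"
            by simp
          then show ?thesis by (simp only: nn_integral_cmult order_refl)
        qed simp
      qed
      finally show ?thesis
        unfolding integrand FI pr(1) g_def[symmetric] by (simp only: mult_ac)
    qed
  qed
  also have "\<dots> = (\<integral>\<^sup>+ x. F (insert i I) x \<partial>lborel_on (insert i I))"
    using i unfolding F_def by (intro lborel_PiM.product_nn_integral_insert[symmetric]) measurable
  finally show ?case by (simp only: F_def e_def)
qed

section \<open>The lower bound for the central fibre mass\<close>

text \<open>For h in a small cube all coordinates of x + W h stay nonnegative.\<close>
lemma fiber_mass_pos:
  assumes x: "\<And>j. j < n \<Longrightarrow> 0 < x j"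
  shows "0 < fiber_mass n k W x"
proof -
  define \<delta> where "\<delta> = Min (insert 1 (x ` {..<n}))"
  have \<delta>: "0 < \<delta>" using x by (auto simp: \<delta>_def)
  have \<delta>x: "\<delta> \<le> x j" if "j < n" for j using that by (auto simp: \<delta>_def)
  define B where "B = (\<Sum>j<n. \<Sum>l<k. \<bar>W j l\<bar>) + 1"
  have B: "1 \<le> B" by (auto simp: B_def intro!: sum_nonneg)
  define \<epsilon> where "\<epsilon> = \<delta> / B"
  have \<epsilon>: "0 < \<epsilon>" using \<delta> B by (simp add: \<epsilon>_def)
  have small: "\<bar>lin_app k W h j\<bar> \<le> \<delta>" if h: "\<And>l. l < k \<Longrightarrow> \<bar>h l\<bar> \<le> \<epsilon>" and j: "j < n" for h j
  proof -
    have "\<bar>lin_app k W h j\<bar> \<le> (\<Sum>l<k. \<bar>W j l * h l\<bar>)" unfolding lin_app_def by (rule sum_abs)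
    also have "\<dots> \<le> (\<Sum>l<k. \<bar>W j l\<bar> * \<epsilon>)" using h by (intro sum_mono) (auto simp: abs_mult intro: mult_left_mono)
    also have "\<dots> = (\<Sum>l<k. \<bar>W j l\<bar>) * \<epsilon>" by (simp add: sum_distrib_right)
    also have "\<dots> \<le> B * \<epsilon>"
    proof (rule mult_right_mono)
      have "(\<Sum>l<k. \<bar>W j l\<bar>) \<le> (\<Sum>j<n. \<Sum>l<k. \<bar>W j l\<bar>)"
        using j by (intro member_le_sum[of j "{..<n}" "\<lambda>j. \<Sum>l<k. \<bar>W j l\<bar>"]) (auto intro: sum_nonneg)
      then show "(\<Sum>l<k. \<bar>W j l\<bar>) \<le> B" by (simp add: B_def)
    qed (use \<epsilon> in simp)
    also have "\<dots> = \<delta>" using B by (simp add: \<epsilon>_def)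
    finally show ?thesis .
  qed
  define c where "c = exp (- (\<Sum>j<n. x j + \<delta>))"
  have "0 < ennreal c * (\<Prod>l<k. emeasure lborel {-\<epsilon>..\<epsilon>})"
  proof -
    have "(\<Prod>l<k. emeasure lborel {-\<epsilon>..\<epsilon>}) = ennreal ((2 * \<epsilon>) ^ k)"
      using \<epsilon> by (simp add: prod_ennreal ennreal_power)
    then show ?thesis using \<epsilon> by (simp add: c_def ennreal_zero_less_mult_iff)
  qed
  also have "\<dots> = ennreal c * (\<integral>\<^sup>+ h. (\<Prod>l<k. indicator {-\<epsilon>..\<epsilon>} (h l)) \<partial>lborel_on {..<k})"
    by (subst lborel_PiM.product_nn_integral_prod) auto
  also have "\<dots> = (\<integral>\<^sup>+ h. ennreal c * (\<Prod>l<k. indicator {-\<epsilon>..\<epsilon>} (h l)) \<partial>lborel_on {..<k})"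
    by (rule nn_integral_cmult[symmetric]) measurable
  also have "\<dots> \<le> fiber_mass n k W x"
    unfolding fiber_mass_def
  proof (rule nn_integral_mono)
    fix h
    show "ennreal c * (\<Prod>l<k. indicator {-\<epsilon>..\<epsilon>} (h l)) \<le> ennreal (expd n (\<lambda>j. x j + lin_app k W h j))"
    proof (cases "\<forall>l<k. \<bar>h l\<bar> \<le> \<epsilon>")
      case False
      then obtain l where l: "l < k" "h l \<notin> {-\<epsilon>..\<epsilon>}" by (auto simp: abs_le_iff)
      then have "(\<Prod>l<k. indicator {-\<epsilon>..\<epsilon>} (h l) :: ennreal) = 0"
        by (intro prod_zero bexI[of _ l]) (auto simp: indicator_def)
      then show ?thesis by (simp only: mult_zero_right zero_le)
    next
      case True
      then have sm: "\<bar>lin_app k W h j\<bar> \<le> \<delta>" if "j < n" for j using small that by auto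
      have nn: "0 \<le> x j + lin_app k W h j" if "j < n" for j
        using sm[OF that] \<delta>x[OF that] by linarith
      have "(\<Sum>j<n. x j + lin_app k W h j) \<le> (\<Sum>j<n. x j + \<delta>)"
        using sm by (intro sum_mono) (force simp: abs_le_iff)
      then have "c \<le> expd n (\<lambda>j. x j + lin_app k W h j)"
        using nn by (simp add: expd_def c_def)
      moreover have "(\<Prod>l<k. indicator {-\<epsilon>..\<epsilon>} (h l) :: ennreal) = 1"
        using True by (intro prod.neutral) (auto simp: indicator_def abs_le_iff)
      ultimately show ?thesis by (simp add: ennreal_leI)
    qed
  qed
  finally show ?thesis .
qed

text \<open>
  Extend the segment from x to 1 slightly beyond 1, to a point y that still has positive coordinates and
  hence positive fibre mass. If the mass at x were infinite, log-concavity along this segment would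
  make the mass at 1 infinite as well.
\<close>
lemma fiber_mass_finite:
  assumes fin: "fiber_mass n k W (\<lambda>_. 1) < top" and x: "\<And>j. j < n \<Longrightarrow> 0 < x j"
  shows "fiber_mass n k W x < top"
proof (rule ccontr)
  assume "\<not> fiber_mass n k W x < top"
  then have top: "fiber_mass n k W x = top" by (meson top.not_eq_extremum)
  define s where "s = 1 / (1 + (\<Sum>j<n. \<bar>1 - x j\<bar>))"
  have S: "0 \<le> (\<Sum>j<n. \<bar>1 - x j\<bar>)" by (intro sum_nonneg) simp
  have s: "0 < s" using S by (simp add: s_def add_pos_nonneg)
  define y where "y j = 1 + s * (1 - x j)" for j
  have "0 < y j" if "j < n" for j
  proof -
    have "\<bar>1 - x j\<bar> \<le> (\<Sum>j<n. \<bar>1 - x j\<bar>)"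
      using that by (intro member_le_sum[of j "{..<n}" "\<lambda>j. \<bar>1 - x j\<bar>"]) auto
    then have "\<bar>1 - x j\<bar> < 1 + (\<Sum>j<n. \<bar>1 - x j\<bar>)" by simp
    then have "s * \<bar>1 - x j\<bar> < 1" using S by (simp add: s_def field_simps)
    then have "\<bar>s * (1 - x j)\<bar> < 1" using s by (simp add: abs_mult)
    then show ?thesis by (simp add: y_def abs_less_iff)
  qed
  then have "0 < fiber_mass n k W y" by (rule fiber_mass_pos)
  then obtain b where b: "0 < b" "ennreal b < fiber_mass n k W y"
  proof -
    assume *: "0 < fiber_mass n k W y"
    then obtain z where z: "0 < z" "z < fiber_mass n k W y" using dense by blast
    then have "z < top" by (meson less_le_trans top_greatest)
    with z show thesis by (cases z rule: ennreal_cases) (auto intro: that)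
  qed
  define t where "t = 1 / (1 + s)"
  have t: "0 < t" "t < 1" using s by (auto simp: t_def)
  have comb: "(\<lambda>j. (1 - t) * x j + t * y j) = (\<lambda>_. 1)"
  proof
    fix j
    have t1: "1 - t = s * t" and t2: "t * (1 + s) = 1" using s by (auto simp: t_def field_simps)
    have "(1 - t) * x j + t * y j = t * (1 + s)"
      unfolding t1 y_def by (simp add: algebra_simps)
    then show "(1 - t) * x j + t * y j = 1" using t2 by simp
  qed
  obtain M where M: "fiber_mass n k W (\<lambda>_. 1) = ennreal M" "0 \<le> M"
    using fin by (cases "fiber_mass n k W (\<lambda>_. 1)" rule: ennreal_cases) auto
  \<comment> \<open>chosen so that a^(1-t) b^t = M + 1 exceeds the mass at 1\<close>
  define a where "a = ((M + 1) / b powr t) powr (1 / (1 - t))"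
  have a: "0 < a" using M b by (simp add: a_def)
  have "ennreal (a powr (1 - t) * b powr t) \<le> fiber_mass n k W (\<lambda>j. (1 - t) * x j + t * y j)"
    by (rule fiber_mass_log_concave[OF t a b(1)]) (use top b in auto)
  moreover have "a powr (1 - t) * b powr t = M + 1"
    using t M b by (simp add: a_def powr_powr)
  ultimately show False using M comb by simp
qed

context gauss_section
begin

lemma lin_app_orthogonal_residual: "(\<Sum>i<n. lin_app k W h i * (y i - proj y i)) = 0"
proof -
  have "(\<Sum>i<n. lin_app k W h i * proj y i) = (\<Sum>i<n. \<Sum>j<n. lin_app k W h i * (P i j * y j))"
    by (simp add: proj_def sum_distrib_left)
  also have "\<dots> = (\<Sum>j<n. \<Sum>i<n. lin_app k W h i * (P i j * y j))" by (rule sum.swap)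
  also have "\<dots> = (\<Sum>j<n. y j * proj (lin_app k W h) j)"
  proof (intro sum.cong refl)
    fix j assume "j \<in> {..<n}"
    then have "P i j = P j i" if "i < n" for i using sym[of i j] that by (simp add: P_def)
    then show "(\<Sum>i<n. lin_app k W h i * (P i j * y j)) = y j * proj (lin_app k W h) j"
      by (simp add: proj_def sum_distrib_left mult_ac)
  qed
  also have "proj (lin_app k W h) = lin_app k W h"
    unfolding proj_eq by (rule lin_app_cong) (rule coord_lin_app)
  finally show ?thesis by (simp add: right_diff_distrib sum_subtractf mult.commute)
qed

text \<open>The squared distance of y from the range of W.\<close>
definition resid :: "(nat \<Rightarrow> real) \<Rightarrow> real" where "resid y = (\<Sum>i<n. y i * (y i - proj y i))"

lemma proj_add_lin: "proj (\<lambda>j. y j + lin_app k W h j) i = proj y i + lin_app k W h i"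
  using proj_shift[of y 1 h] lin_app_lin[of k W 1 "coord y" 1 h i] by (simp add: proj_eq)

lemma resid_shift: "resid (\<lambda>j. y j + lin_app k W h j) = resid y"
  using lin_app_orthogonal_residual[of h y]
  by (simp add: resid_def proj_add_lin distrib_right sum.distrib)

lemma resid_add_proj: "resid y + (\<Sum>i<n. (proj y i)\<^sup>2) = (\<Sum>i<n. (y i)\<^sup>2)"
proof -
  have "(\<Sum>i<n. proj y i * (y i - proj y i)) = 0"
    using lin_app_orthogonal_residual[of "coord y" y] by (simp add: proj_eq)
  then have "(\<Sum>i<n. (proj y i)\<^sup>2) = (\<Sum>i<n. y i * proj y i)"
    by (simp add: right_diff_distrib sum_subtractf power2_eq_square mult.commute)
  then show ?thesis by (simp add: resid_def right_diff_distrib sum_subtractf power2_eq_square)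
qed

text \<open>The matrix of the quadratic form \<open>resid\<close>: the projection onto the orthogonal complement of the range of W.\<close>
definition R :: "nat \<Rightarrow> nat \<Rightarrow> real" where "R i j = (if i = j then 1 else 0) - P i j"

lemma resid_eq: "resid y = (\<Sum>i<n. \<Sum>j<n. R i j * y i * y j)"
proof -
  have "(\<Sum>j<n. R i j * y i * y j) = y i * (y i - proj y i)" if "i < n" for i
  proof -
    have "(\<Sum>j<n. R i j * y i * y j) = (\<Sum>j<n. (if i = j then y i * y j else 0) - y i * (P i j * y j))"
      by (intro sum.cong refl) (simp add: R_def algebra_simps)
    also have "\<dots> = y i * (y i - proj y i)"
      using that by (simp add: sum_subtractf proj_def sum_distrib_left right_diff_distrib)
    finally show ?thesis .
  qed
  then show ?thesis by (simp add: resid_def)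
qed

lemma trace_R: "(\<Sum>i<n. R i i) = real n - real k"
proof -
  have "(\<Sum>i<n. P i i) = (\<Sum>i<n. \<Sum>l<k. L l i * W i l)" by (simp add: P_def mult.commute)
  also have "\<dots> = (\<Sum>l<k. \<Sum>i<n. L l i * W i l)" by (rule sum.swap)
  also have "\<dots> = real k" by (simp add: LW)
  finally show ?thesis by (simp add: R_def sum_subtractf)
qed

lemma m_pos: "(\<And>j. j < n \<Longrightarrow> 0 < x j) \<Longrightarrow> 0 < m x"
  by (rule fiber_mass_pos)

lemma m_finite: "(\<And>j. j < n \<Longrightarrow> 0 < x j) \<Longrightarrow> m x < top"
  by (rule fiber_mass_finite) (use fiber_mass_upper in \<open>auto intro: le_less_trans\<close>)

text \<open>
  Log-concavity is available for reals strictly below the masses A and B; it is used for r A and r B and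
  r tends to 1.
\<close>
lemma ln_m_concave:
  assumes x: "\<And>j. j < n \<Longrightarrow> 0 < x j" and y: "\<And>j. j < n \<Longrightarrow> 0 < y j" and t: "0 < t" "t < 1"
  shows "(1 - t) * ln (enn2real (m x)) + t * ln (enn2real (m y)) \<le> ln (enn2real (m (\<lambda>j. (1 - t) * x j + t * y j)))"
proof -
  define z where "z = (\<lambda>j. (1 - t) * x j + t * y j)"
  have zp: "\<And>j. j < n \<Longrightarrow> 0 < z j" using x y t by (simp add: z_def add_pos_pos)
  have real: "\<exists>A>0. m w = ennreal A" if "\<And>j. j < n \<Longrightarrow> 0 < w j" for w
  proof -
    have "0 < m w" by (rule m_pos) (rule that)
    moreover have "m w < top" by (rule m_finite) (rule that)
    ultimately show ?thesis by (cases "m w" rule: ennreal_cases) auto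
  qed
  obtain A where A: "0 < A" "m x = ennreal A" using real[of x] x by auto
  obtain B where B: "0 < B" "m y = ennreal B" using real[of y] y by auto
  obtain C where C: "0 < C" "m z = ennreal C" using real[of z] zp by auto
  have "A powr (1 - t) * B powr t \<le> C"
  proof (rule field_le_mult_one_interval)
    fix r :: real assume r: "0 < r" "r < 1"
    have "ennreal ((r * A) powr (1 - t) * (r * B) powr t) \<le> m z"
      unfolding z_def using r A B by (intro fiber_mass_log_concave t) (auto intro!: ennreal_lessI)
    then have "(r * A) powr (1 - t) * (r * B) powr t \<le> C" using C by simp
    moreover have "(r * A) powr (1 - t) * (r * B) powr t = r * (A powr (1 - t) * B powr t)"
    proof -
      have "(r * A) powr (1 - t) * (r * B) powr t = (r powr (1 - t) * r powr t) * (A powr (1 - t) * B powr t)"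
        using r A B by (simp add: powr_mult)
      also have "r powr (1 - t) * r powr t = r" using r by (simp flip: powr_add)
      finally show ?thesis .
    qed
    ultimately show "r * (A powr (1 - t) * B powr t) \<le> C" by simp
  qed
  then have "ln (A powr (1 - t) * B powr t) \<le> ln C" using A B C by simp
  then show ?thesis using A B C by (simp add: z_def[symmetric] ln_mult ln_powr)
qed

text \<open>By Pythagoras the two exponents add up to that of a standard Gaussian centred at 1.\<close>
lemma wt_times_resid:
  "(\<integral>\<^sup>+ x. wt x * ennreal (exp (- resid (\<lambda>j. x j - 1) / 2)) \<partial>lborel_on {..<n}) = ennreal (sqrt (2 * pi) ^ n / \<zeta>)"
proof -
  have "wt x * ennreal (exp (- resid (\<lambda>j. x j - 1) / 2)) = ennreal (1 / \<zeta>) * (\<Prod>j<n. ennreal (exp (- (1 / 2) * (x j - 1)\<^sup>2)))" for x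
  proof -
    have "exp (- (1 / 2) * (\<Sum>i<n. (proj (\<lambda>j. x j - 1) i)\<^sup>2)) * exp (- resid (\<lambda>j. x j - 1) / 2) = exp (- (1 / 2) * (\<Sum>i<n. (x i - 1)\<^sup>2))"
      unfolding exp_add[symmetric] resid_add_proj[of "\<lambda>j. x j - 1", symmetric] by (simp add: algebra_simps)
    also have "\<dots> = (\<Prod>j<n. exp (- (1 / 2) * (x j - 1)\<^sup>2))"
      unfolding sum_distrib_left by (rule exp_sum) simp
    finally have "ennreal (exp (- (1 / 2) * (\<Sum>i<n. (proj (\<lambda>j. x j - 1) i)\<^sup>2))) * ennreal (exp (- resid (\<lambda>j. x j - 1) / 2))
      = (\<Prod>j<n. ennreal (exp (- (1 / 2) * (x j - 1)\<^sup>2)))"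
      by (subst prod_ennreal) (auto simp only: ennreal_mult[symmetric] exp_ge_zero)
    then show ?thesis unfolding wt_def by (simp only: mult.assoc)
  qed
  then have "(\<integral>\<^sup>+ x. wt x * ennreal (exp (- resid (\<lambda>j. x j - 1) / 2)) \<partial>lborel_on {..<n})
    = (\<integral>\<^sup>+ x. ennreal (1 / \<zeta>) * (\<Prod>j<n. ennreal (exp (- (1 / 2) * (x j - 1)\<^sup>2))) \<partial>lborel_on {..<n})" by (simp only:)
  also have "\<dots> = ennreal (1 / \<zeta>) * (\<integral>\<^sup>+ x. (\<Prod>j<n. ennreal (exp (- (1 / 2) * (x j - 1)\<^sup>2))) \<partial>lborel_on {..<n})"
    by (rule nn_integral_cmult) measurable
  also have "\<dots> = ennreal (1 / \<zeta>) * (\<Prod>j<n. ennreal (sqrt (2 * pi)))"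
  proof -
    have "(\<integral>\<^sup>+ s. ennreal (exp (- (1 / 2) * (s - 1)\<^sup>2)) \<partial>lborel) = ennreal (sqrt (2 * pi))"
    proof -
      have "(\<integral>\<^sup>+ s. ennreal (exp (- (1 / 2) * (s - 1)\<^sup>2)) \<partial>lborel) = ennreal \<bar>1\<bar> * (\<integral>\<^sup>+ s. ennreal (exp (- (1 / 2) * (1 + 1 * s - 1)\<^sup>2)) \<partial>lborel)"
        by (rule nn_integral_real_affine) auto
      also have "\<dots> = (\<integral>\<^sup>+ s. ennreal (exp (- (1 / 2) * s\<^sup>2)) \<partial>lborel)" by simp
      also have "\<dots> = ennreal (sqrt (2 * pi))" by (subst nn_integral_gauss) (auto simp: mult.commute)
      finally show ?thesis .
    qed
    then show ?thesis by (subst lborel_PiM.product_nn_integral_prod) auto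
  qed
  also have "\<dots> = ennreal (1 / \<zeta>) * ennreal (sqrt (2 * pi) ^ n)"
    by (simp add: prod_ennreal ennreal_power)
  also have "\<dots> = ennreal (sqrt (2 * pi) ^ n / \<zeta>)"
    using \<zeta>_pos by (subst ennreal_mult[symmetric]) auto
  finally show ?thesis .
qed

text \<open>
  Jensen's inequality is applied to G = ln m and the quadratic form \<open>resid\<close>, whose trace is n - k. On the
  other side, 1 / m gives every fibre the same total mass under the exponential law. Exchanging base
  points against \<open>wt\<close> therefore replaces the exponential density by the Gaussian weight, and the
  integral becomes the one in \<open>wt_times_resid\<close>.
\<close>
theorem fiber_mass_lower: "ennreal (exp (- (real n - real k) / 2) * \<zeta> / sqrt (2 * pi) ^ n) \<le> m (\<lambda>_. 1)"
proof -
  define D where "D x = inverse (m x)" for x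
  define G where "G x = ln (enn2real (m x))" for x
  define q where "q x = ennreal (exp (- resid (\<lambda>j. x j - 1) / 2))" for x
  define e :: "real \<Rightarrow> real" where "e s = (if 0 < s then exp (- s) else 0)" for s
  have [measurable]: "D \<in> borel_measurable (lborel_on {..<n})" unfolding D_def by measurable
  have [measurable]: "q \<in> borel_measurable (lborel_on {..<n})" unfolding q_def resid_eq by measurable
  have [measurable]: "e \<in> borel_measurable borel" unfolding e_def by measurable
  have Dr: "D (restrict x {..<n}) = D x" for x by (simp add: D_def)
  have qr: "q (restrict x {..<n}) = q x" for x
    by (simp add: q_def resid_eq)
  have DG: "D x = ennreal (exp (- G x))" if "\<And>j. j < n \<Longrightarrow> 0 < x j" for x
  proof -
    have "0 < m x" by (rule m_pos) (rule that)
    moreover have "m x < top" by (rule m_finite) (rule that)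
    ultimately obtain A where A: "0 < A" "m x = ennreal A"
      by (cases "m x" rule: ennreal_cases) auto
    then show ?thesis by (simp add: D_def G_def exp_minus inverse_ennreal)
  qed
  have conc: "(1 - t) * G (x(i := u)) + t * G (x(i := v)) \<le> G (x(i := (1 - t) * u + t * v))"
    if "\<And>j. j < n \<Longrightarrow> 0 < x j" "0 < u" "0 < v" "0 < t" "t < 1" for x i u v t
  proof -
    have eq: "(\<lambda>j. (1 - t) * (x(i := u)) j + t * (x(i := v)) j) = x(i := (1 - t) * u + t * v)"
      by (auto simp: fun_eq_iff algebra_simps)
    have "(1 - t) * ln (enn2real (m (x(i := u)))) + t * ln (enn2real (m (x(i := v))))
      \<le> ln (enn2real (m (\<lambda>j. (1 - t) * (x(i := u)) j + t * (x(i := v)) j)))"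
      by (rule ln_m_concave) (use that in auto)
    then show ?thesis unfolding eq G_def .
  qed
  have "ennreal (exp (- (\<Sum>i<n. R i i) / 2)) * D (\<lambda>_. 1)
    \<le> (\<integral>\<^sup>+ x. (\<Prod>i<n. ennreal (e (x i)))
        * ennreal (exp (- (\<Sum>i<n. \<Sum>j<n. R i j * (x i - 1) * (x j - 1)) / 2)) * D (ext_one {..<n} x) \<partial>lborel_on {..<n})"
    unfolding e_def
  proof (rule jensen_product_exponential[where G = G and n = n])
    show "D x = ennreal (exp (- G x))" if "\<And>j. j < n \<Longrightarrow> 0 < x j" for x
      by (rule DG) (rule that)
    show "(1 - t) * G (x(i := u)) + t * G (x(i := v)) \<le> G (x(i := (1 - t) * u + t * v))"
      if "\<And>j. j < n \<Longrightarrow> 0 < x j" "0 < u" "0 < v" "0 < t" "t < 1" for x i u v t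
      by (rule conc[OF _ that(2-5)]) (rule that(1))
  qed (measurable, rule Dr, auto)
  also have "\<dots> \<le> (\<integral>\<^sup>+ x. ennreal (expd n x) * q x * D x \<partial>lborel_on {..<n})"
  proof (rule nn_integral_mono)
    fix x
    have "D (ext_one {..<n} x) = D x"
      by (subst (1 2) Dr[symmetric]) (rule arg_cong[where f = D], auto simp: ext_one_def fun_eq_iff)
    moreover have "(\<Prod>i<n. ennreal (e (x i))) \<le> ennreal (expd n x)"
      unfolding expd_eq_prod
      by (subst (1 2) prod_ennreal) (auto simp: e_def intro!: ennreal_leI prod_mono)
    ultimately show "(\<Prod>i<n. ennreal (e (x i))) * ennreal (exp (- (\<Sum>i<n. \<Sum>j<n. R i j * (x i - 1) * (x j - 1)) / 2)) * D (ext_one {..<n} x)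
      \<le> ennreal (expd n x) * q x * D x"
      unfolding q_def resid_eq by (auto intro!: mult_right_mono)
  qed
  also have "\<dots> = (\<integral>\<^sup>+ x. ennreal (expd n x) * q x * D x * (\<integral>\<^sup>+ h. wt (\<lambda>j. x j - lin_app k W h j) \<partial>lborel_on {..<k}) \<partial>lborel_on {..<n})"
  proof -
    have "(\<integral>\<^sup>+ h. wt (\<lambda>j. x j - lin_app k W h j) \<partial>lborel_on {..<k}) = 1" for x
      using wt_fiber[of 1 x 0] by simp
    then show ?thesis by simp
  qed
  also have "\<dots> = (\<integral>\<^sup>+ x. wt x * (\<integral>\<^sup>+ h. ennreal (expd n (\<lambda>j. x j + lin_app k W h j)) * q (\<lambda>j. x j + lin_app k W h j) * D (\<lambda>j. x j + lin_app k W h j) \<partial>lborel_on {..<k}) \<partial>lborel_on {..<n})"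
    by (rule fiber_exchange) (measurable, auto simp: Dr qr)
  also have "\<dots> \<le> (\<integral>\<^sup>+ x. wt x * q x \<partial>lborel_on {..<n})"
  proof (rule nn_integral_mono, rule mult_left_mono)
    fix x
    have qs: "q (\<lambda>j. x j + lin_app k W h j) = q x" for h
      using resid_shift[of "\<lambda>j. x j - 1" h] by (simp add: q_def algebra_simps)
    have Ds: "D (\<lambda>j. x j + lin_app k W h j) = D x" for h
      by (simp add: D_def fiber_mass_shift)
    have "(\<integral>\<^sup>+ h. ennreal (expd n (\<lambda>j. x j + lin_app k W h j)) * q (\<lambda>j. x j + lin_app k W h j) * D (\<lambda>j. x j + lin_app k W h j) \<partial>lborel_on {..<k})
      = (\<integral>\<^sup>+ h. ennreal (expd n (\<lambda>j. x j + lin_app k W h j)) * (q x * D x) \<partial>lborel_on {..<k})"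
      by (simp only: qs Ds mult.assoc)
    also have "\<dots> = m x * (q x * D x)"
      unfolding fiber_mass_def by (rule nn_integral_multc) measurable
    also have "\<dots> = q x * (m x * inverse (m x))" by (simp only: D_def mult_ac)
    also have "\<dots> \<le> q x * 1"
    proof (rule mult_left_mono)
      show "m x * inverse (m x) \<le> 1"
      proof (cases "m x" rule: ennreal_cases)
        case (real r)
        then show ?thesis by (cases "r = 0") (auto simp: inverse_ennreal ennreal_mult[symmetric])
      qed simp
    qed simp
    finally show "(\<integral>\<^sup>+ h. ennreal (expd n (\<lambda>j. x j + lin_app k W h j)) * q (\<lambda>j. x j + lin_app k W h j) * D (\<lambda>j. x j + lin_app k W h j) \<partial>lborel_on {..<k}) \<le> q x"
      by simp
  qed simp
  also have "\<dots> = ennreal (sqrt (2 * pi) ^ n / \<zeta>)" unfolding q_def by (rule wt_times_resid)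
  finally have main: "ennreal (exp (- (real n - real k) / 2)) * D (\<lambda>_. 1) \<le> ennreal (sqrt (2 * pi) ^ n / \<zeta>)"
    unfolding trace_R .
  obtain M where M: "0 < M" "m (\<lambda>_. 1) = ennreal M"
    using m_pos[of "\<lambda>_. 1"] m_finite[of "\<lambda>_. 1"] by (cases "m (\<lambda>_. 1)" rule: ennreal_cases) auto
  have "ennreal (exp (- (real n - real k) / 2) * inverse M) \<le> ennreal (sqrt (2 * pi) ^ n / \<zeta>)"
    using main M by (simp add: D_def inverse_ennreal ennreal_mult)
  then have "exp (- (real n - real k) / 2) * inverse M \<le> sqrt (2 * pi) ^ n / \<zeta>"
    using \<zeta>_pos by (subst (asm) ennreal_le_iff) auto
  then have "exp (- (real n - real k) / 2) * \<zeta> / sqrt (2 * pi) ^ n \<le> M"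
    using M \<zeta>_pos by (simp add: field_simps)
  then show ?thesis using M by (simp add: ennreal_leI)
qed

end

section \<open>Gaussian integrals and ranks of matrices\<close>

definition qform :: "nat \<Rightarrow> real mat \<Rightarrow> (nat \<Rightarrow> real) \<Rightarrow> real" where
  "qform k S h = (\<Sum>i<k. \<Sum>j<k. S $$ (i, j) * h i * h j)"

text \<open>
  Block elimination of the last row and column: S is a unit upper triangular block matrix times a block
  lower triangular one with diagonal blocks S' and \<open>S $$ (k, k)\<close>.
\<close>
lemma schur_complement_det:
  fixes S :: "real mat"
  assumes S: "S \<in> carrier_mat (Suc k) (Suc k)" and d: "S $$ (k, k) \<noteq> 0"
  defines "S' \<equiv> mat k k (\<lambda>(i, j). S $$ (i, j) - S $$ (i, k) * S $$ (k, j) / S $$ (k, k))"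
  shows "det S = S $$ (k, k) * det S'"
proof -
  define d where "d = S $$ (k, k)"
  define C where "C = mat k 1 (\<lambda>(i, _). S $$ (i, k) / d)"
  define r where "r = mat 1 k (\<lambda>(_, j). S $$ (k, j))"
  define D where "D = mat 1 1 (\<lambda>_. d)"
  have c: "S' \<in> carrier_mat k k" "C \<in> carrier_mat k 1" "r \<in> carrier_mat 1 k" "D \<in> carrier_mat 1 1"
    by (auto simp: S'_def C_def r_def D_def)
  have "four_block_mat (1\<^sub>m k) C (0\<^sub>m 1 k) (1\<^sub>m 1) * four_block_mat S' (0\<^sub>m k 1) r D
    = four_block_mat (1\<^sub>m k * S' + C * r) (1\<^sub>m k * 0\<^sub>m k 1 + C * D) (0\<^sub>m 1 k * S' + 1\<^sub>m 1 * r) (0\<^sub>m 1 k * 0\<^sub>m k 1 + 1\<^sub>m 1 * D)"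
    using c by (intro mult_four_block_mat) auto
  also have "\<dots> = S"
  proof (rule eq_matI)
    fix i j assume ij: "i < dim_row S" "j < dim_col S"
    have dd: "d \<noteq> 0" using d by (simp add: d_def)
    have Cr: "(C * r) $$ (i, j) = S $$ (i, k) / d * S $$ (k, j)" if "i < k" "j < k" for i j
      using that c by (simp add: scalar_prod_def C_def r_def)
    have CD: "(C * D) $$ (i, 0) = S $$ (i, k)" if "i < k" for i
      using that c dd by (simp add: scalar_prod_def C_def D_def)
    show "four_block_mat (1\<^sub>m k * S' + C * r) (1\<^sub>m k * 0\<^sub>m k 1 + C * D) (0\<^sub>m 1 k * S' + 1\<^sub>m 1 * r) (0\<^sub>m 1 k * 0\<^sub>m k 1 + 1\<^sub>m 1 * D) $$ (i, j) = S $$ (i, j)"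
    proof (cases "i < k"; cases "j < k")
      assume "i < k" "j < k"
      then show ?thesis using c S Cr by (simp add: S'_def d_def)
    next
      assume "i < k" "\<not> j < k"
      then have "j = k" using ij S by auto
      then show ?thesis using \<open>i < k\<close> c S CD by simp
    next
      assume "\<not> i < k" "j < k"
      then have "i = k" using ij S by auto
      then show ?thesis using \<open>j < k\<close> c S by (simp add: r_def)
    next
      assume "\<not> i < k" "\<not> j < k"
      then have "i = k" "j = k" using ij S by auto
      then show ?thesis using c S by (simp add: D_def d_def)
    qed
  qed (use c S in auto)
  finally have "det S = det (four_block_mat (1\<^sub>m k) C (0\<^sub>m 1 k) (1\<^sub>m 1)) * det (four_block_mat S' (0\<^sub>m k 1) r D)"
    using c by (subst Determinant.det_mult[symmetric, of _ "Suc k"]) auto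
  also have "det (four_block_mat (1\<^sub>m k) C (0\<^sub>m 1 k) (1\<^sub>m 1)) = 1"
    using c by (subst det_four_block_mat_lower_left_zero[of _ k _ 1]) auto
  also have "det (four_block_mat S' (0\<^sub>m k 1) r D) = det S' * d"
    using c by (subst det_four_block_mat_upper_right_zero[of _ k _ 1]) (auto simp: D_def Determinant.det_single)
  finally show ?thesis by (simp add: d_def mult.commute)
qed

text \<open>Completing the square in the last variable; the remainder is the Schur complement.\<close>
lemma qform_schur:
  fixes S :: "real mat"
  assumes S: "S \<in> carrier_mat (Suc k) (Suc k)" and sym: "\<And>i j. i \<le> k \<Longrightarrow> j \<le> k \<Longrightarrow> S $$ (i, j) = S $$ (j, i)"
    and d: "S $$ (k, k) \<noteq> 0"
  shows "qform (Suc k) S h = S $$ (k, k) * (h k + (\<Sum>i<k. S $$ (i, k) / S $$ (k, k) * h i))\<^sup>2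
    + qform k (mat k k (\<lambda>(i, j). S $$ (i, j) - S $$ (i, k) * S $$ (k, j) / S $$ (k, k))) h"
proof -
  define d where "d = S $$ (k, k)"
  define s where "s = (\<Sum>i<k. S $$ (i, k) * h i)"
  have dd: "d \<noteq> 0" using d by (simp add: d_def)
  have ki: "S $$ (k, i) = S $$ (i, k)" if "i < k" for i using sym[of k i] that by simp
  have "qform (Suc k) S h = (\<Sum>i<k. \<Sum>j<k. S $$ (i, j) * h i * h j) + (\<Sum>i<k. S $$ (i, k) * h i * h k) + ((\<Sum>j<k. S $$ (k, j) * h k * h j) + d * h k * h k)"
    by (simp add: qform_def sum.distrib d_def)
  also have "(\<Sum>i<k. S $$ (i, k) * h i * h k) = s * h k" by (simp add: s_def sum_distrib_right)
  also have "(\<Sum>j<k. S $$ (k, j) * h k * h j) = s * h k"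
    unfolding s_def sum_distrib_right by (intro sum.cong refl) (simp add: ki mult_ac)
  also have "(\<Sum>i<k. \<Sum>j<k. S $$ (i, j) * h i * h j)
    = qform k (mat k k (\<lambda>(i, j). S $$ (i, j) - S $$ (i, k) * S $$ (k, j) / d)) h + s\<^sup>2 / d"
  proof -
    have "s\<^sup>2 / d = (\<Sum>i<k. \<Sum>j<k. S $$ (i, k) * S $$ (k, j) / d * h i * h j)"
      unfolding power2_eq_square s_def sum_product sum_divide_distrib
      by (intro sum.cong refl) (simp add: ki mult_ac)
    then show ?thesis
      by (simp add: qform_def sum.distrib[symmetric] left_diff_distrib)
  qed
  finally have eq: "qform (Suc k) S h = qform k (mat k k (\<lambda>(i, j). S $$ (i, j) - S $$ (i, k) * S $$ (k, j) / d)) h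
    + s\<^sup>2 / d + s * h k + (s * h k + d * h k * h k)" by simp
  have "(\<Sum>i<k. S $$ (i, k) / d * h i) = s / d" by (simp add: s_def sum_divide_distrib)
  moreover have "d * (h k + s / d)\<^sup>2 = s\<^sup>2 / d + s * h k + (s * h k + d * h k * h k)"
    using dd by (simp add: power2_eq_square field_simps)
  ultimately show ?thesis using eq by (simp add: d_def)
qed

text \<open>
  Integrating out the last coordinate leaves the Gaussian of the Schur complement, whose determinant
  is \<open>det S / S $$ (k, k)\<close>.
\<close>
theorem gaussian_integral_qform:
  fixes S :: "real mat"
  assumes S: "S \<in> carrier_mat k k" and sym: "\<And>i j. i < k \<Longrightarrow> j < k \<Longrightarrow> S $$ (i, j) = S $$ (j, i)"
    and pd: "\<And>h. (\<exists>i<k. h i \<noteq> 0) \<Longrightarrow> 0 < qform k S h"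
  shows "0 < det S \<and> (\<integral>\<^sup>+ h. ennreal (exp (- (1 / 2) * qform k S h)) \<partial>lborel_on {..<k}) = ennreal (sqrt (2 * pi) ^ k / sqrt (det S))"
  using assms
proof (induction k arbitrary: S)
  case 0
  then have "det S = 1" by (simp add: det_def)
  then show ?case by (simp add: lborel_PiM.nn_integral_empty qform_def del: nn_integral_const)
next
  case (Suc k)
  define d where "d = S $$ (k, k)"
  have "qform (Suc k) S (\<lambda>i. if i = k then 1 else 0) = d"
  proof -
    have "qform (Suc k) S (\<lambda>i. if i = k then 1 else 0) = (\<Sum>i<Suc k. if i = k then d else 0)"
      unfolding qform_def by (intro sum.cong refl) (auto simp: d_def)
    then show ?thesis by simp
  qed
  with Suc.prems(3)[of "\<lambda>i. if i = k then 1 else 0"] have d: "0 < d" by auto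
  define S' where "S' = mat k k (\<lambda>(i, j). S $$ (i, j) - S $$ (i, k) * S $$ (k, j) / S $$ (k, k))"
  define \<beta> where "\<beta> h = (\<Sum>i<k. S $$ (i, k) / S $$ (k, k) * h i)" for h :: "nat \<Rightarrow> real"
  have q: "qform (Suc k) S h = d * (h k + \<beta> h)\<^sup>2 + qform k S' h" for h
    unfolding d_def \<beta>_def S'_def using Suc.prems d by (intro qform_schur) (auto simp: d_def)
  have loc: "qform k S' (h(k := s)) = qform k S' h" "\<beta> (h(k := s)) = \<beta> h" for h s
    by (auto simp: qform_def \<beta>_def)
  have IH: "0 < det S'" "(\<integral>\<^sup>+ h. ennreal (exp (- (1 / 2) * qform k S' h)) \<partial>lborel_on {..<k}) = ennreal (sqrt (2 * pi) ^ k / sqrt (det S'))"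
  proof -
    have "0 < det S' \<and> (\<integral>\<^sup>+ h. ennreal (exp (- (1 / 2) * qform k S' h)) \<partial>lborel_on {..<k}) = ennreal (sqrt (2 * pi) ^ k / sqrt (det S'))"
    proof (rule Suc.IH)
      show "S' \<in> carrier_mat k k" by (simp add: S'_def)
      show "S' $$ (i, j) = S' $$ (j, i)" if "i < k" "j < k" for i j
        using that Suc.prems(2)[of i j] Suc.prems(2)[of i k] Suc.prems(2)[of k j] by (simp add: S'_def)
      fix h :: "nat \<Rightarrow> real" assume "\<exists>i<k. h i \<noteq> 0"
      then obtain i where i: "i < k" "h i \<noteq> 0" by auto
      then have "0 < qform (Suc k) S (h(k := - \<beta> h))" by (intro Suc.prems(3) exI[of _ i]) auto
      then show "0 < qform k S' h" unfolding q by (simp add: loc)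
    qed
    then show "0 < det S'" "(\<integral>\<^sup>+ h. ennreal (exp (- (1 / 2) * qform k S' h)) \<partial>lborel_on {..<k}) = ennreal (sqrt (2 * pi) ^ k / sqrt (det S'))"
      by auto
  qed
  have det: "det S = d * det S'"
    unfolding d_def S'_def using Suc.prems d by (intro schur_complement_det) (auto simp: d_def)
  have [measurable]: "qform k S' \<in> borel_measurable (lborel_on {..<k})" unfolding qform_def by measurable
  have m2: "qform (Suc k) S \<in> borel_measurable (lborel_on (insert k {..<k}))"
    unfolding qform_def by measurable (auto simp: less_Suc_eq)
  have "(\<integral>\<^sup>+ h. ennreal (exp (- (1 / 2) * qform (Suc k) S h)) \<partial>lborel_on {..<Suc k})
    = (\<integral>\<^sup>+ h. (\<integral>\<^sup>+ s. ennreal (exp (- (1 / 2) * qform (Suc k) S (h(k := s)))) \<partial>lborel) \<partial>lborel_on {..<k})"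
    unfolding lessThan_Suc using m2 by (intro lborel_PiM.product_nn_integral_insert) auto
  also have "\<dots> = (\<integral>\<^sup>+ h. ennreal (exp (- (1 / 2) * qform k S' h)) * ennreal (sqrt (2 * pi / d)) \<partial>lborel_on {..<k})"
  proof (rule nn_integral_cong)
    fix h :: "nat \<Rightarrow> real"
    have "(\<integral>\<^sup>+ s. ennreal (exp (- (1 / 2) * qform (Suc k) S (h(k := s)))) \<partial>lborel)
      = (\<integral>\<^sup>+ s. ennreal (exp (- (1 / 2) * qform k S' h)) * ennreal (exp (- (d / 2) * (s + \<beta> h)\<^sup>2)) \<partial>lborel)"
    proof (rule nn_integral_cong)
      fix s
      have "- (1 / 2) * qform (Suc k) S (h(k := s)) = - (1 / 2) * qform k S' h + - (d / 2) * (s + \<beta> h)\<^sup>2"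
        unfolding q by (simp add: loc add_divide_distrib)
      then show "ennreal (exp (- (1 / 2) * qform (Suc k) S (h(k := s)))) = ennreal (exp (- (1 / 2) * qform k S' h)) * ennreal (exp (- (d / 2) * (s + \<beta> h)\<^sup>2))"
        by (simp only: exp_add ennreal_mult[OF exp_ge_zero exp_ge_zero])
    qed
    also have "\<dots> = ennreal (exp (- (1 / 2) * qform k S' h)) * (\<integral>\<^sup>+ s. ennreal (exp (- (d / 2) * (s + \<beta> h)\<^sup>2)) \<partial>lborel)"
      by (rule nn_integral_cmult) measurable
    also have "(\<integral>\<^sup>+ s. ennreal (exp (- (d / 2) * (s + \<beta> h)\<^sup>2)) \<partial>lborel) = ennreal (sqrt (2 * pi / d))"
    proof -
      have "(\<integral>\<^sup>+ s. ennreal (exp (- (d / 2) * (s + \<beta> h)\<^sup>2)) \<partial>lborel)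
        = ennreal \<bar>1\<bar> * (\<integral>\<^sup>+ s. ennreal (exp (- (d / 2) * (- \<beta> h + 1 * s + \<beta> h)\<^sup>2)) \<partial>lborel)"
        by (rule nn_integral_real_affine) auto
      then show ?thesis using nn_integral_gauss[of "d / 2"] d by (simp add: mult.commute)
    qed
    finally show "(\<integral>\<^sup>+ s. ennreal (exp (- (1 / 2) * qform (Suc k) S (h(k := s)))) \<partial>lborel)
      = ennreal (exp (- (1 / 2) * qform k S' h)) * ennreal (sqrt (2 * pi / d))" .
  qed
  also have "\<dots> = ennreal (sqrt (2 * pi) ^ k / sqrt (det S')) * ennreal (sqrt (2 * pi / d))"
    by (subst nn_integral_multc, measurable) (simp only: IH(2))
  also have "\<dots> = ennreal (sqrt (2 * pi) ^ Suc k / sqrt (det S))"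
    using d IH(1) unfolding det
    by (subst ennreal_mult[symmetric]) (auto simp: real_sqrt_mult real_sqrt_divide field_simps)
  finally show ?case using det d IH(1) by simp
qed

text \<open>
  The rank provides m linearly independent columns. They form an invertible square matrix, whose
  transpose annihilates y.
\<close>
lemma rank_rows_independent:
  fixes A :: "real mat"
  assumes A: "A \<in> carrier_mat m n" and rk: "vec_space.rank m A = m"
    and y: "y \<in> carrier_vec m" and orth: "\<And>j. j < n \<Longrightarrow> y \<bullet> col A j = 0"
  shows "y = 0\<^sub>v m"
proof -
  interpret V: vec_space "TYPE(real)" m .
  have "\<exists>S. maximal S (\<lambda>T. T \<subseteq> set (cols A) \<and> V.lin_indpt T)"
  proof -
    have "V.lin_indpt {}" using V.lin_dep_def by auto
    then show ?thesis
      using maximal_exists_superset[of "set (cols A)" "\<lambda>T. T \<subseteq> set (cols A) \<and> V.lin_indpt T" "{}"] by auto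
  qed
  then obtain S where S: "maximal S (\<lambda>T. T \<subseteq> set (cols A) \<and> V.lin_indpt T)" ..
  then have S2: "S \<subseteq> set (cols A)" "V.lin_indpt S" by (auto simp: maximal_def)
  have cS: "card S = m" using V.rank_card_indpt[OF A S] rk by simp
  have "finite S" using S2(1) finite_subset by blast
  then obtain cs where cs: "set cs = S" "distinct cs" using finite_distinct_list by blast
  then have len: "length cs = m" using cS distinct_card by force
  have carr: "set cs \<subseteq> carrier_vec m" using S2(1) cs A cols_dim[of A] by auto
  define M where "M = mat_of_cols m cs"
  have M: "M \<in> carrier_mat m m" by (simp add: M_def len[symmetric])
  have colsM: "cols M = cs" using carr by (simp add: M_def)
  have "V.rank M = m"
    using V.lin_indpt_full_rank[OF M] colsM cs S2(2) by simp
  then have "det M \<noteq> 0" using V.det_rank_iff[OF M] by simp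
  then have "det (M\<^sup>T) \<noteq> 0" using Determinant.det_transpose[OF M] by simp
  moreover have "M\<^sup>T *\<^sub>v y = 0\<^sub>v m"
  proof (rule eq_vecI)
    fix i assume "i < dim_vec (0\<^sub>v m :: real Matrix.vec)"
    then have i: "i < m" by simp
    then have "col M i \<in> set (cols A)" using colsM cs S2(1) len M by (metis carrier_matD(2) cols_length cols_nth nth_mem subsetD)
    then obtain j where j: "j < n" "col M i = col A j" using A by (auto simp: cols_def)
    have "(M\<^sup>T *\<^sub>v y) $ i = col M i \<bullet> y" using i M by simp
    also have "\<dots> = y \<bullet> col A j" unfolding j(2) using A y j by (intro comm_scalar_prod[of _ m]) auto
    finally show "(M\<^sup>T *\<^sub>v y) $ i = 0\<^sub>v m $ i" using orth j i by simp
  qed (use M in auto)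
  ultimately show ?thesis
    using det_0_iff_vec_prod_zero_field[of "M\<^sup>T" m] M y by auto
qed

lemma full_rank_transpose_injective:
  fixes A :: "real mat"
  assumes A: "A \<in> carrier_mat m n" and rk: "vec_space.rank m A = m"
    and v: "v \<in> carrier_vec m" "A\<^sup>T *\<^sub>v v = 0\<^sub>v n"
  shows "v = 0\<^sub>v m"
proof (rule rank_rows_independent[OF A rk v(1)])
  fix j assume j: "j < n"
  have "v \<bullet> col A j = (A\<^sup>T *\<^sub>v v) $ j"
    using j A v(1) by (simp add: comm_scalar_prod[of v m])
  then show "v \<bullet> col A j = 0" using j v(2) by simp
qed

text \<open>
  If b < a, padding X and Y with zeros to square matrices preserves the product 1, although the padded
  Y has a zero row.
\<close>
lemma right_inverse_dim_le:
  fixes X Y :: "real mat"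
  assumes X: "X \<in> carrier_mat a b" and Y: "Y \<in> carrier_mat b a" and XY: "X * Y = 1\<^sub>m a"
  shows "a \<le> b"
proof (rule ccontr)
  assume "\<not> a \<le> b"
  then have ba: "b < a" by simp
  define X' where "X' = mat a a (\<lambda>(i, j). if j < b then X $$ (i, j) else 0)"
  define Y' where "Y' = mat a a (\<lambda>(i, j). if i < b then Y $$ (i, j) else 0)"
  have c: "X' \<in> carrier_mat a a" "Y' \<in> carrier_mat a a" by (auto simp: X'_def Y'_def)
  have "X' * Y' = 1\<^sub>m a"
  proof (rule eq_matI)
    fix i j assume "i < dim_row (1\<^sub>m a :: real mat)" "j < dim_col (1\<^sub>m a :: real mat)"
    then have ij: "i < a" "j < a" by auto
    have "(X' * Y') $$ (i, j) = (\<Sum>l<a. X' $$ (i, l) * Y' $$ (l, j))"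
      using ij c by (simp add: scalar_prod_def lessThan_atLeast0)
    also have "\<dots> = (\<Sum>l<b. X' $$ (i, l) * Y' $$ (l, j))"
      using ij ba by (intro sum.mono_neutral_right) (auto simp: X'_def)
    also have "\<dots> = (\<Sum>l<b. X $$ (i, l) * Y $$ (l, j))"
      using ij ba by (intro sum.cong) (auto simp: X'_def Y'_def)
    also have "\<dots> = (X * Y) $$ (i, j)"
      using ij X Y by (simp add: scalar_prod_def lessThan_atLeast0)
    finally show "(X' * Y') $$ (i, j) = 1\<^sub>m a $$ (i, j)" by (simp add: XY)
  qed (use c in auto)
  then have "det X' * det Y' = 1" using Determinant.det_mult[OF c] by simp
  moreover have "Y'\<^sup>T *\<^sub>v unit_vec a b = 0\<^sub>v a"
    using ba by (intro eq_vecI) (auto simp: Y'_def)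
  then have "det (Y'\<^sup>T) = 0"
    using ba c by (subst det_0_iff_vec_prod_zero_field[of _ a]) (auto intro!: exI[of _ "unit_vec a b"] simp: unit_vec_nonzero)
  then have "det Y' = 0" using Determinant.det_transpose[OF c(2)] by simp
  ultimately show False by simp
qed

section \<open>Kernels and Gram determinants\<close>

lemma mult_mat_vec_nth:
  fixes X :: "real mat"
  assumes "X \<in> carrier_mat a b" "v \<in> carrier_vec b" "j < a"
  shows "(X *\<^sub>v v) $ j = (\<Sum>l<b. X $$ (j, l) * v $ l)"
  using assms by (simp add: scalar_prod_def lessThan_atLeast0)

lemma mult_mat_nth:
  fixes X Y :: "real mat"
  assumes "X \<in> carrier_mat a b" "Y \<in> carrier_mat b c" "i < a" "j < c"
  shows "(X * Y) $$ (i, j) = (\<Sum>l<b. X $$ (i, l) * Y $$ (l, j))"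
  using assms by (simp add: scalar_prod_def lessThan_atLeast0)

lemma zero_mat_mult_vec: "v \<in> carrier_vec b \<Longrightarrow> 0\<^sub>m a b *\<^sub>v v = (0\<^sub>v a :: real Matrix.vec)"
  by (intro eq_vecI) (auto simp: mult_mat_vec_nth[of _ a b])

lemma gram_qform:
  fixes X :: "real mat"
  assumes X: "X \<in> carrier_mat a b"
  shows "qform b (X\<^sup>T * X) h = (\<Sum>j<a. (lin_app b (\<lambda>j l. X $$ (j, l)) h j)\<^sup>2)"
proof -
  have G: "(X\<^sup>T * X) $$ (i, l) = (\<Sum>j<a. X $$ (j, i) * X $$ (j, l))" if "i < b" "l < b" for i l
    using that X by (subst mult_mat_nth[of _ b a _ b]) auto
  have "qform b (X\<^sup>T * X) h = (\<Sum>i<b. \<Sum>l<b. \<Sum>j<a. (X $$ (j, i) * h i) * (X $$ (j, l) * h l))"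
    unfolding qform_def by (intro sum.cong refl) (simp add: G sum_distrib_right sum_distrib_left mult_ac)
  also have "\<dots> = (\<Sum>i<b. \<Sum>j<a. \<Sum>l<b. (X $$ (j, i) * h i) * (X $$ (j, l) * h l))"
    by (rule sum.cong[OF refl]) (rule sum.swap)
  also have "\<dots> = (\<Sum>j<a. \<Sum>i<b. \<Sum>l<b. (X $$ (j, i) * h i) * (X $$ (j, l) * h l))"
    by (rule sum.swap)
  also have "\<dots> = (\<Sum>j<a. (lin_app b (\<lambda>j l. X $$ (j, l)) h j)\<^sup>2)"
    by (simp add: lin_app_def power2_eq_square sum_product)
  finally show ?thesis .
qed

lemma gram_gaussian:
  fixes X :: "real mat"
  assumes X: "X \<in> carrier_mat a b"
    and inj: "\<And>v. v \<in> carrier_vec b \<Longrightarrow> X *\<^sub>v v = 0\<^sub>v a \<Longrightarrow> v = 0\<^sub>v b"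
  shows "0 < det (X\<^sup>T * X)"
    and "(\<integral>\<^sup>+ h. ennreal (exp (- (1 / 2) * (\<Sum>j<a. (lin_app b (\<lambda>j l. X $$ (j, l)) h j)\<^sup>2))) \<partial>lborel_on {..<b})
      = ennreal (sqrt (2 * pi) ^ b / sqrt (det (X\<^sup>T * X)))"
proof -
  have "0 < det (X\<^sup>T * X) \<and>
    (\<integral>\<^sup>+ h. ennreal (exp (- (1 / 2) * qform b (X\<^sup>T * X) h)) \<partial>lborel_on {..<b})
      = ennreal (sqrt (2 * pi) ^ b / sqrt (det (X\<^sup>T * X)))"
  proof (rule gaussian_integral_qform)
    show "X\<^sup>T * X \<in> carrier_mat b b" using X by auto
    show "(X\<^sup>T * X) $$ (i, j) = (X\<^sup>T * X) $$ (j, i)" if "i < b" "j < b" for i j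
      using that X by (simp add: comm_scalar_prod[of "col X i" a])
    fix h :: "nat \<Rightarrow> real" assume h: "\<exists>i<b. h i \<noteq> 0"
    have "0 \<le> qform b (X\<^sup>T * X) h" unfolding gram_qform[OF X] by (intro sum_nonneg) simp
    moreover have "qform b (X\<^sup>T * X) h \<noteq> 0"
    proof
      assume "qform b (X\<^sup>T * X) h = 0"
      then have z: "\<forall>j<a. lin_app b (\<lambda>j l. X $$ (j, l)) h j = 0"
        unfolding gram_qform[OF X] by (subst (asm) sum_nonneg_eq_0_iff) auto
      define v where "v = Matrix.vec b h"
      have "X *\<^sub>v v = 0\<^sub>v a"
      proof (rule eq_vecI)
        fix j assume "j < dim_vec (0\<^sub>v a :: real Matrix.vec)"
        then show "(X *\<^sub>v v) $ j = 0\<^sub>v a $ j"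
          using z X by (subst mult_mat_vec_nth[OF X]) (auto simp: v_def lin_app_def)
      qed (use X in auto)
      then have "v = 0\<^sub>v b" using inj by (simp add: v_def)
      then have "h i = 0" if "i < b" for i using that by (metis index_vec index_zero_vec(1) v_def)
      then show False using h by auto
    qed
    ultimately show "0 < qform b (X\<^sup>T * X) h" by simp
  qed
  then show "0 < det (X\<^sup>T * X)"
    "(\<integral>\<^sup>+ h. ennreal (exp (- (1 / 2) * (\<Sum>j<a. (lin_app b (\<lambda>j l. X $$ (j, l)) h j)\<^sup>2))) \<partial>lborel_on {..<b})
      = ennreal (sqrt (2 * pi) ^ b / sqrt (det (X\<^sup>T * X)))"
    unfolding gram_qform[OF X] by auto
qed

lemma det_nonzero_inverse:
  fixes S :: "real mat"
  assumes S: "S \<in> carrier_mat n n" and d: "det S \<noteq> 0"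
  obtains T where "T \<in> carrier_mat n n" "S * T = 1\<^sub>m n" "T * S = 1\<^sub>m n"
proof -
  from det_non_zero_imp_unit[OF S d, of "()"]
  show thesis unfolding Units_def by (auto simp: ring_mat_simps intro: that)
qed

text \<open>The Moore-Penrose inverse (X^T X)^(-1) X^T.\<close>
lemma left_inverse_of_injective:
  fixes X :: "real mat"
  assumes X: "X \<in> carrier_mat a b"
    and inj: "\<And>v. v \<in> carrier_vec b \<Longrightarrow> X *\<^sub>v v = 0\<^sub>v a \<Longrightarrow> v = 0\<^sub>v b"
  obtains L where "L \<in> carrier_mat b a" "L * X = 1\<^sub>m b" "(X * L)\<^sup>T = X * L"
proof -
  define G where "G = X\<^sup>T * X"
  have G: "G \<in> carrier_mat b b" using X by (simp add: G_def)
  have "det G \<noteq> 0" using gram_gaussian(1)[OF X inj] by (simp add: G_def)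
  then obtain T where T: "T \<in> carrier_mat b b" "G * T = 1\<^sub>m b" "T * G = 1\<^sub>m b"
    by (rule det_nonzero_inverse[OF G])
  have Gt: "G\<^sup>T = G" using X by (simp add: G_def transpose_mult[of _ b a])
  have "T\<^sup>T * G = 1\<^sub>m b"
    using arg_cong[OF T(2), of transpose_mat] G T(1) Gt by (simp add: transpose_mult[of _ b b])
  then have "T\<^sup>T * G * T = T" using T by simp
  then have Tt: "T\<^sup>T = T"
    using G T by (simp add: assoc_mult_mat[of _ b b _ b _ b])
  show thesis
  proof
    show "T * X\<^sup>T \<in> carrier_mat b a" using T X by auto
    show "T * X\<^sup>T * X = 1\<^sub>m b"
      using T X by (simp add: assoc_mult_mat[of _ b b _ a _ b] G_def)
    show "transpose_mat (X * (T * X\<^sup>T)) = X * (T * X\<^sup>T)"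
    proof -
      have "transpose_mat (X * (T * X\<^sup>T)) = (T * X\<^sup>T)\<^sup>T * X\<^sup>T"
        by (rule transpose_mult) (use T X in auto)
      also have "(T * X\<^sup>T)\<^sup>T = X * T"
        using transpose_mult[of T b b "X\<^sup>T" a] T X Tt by simp
      also have "X * T * X\<^sup>T = X * (T * X\<^sup>T)"
        by (rule assoc_mult_mat) (use T X in auto)
      finally show ?thesis .
    qed
  qed
qed

text \<open>
  Take an orthonormal system of vectors in the kernel with the largest possible number K of members. It
  spans the kernel, since otherwise the normalised residual of a kernel vector could be added to it. The
  matrix Q obtained by stacking A on U^T is injective, and it has a right inverse because Q Q^T is
  invertible. Hence Q is square and K = n - m.
\<close>
lemma orthonormal_kernel_basis:
  fixes A :: "real mat"
  assumes A: "A \<in> carrier_mat m n"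
    and inj: "\<And>v. v \<in> carrier_vec m \<Longrightarrow> A\<^sup>T *\<^sub>v v = 0\<^sub>v n \<Longrightarrow> v = 0\<^sub>v m"
  obtains U where "U \<in> carrier_mat n (n - m)" "U\<^sup>T * U = 1\<^sub>m (n - m)"
    "(\<lambda>y. U *\<^sub>v y) ` carrier_vec (n - m) = {x \<in> carrier_vec n. A *\<^sub>v x = 0\<^sub>v m}"
proof -
  define ok where "ok k U \<longleftrightarrow> U \<in> carrier_mat n k \<and> U\<^sup>T * U = 1\<^sub>m k \<and> A * U = 0\<^sub>m m k" for k and U :: "real mat"
  have ok0: "ok 0 (0\<^sub>m n 0)" using A by (auto simp: ok_def intro!: eq_matI)
  have le: "k \<le> n" if "ok k U" for k U
    using that right_inverse_dim_le[of "U\<^sup>T" k n U] by (auto simp: ok_def)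
  define K where "K = Max {k. \<exists>U. ok k U}"
  have fin: "finite {k. \<exists>U. ok k U}" by (rule finite_subset[of _ "{..n}"]) (use le in auto)
  have "K \<in> {k. \<exists>U. ok k U}" unfolding K_def by (rule Max_in[OF fin]) (use ok0 in auto)
  then obtain U where U: "U \<in> carrier_mat n K" "U\<^sup>T * U = 1\<^sub>m K" "A * U = 0\<^sub>m m K"
    by (auto simp: ok_def)
  have max: "\<not> ok (Suc K) U'" for U' using Max_ge[OF fin, of "Suc K"] unfolding K_def[symmetric] by auto
  have Ut: "U\<^sup>T \<in> carrier_mat K n" using U by simp
  have span: "x = U *\<^sub>v (U\<^sup>T *\<^sub>v x)" if x: "x \<in> carrier_vec n" "A *\<^sub>v x = 0\<^sub>v m" for x
  proof (rule ccontr)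
    assume ne: "x \<noteq> U *\<^sub>v (U\<^sup>T *\<^sub>v x)"
    define r where "r = x - U *\<^sub>v (U\<^sup>T *\<^sub>v x)"
    have Ux: "U\<^sup>T *\<^sub>v x \<in> carrier_vec K" using Ut x by simp
    have UUx: "U *\<^sub>v (U\<^sup>T *\<^sub>v x) \<in> carrier_vec n" using U Ux by simp
    have r: "r \<in> carrier_vec n" using x UUx by (simp add: r_def)
    have Ar: "A *\<^sub>v r = 0\<^sub>v m"
    proof -
      have "A *\<^sub>v r = A *\<^sub>v x - A *\<^sub>v (U *\<^sub>v (U\<^sup>T *\<^sub>v x))"
        unfolding r_def using A x(1) UUx by (rule mult_minus_distrib_mat_vec)
      also have "A *\<^sub>v (U *\<^sub>v (U\<^sup>T *\<^sub>v x)) = (A * U) *\<^sub>v (U\<^sup>T *\<^sub>v x)"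
        by (rule assoc_mult_mat_vec[OF A U(1) Ux, symmetric])
      also have "\<dots> = 0\<^sub>v m" unfolding U(3) by (rule zero_mat_mult_vec[OF Ux])
      finally show ?thesis using x by simp
    qed
    have Ur: "U\<^sup>T *\<^sub>v r = 0\<^sub>v K"
    proof -
      have "U\<^sup>T *\<^sub>v r = U\<^sup>T *\<^sub>v x - U\<^sup>T *\<^sub>v (U *\<^sub>v (U\<^sup>T *\<^sub>v x))"
        unfolding r_def using Ut x(1) UUx by (rule mult_minus_distrib_mat_vec)
      also have "U\<^sup>T *\<^sub>v (U *\<^sub>v (U\<^sup>T *\<^sub>v x)) = (U\<^sup>T * U) *\<^sub>v (U\<^sup>T *\<^sub>v x)"
        by (rule assoc_mult_mat_vec[OF Ut U(1) Ux, symmetric])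
      finally show ?thesis using U(2) Ux by simp
    qed
    have Ur': "(\<Sum>j<n. U $$ (j, l) * r $ j) = 0" if "l < K" for l
    proof -
      have "(U\<^sup>T *\<^sub>v r) $ l = (\<Sum>j<n. U $$ (j, l) * r $ j)"
        using that U(1) by (subst mult_mat_vec_nth[OF Ut r]) auto
      then show ?thesis unfolding Ur using that by simp
    qed
    define s where "s = (\<Sum>j<n. (r $ j)\<^sup>2)"
    have "s \<noteq> 0"
    proof
      assume "s = 0"
      then have "r = 0\<^sub>v n" using r by (intro eq_vecI) (auto simp: s_def sum_nonneg_eq_0_iff)
      then have "(x - U *\<^sub>v (U\<^sup>T *\<^sub>v x)) $ j = 0" if "j < n" for j
        using that by (simp add: r_def)
      then have "x $ j = (U *\<^sub>v (U\<^sup>T *\<^sub>v x)) $ j" if "j < n" for j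
        using that UUx by (metis carrier_vecD eq_iff_diff_eq_0 index_minus_vec(1))
      then have "x = U *\<^sub>v (U\<^sup>T *\<^sub>v x)"
        using x(1) UUx by (metis carrier_vecD eq_vecI)
      then show False using ne by simp
    qed
    then have s: "0 < s" by (simp add: s_def sum_nonneg less_le)
    define U' where "U' = mat n (Suc K) (\<lambda>(i, l). if l < K then U $$ (i, l) else r $ i / sqrt s)"
    have U'c: "U' \<in> carrier_mat n (Suc K)" by (simp add: U'_def)
    have "ok (Suc K) U'"
      unfolding ok_def
    proof (intro conjI U'c)
      show "U'\<^sup>T * U' = 1\<^sub>m (Suc K)"
      proof (rule eq_matI)
        fix i l assume "i < dim_row (1\<^sub>m (Suc K) :: real mat)" "l < dim_col (1\<^sub>m (Suc K) :: real mat)"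
        then have il: "i < Suc K" "l < Suc K" by auto
        have UU: "(\<Sum>j<n. U $$ (j, i) * U $$ (j, l)) = (if i = l then 1 else 0)" if "i < K" "l < K" for i l
        proof -
          have "(U\<^sup>T * U) $$ (i, l) = (\<Sum>j<n. U $$ (j, i) * U $$ (j, l))"
            using that U(1) by (subst mult_mat_nth[OF Ut U(1)]) auto
          then show ?thesis unfolding U(2) using that by simp
        qed
        have e: "(U'\<^sup>T * U') $$ (i, l) = (\<Sum>j<n. U' $$ (j, i) * U' $$ (j, l))"
          using il U'c by (subst mult_mat_nth[of _ "Suc K" n _ "Suc K"]) auto
        consider "i < K" "l < K" | "i < K" "l = K" | "i = K" "l < K" | "i = K" "l = K" using il by linarith
        then show "(U'\<^sup>T * U') $$ (i, l) = 1\<^sub>m (Suc K) $$ (i, l)"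
        proof cases
          case 1
          then show ?thesis unfolding e using UU[of i l] by (simp add: U'_def)
        next
          case 2
          have "(\<Sum>j<n. U' $$ (j, i) * U' $$ (j, l)) = (\<Sum>j<n. U $$ (j, i) * r $ j) / sqrt s"
            unfolding sum_divide_distrib using 2 by (intro sum.cong) (auto simp: U'_def)
          then show ?thesis unfolding e using 2 Ur' by simp
        next
          case 3
          have "(\<Sum>j<n. U' $$ (j, i) * U' $$ (j, l)) = (\<Sum>j<n. U $$ (j, l) * r $ j) / sqrt s"
            unfolding sum_divide_distrib using 3 by (intro sum.cong) (auto simp: U'_def)
          then show ?thesis unfolding e using 3 Ur' by simp
        next
          case 4
          have "(\<Sum>j<n. U' $$ (j, i) * U' $$ (j, l)) = (\<Sum>j<n. (r $ j)\<^sup>2 / (sqrt s * sqrt s))"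
            using 4 by (intro sum.cong) (auto simp: U'_def power2_eq_square)
          also have "\<dots> = s / (sqrt s * sqrt s)"
            unfolding sum_divide_distrib[symmetric] s_def[symmetric] ..
          finally have "(\<Sum>j<n. U' $$ (j, i) * U' $$ (j, l)) = s / (sqrt s * sqrt s)" .
          then show ?thesis unfolding e using 4 s by simp
        qed
      qed (use U'c in auto)
      show "A * U' = 0\<^sub>m m (Suc K)"
      proof (rule eq_matI)
        fix i l assume "i < dim_row (0\<^sub>m m (Suc K) :: real mat)" "l < dim_col (0\<^sub>m m (Suc K) :: real mat)"
        then have il: "i < m" "l < Suc K" by auto
        have e: "(A * U') $$ (i, l) = (\<Sum>j<n. A $$ (i, j) * U' $$ (j, l))"
          using il by (subst mult_mat_nth[OF A U'c]) auto
        show "(A * U') $$ (i, l) = 0\<^sub>m m (Suc K) $$ (i, l)"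
        proof (cases "l < K")
          case True
          have "(\<Sum>j<n. A $$ (i, j) * U' $$ (j, l)) = (A * U) $$ (i, l)"
            using True il by (subst mult_mat_nth[OF A U(1)]) (auto simp: U'_def)
          then show ?thesis unfolding e U(3) using True il by simp
        next
          case False
          then have "(\<Sum>j<n. A $$ (i, j) * U' $$ (j, l)) = (\<Sum>j<n. A $$ (i, j) * r $ j) / sqrt s"
            unfolding sum_divide_distrib using il by (intro sum.cong) (auto simp: U'_def)
          also have "(\<Sum>j<n. A $$ (i, j) * r $ j) = (A *\<^sub>v r) $ i"
            using mult_mat_vec_nth[OF A r il(1)] by simp
          finally show ?thesis unfolding e Ar using il by simp
        qed
      qed (use A U'c in auto)
    qed
    then show False using max by blast
  qed
  \<comment> \<open>vertical stacking is written as a block matrix whose right column is empty\<close>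
  define Q where "Q = four_block_mat A (0\<^sub>m m 0) (U\<^sup>T) (0\<^sub>m K 0)"
  have Q: "Q \<in> carrier_mat (m + K) n" using A U by (auto simp: Q_def)
  have "Q * Q\<^sup>T = four_block_mat (A * A\<^sup>T) (0\<^sub>m m K) (0\<^sub>m K m) (1\<^sub>m K)"
  proof -
    have z1: "A * U + 0\<^sub>m m 0 * 0\<^sub>m 0 K = 0\<^sub>m m K" using A U by (auto intro!: eq_matI simp: scalar_prod_def)
    have "U\<^sup>T * A\<^sup>T = 0\<^sub>m K m"
      using A U by (simp add: transpose_mult[of A m n U K, symmetric])
    then have z2: "U\<^sup>T * A\<^sup>T + 0\<^sub>m K 0 * 0\<^sub>m 0 m = 0\<^sub>m K m" using A U by (auto intro!: eq_matI simp: scalar_prod_def)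
    have z3: "A * A\<^sup>T + 0\<^sub>m m 0 * 0\<^sub>m 0 m = A * A\<^sup>T" using A by (auto intro!: eq_matI simp: scalar_prod_def)
    have z4: "U\<^sup>T * U + 0\<^sub>m K 0 * 0\<^sub>m 0 K = 1\<^sub>m K" using U by (auto intro!: eq_matI simp: scalar_prod_def)
    have t: "Q\<^sup>T = four_block_mat (A\<^sup>T) U (0\<^sub>m 0 m) (0\<^sub>m 0 K)"
      unfolding Q_def using A U by (subst transpose_four_block_mat[of _ m n _ 0 _ K]) auto
    have "Q * Q\<^sup>T = four_block_mat (A * A\<^sup>T + 0\<^sub>m m 0 * 0\<^sub>m 0 m) (A * U + 0\<^sub>m m 0 * 0\<^sub>m 0 K)
      (U\<^sup>T * A\<^sup>T + 0\<^sub>m K 0 * 0\<^sub>m 0 m) (U\<^sup>T * U + 0\<^sub>m K 0 * 0\<^sub>m 0 K)"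
      unfolding t unfolding Q_def by (rule mult_four_block_mat) (use A U(1) in auto)
    then show ?thesis unfolding z1 z2 z3 z4 .
  qed
  then have "det (Q * Q\<^sup>T) = det (A * A\<^sup>T) * det (1\<^sub>m K)"
    using A by (subst det_four_block_mat_lower_left_zero[of _ m _ K, symmetric]) auto
  also have "\<dots> \<noteq> 0"
    using gram_gaussian(1)[of "A\<^sup>T" n m] A inj by simp
  finally obtain T where T: "T \<in> carrier_mat (m + K) (m + K)" "(Q * Q\<^sup>T) * T = 1\<^sub>m (m + K)"
    using Q by (auto intro: det_nonzero_inverse[of "Q * Q\<^sup>T" "m + K"])
  have "Q * (Q\<^sup>T * T) = 1\<^sub>m (m + K)"
    using T Q by (simp add: assoc_mult_mat[of _ "m + K" n _ "m + K" _ "m + K"])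
  then have d1: "m + K \<le> n"
    using Q T by (intro right_inverse_dim_le[of Q _ _ "Q\<^sup>T * T"]) auto
  have Qinj: "v = 0\<^sub>v n" if v: "v \<in> carrier_vec n" "Q *\<^sub>v v = 0\<^sub>v (m + K)" for v
  proof -
    have Av: "A *\<^sub>v v = 0\<^sub>v m"
    proof (rule eq_vecI)
      fix i assume "i < dim_vec (0\<^sub>v m :: real Matrix.vec)"
      then have i: "i < m" by simp
      have "(Q *\<^sub>v v) $ i = (\<Sum>j<n. Q $$ (i, j) * v $ j)" using i by (subst mult_mat_vec_nth[OF Q v(1)]) auto
      also have "\<dots> = (\<Sum>j<n. A $$ (i, j) * v $ j)" using i A U by (intro sum.cong) (auto simp: Q_def)
      also have "\<dots> = (A *\<^sub>v v) $ i" using i by (subst mult_mat_vec_nth[OF A v(1)]) auto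
      finally show "(A *\<^sub>v v) $ i = 0\<^sub>v m $ i" using v i by simp
    qed (use A in auto)
    have Uv: "U\<^sup>T *\<^sub>v v = 0\<^sub>v K"
    proof (rule eq_vecI)
      fix i assume "i < dim_vec (0\<^sub>v K :: real Matrix.vec)"
      then have i: "i < K" by simp
      have "(Q *\<^sub>v v) $ (m + i) = (\<Sum>j<n. Q $$ (m + i, j) * v $ j)" using i by (subst mult_mat_vec_nth[OF Q v(1)]) auto
      also have "\<dots> = (\<Sum>j<n. U\<^sup>T $$ (i, j) * v $ j)" using i A U by (intro sum.cong) (auto simp: Q_def)
      also have "\<dots> = (U\<^sup>T *\<^sub>v v) $ i" using i by (subst mult_mat_vec_nth[OF Ut v(1)]) auto
      finally show "(U\<^sup>T *\<^sub>v v) $ i = 0\<^sub>v K $ i" using v i by simp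
    qed (use U in auto)
    have "v = U *\<^sub>v (0\<^sub>v K)" using span[OF v(1) Av] Uv by simp
    also have "\<dots> = 0\<^sub>v n" using U by (intro eq_vecI) (auto simp: scalar_prod_def)
    finally show ?thesis .
  qed
  obtain L where L: "L \<in> carrier_mat n (m + K)" "L * Q = 1\<^sub>m n"
    using left_inverse_of_injective[OF Q Qinj] by blast
  have d2: "n \<le> m + K" using right_inverse_dim_le[OF L(1) Q L(2)] .
  have K: "K = n - m" using d1 d2 by simp
  have "(\<lambda>y. U *\<^sub>v y) ` carrier_vec (n - m) = {x \<in> carrier_vec n. A *\<^sub>v x = 0\<^sub>v m}"
  proof (intro equalityI subsetI)
    fix x assume "x \<in> (\<lambda>y. U *\<^sub>v y) ` carrier_vec (n - m)"
    then obtain y where y: "y \<in> carrier_vec K" "x = U *\<^sub>v y" by (auto simp: K)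
    have "A *\<^sub>v x = (A * U) *\<^sub>v y" using y by (simp only:) (rule assoc_mult_mat_vec[OF A U(1) y(1), symmetric])
    also have "\<dots> = 0\<^sub>v m" unfolding U(3) by (rule zero_mat_mult_vec[OF y(1)])
    finally show "x \<in> {x \<in> carrier_vec n. A *\<^sub>v x = 0\<^sub>v m}" using y U by simp
  next
    fix x assume x: "x \<in> {x \<in> carrier_vec n. A *\<^sub>v x = 0\<^sub>v m}"
    then have "x = U *\<^sub>v (U\<^sup>T *\<^sub>v x)" using span by blast
    moreover have "U\<^sup>T *\<^sub>v x \<in> carrier_vec (n - m)" using Ut x by (simp add: K)
    ultimately show "x \<in> (\<lambda>y. U *\<^sub>v y) ` carrier_vec (n - m)" by blast
  qed
  then show thesis using U K that by simp
qed

lemma prod_list_diag_mat_diag: "prod_list (diag_mat (mat_diag n f)) = (\<Prod>j<n. f j :: real)"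
proof -
  have "diag_mat (mat_diag n f) = map f [0..<n]" by (simp add: diag_mat_def mat_diag_def)
  then show ?thesis by (simp add: prod.list_conv_set_nth lessThan_atLeast0)
qed

text \<open>
  With D = diag(z), stack Q = (A, U^T) and R = (B, W^T). Since B = A D and U = D W, the orthogonality
  A U = 0 implies B W = 0, and the products Q Q^T, R R^T and Q D R^T are block triangular with
  determinants det (A A^T), det (B B^T) det (W^T W) and det (B B^T). Comparing (det Q det D det R)^2 with the
  square of the last one gives the identity.
\<close>
lemma det_gram_kernel_identity:
  fixes A U :: "real mat" and z :: "nat \<Rightarrow> real"
  assumes A: "A \<in> carrier_mat m n" and U: "U \<in> carrier_mat n k" and mk: "m + k = n"
    and UU: "U\<^sup>T * U = 1\<^sub>m k" and AU: "A * U = 0\<^sub>m m k"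
    and z: "\<And>j. j < n \<Longrightarrow> z j \<noteq> 0"
  defines "B \<equiv> mat m n (\<lambda>(i, j). z j * A $$ (i, j))" and "W \<equiv> mat n k (\<lambda>(j, l). U $$ (j, l) / z j)"
  assumes nz: "det (B * B\<^sup>T) \<noteq> 0"
  shows "det (A * A\<^sup>T) * (\<Prod>j<n. z j)\<^sup>2 * det (W\<^sup>T * W) = det (B * B\<^sup>T)"
proof -
  have B: "B \<in> carrier_mat m n" and W: "W \<in> carrier_mat n k" by (auto simp: B_def W_def)
  define D where "D = mat_diag n z"
  have D: "D \<in> carrier_mat n n" by (simp add: D_def)
  have detD: "det D = (\<Prod>j<n. z j)"
  proof -
    have "upper_triangular D" by (auto simp: D_def mat_diag_def)
    from det_upper_triangular[OF this D] show ?thesis by (simp add: D_def prod_list_diag_mat_diag)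
  qed
  have AD: "A * D = B" unfolding D_def mat_diag_mult_right[OF A] B_def by (auto intro!: eq_matI)
  have DW: "D * W = U" unfolding D_def mat_diag_mult_left[OF W] unfolding W_def using U z by (auto intro!: eq_matI)
  have BW: "B * W = 0\<^sub>m m k"
    unfolding AD[symmetric] using A D W AU by (simp add: assoc_mult_mat[of _ m n _ n _ k] DW)
  have stack: "four_block_mat X (0\<^sub>m m 0) Y (0\<^sub>m k 0) * transpose_mat (four_block_mat X' (0\<^sub>m m 0) Y' (0\<^sub>m k 0))
      = four_block_mat (X * X'\<^sup>T) (X * Y'\<^sup>T) (Y * X'\<^sup>T) (Y * Y'\<^sup>T)"
    if c: "X \<in> carrier_mat m n" "X' \<in> carrier_mat m n" "Y \<in> carrier_mat k n" "Y' \<in> carrier_mat k n" for X X' Y Y' :: "real mat"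
  proof -
    have t: "transpose_mat (four_block_mat X' (0\<^sub>m m 0) Y' (0\<^sub>m k 0)) = four_block_mat (X'\<^sup>T) (Y'\<^sup>T) (0\<^sub>m 0 m) (0\<^sub>m 0 k)"
      using c by (subst transpose_four_block_mat[of _ m n _ 0 _ k]) auto
    have e: "P + 0\<^sub>m a 0 * 0\<^sub>m 0 b = P" if "P \<in> carrier_mat a b" for P :: "real mat" and a b
      using that by (auto intro!: eq_matI simp: scalar_prod_def)
    have "four_block_mat X (0\<^sub>m m 0) Y (0\<^sub>m k 0) * four_block_mat (X'\<^sup>T) (Y'\<^sup>T) (0\<^sub>m 0 m) (0\<^sub>m 0 k)
      = four_block_mat (X * X'\<^sup>T + 0\<^sub>m m 0 * 0\<^sub>m 0 m) (X * Y'\<^sup>T + 0\<^sub>m m 0 * 0\<^sub>m 0 k)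
        (Y * X'\<^sup>T + 0\<^sub>m k 0 * 0\<^sub>m 0 m) (Y * Y'\<^sup>T + 0\<^sub>m k 0 * 0\<^sub>m 0 k)"
      using c by (intro mult_four_block_mat) auto
    then show ?thesis unfolding t using c by (simp add: e)
  qed
  define Q where "Q = four_block_mat A (0\<^sub>m m 0) (U\<^sup>T) (0\<^sub>m k 0)"
  \<comment> \<open>QD is Q times the diagonal matrix D, written out in blocks\<close>
  define QD where "QD = four_block_mat B (0\<^sub>m m 0) (U\<^sup>T * D) (0\<^sub>m k 0)"
  define R where "R = four_block_mat B (0\<^sub>m m 0) (W\<^sup>T) (0\<^sub>m k 0)"
  have Q: "Q \<in> carrier_mat n n" and R: "R \<in> carrier_mat n n" and QDc: "QD \<in> carrier_mat n n"
    using A U B W D mk by (auto simp: Q_def R_def QD_def)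
  have QD: "Q * D = QD"
  proof (rule eq_matI)
    fix i j assume ij: "i < dim_row QD" "j < dim_col QD"
    then have ij': "i < n" "j < n" using QDc by auto
    have "(Q * D) $$ (i, j) = Q $$ (i, j) * z j"
      using ij' Q by (simp add: D_def mat_diag_mult_right[OF Q])
    also have "\<dots> = QD $$ (i, j)"
      using ij' A U B D mk by (auto simp: Q_def QD_def B_def D_def mat_diag_mult_right[of _ k])
    finally show "(Q * D) $$ (i, j) = QD $$ (i, j)" .
  qed (use Q D QDc in auto)
  have "Q * Q\<^sup>T = four_block_mat (A * A\<^sup>T) (0\<^sub>m m k) (U\<^sup>T * A\<^sup>T) (1\<^sub>m k)"
    unfolding Q_def using A U by (subst stack) (auto simp: AU UU)
  then have "det (Q * Q\<^sup>T) = det (A * A\<^sup>T)"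
    using A U by (simp add: det_four_block_mat_upper_right_zero[of _ m _ k])
  then have q2: "(det Q)\<^sup>2 = det (A * A\<^sup>T)"
    using Q by (simp add: Determinant.det_mult[of _ n] Determinant.det_transpose[of _ n] power2_eq_square)
  have "R * R\<^sup>T = four_block_mat (B * B\<^sup>T) (0\<^sub>m m k) (W\<^sup>T * B\<^sup>T) (W\<^sup>T * W)"
    unfolding R_def using B W by (subst stack) (auto simp: BW)
  then have "det (R * R\<^sup>T) = det (B * B\<^sup>T) * det (W\<^sup>T * W)"
    using B W by (simp add: det_four_block_mat_upper_right_zero[of _ m _ k])
  then have r2: "(det R)\<^sup>2 = det (B * B\<^sup>T) * det (W\<^sup>T * W)"
    using R by (simp add: Determinant.det_mult[of _ n] Determinant.det_transpose[of _ n] power2_eq_square)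
  have "U\<^sup>T * D * W = 1\<^sub>m k"
    using U D W UU by (simp add: assoc_mult_mat[of _ k n _ n _ k] DW)
  then have "QD * R\<^sup>T = four_block_mat (B * B\<^sup>T) (0\<^sub>m m k) (U\<^sup>T * D * B\<^sup>T) (1\<^sub>m k)"
    unfolding QD_def R_def using B W U D by (subst stack) (auto simp: BW)
  then have "det (QD * R\<^sup>T) = det (B * B\<^sup>T)"
    using B U D by (simp add: det_four_block_mat_upper_right_zero[of _ m _ k])
  then have "det Q * det D * det R = det (B * B\<^sup>T)"
    unfolding QD[symmetric] using Q R D by (simp add: Determinant.det_mult[of _ n] Determinant.det_transpose[of _ n])
  then have "(det Q)\<^sup>2 * (det D)\<^sup>2 * (det R)\<^sup>2 = (det (B * B\<^sup>T))\<^sup>2"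
    by (simp flip: power_mult_distrib)
  then show ?thesis unfolding q2 r2 detD using nz by (simp add: power2_eq_square)
qed

section \<open>The analytic center\<close>

lemma vec_le_norm:
  fixes x :: "real Matrix.vec"
  assumes "x \<in> carrier_vec n" "j < n"
  shows "x $ j \<le> sqrt (x \<bullet> x)"
proof -
  have "(x $ j)\<^sup>2 \<le> (\<Sum>i<n. (x $ i)\<^sup>2)"
    using assms by (intro member_le_sum[of j "{..<n}" "\<lambda>i. (x $ i)\<^sup>2"]) auto
  also have "\<dots> = x \<bullet> x"
    using assms by (simp add: scalar_prod_def lessThan_atLeast0 power2_eq_square)
  finally show ?thesis by (rule real_le_rsqrt)
qed

lemma polyhedron_iff:
  fixes A :: "real mat"
  assumes A: "A \<in> carrier_mat m n" and b: "b \<in> carrier_vec m"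
  shows "x \<in> Defs.polyhedron A b \<longleftrightarrow> x \<in> carrier_vec n \<and> (\<forall>i<m. (\<Sum>j<n. A $$ (i, j) * x $ j) = b $ i) \<and> (\<forall>j<n. 0 \<le> x $ j)"
proof -
  have "A *\<^sub>v x = b \<longleftrightarrow> (\<forall>i<m. (\<Sum>j<n. A $$ (i, j) * x $ j) = b $ i)" if x: "x \<in> carrier_vec n"
  proof
    assume "A *\<^sub>v x = b"
    then show "\<forall>i<m. (\<Sum>j<n. A $$ (i, j) * x $ j) = b $ i"
      using mult_mat_vec_nth[OF A x] by metis
  next
    assume "\<forall>i<m. (\<Sum>j<n. A $$ (i, j) * x $ j) = b $ i"
    then show "A *\<^sub>v x = b"
      using mult_mat_vec_nth[OF A x] A b by (intro eq_vecI) auto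
  qed
  then show ?thesis using A by (auto simp: Defs.polyhedron_def affine_solutions_def)
qed

text \<open>
  Unlike the sum of the logarithms, the product of the coordinates is continuous on the whole polytope,
  which is compact. Vectors are extended by 0 to functions on all of nat in order to have a topology.
\<close>
lemma exists_max_coordinate_product:
  fixes A :: "real mat"
  assumes A: "A \<in> carrier_mat m n" and b: "b \<in> carrier_vec m"
    and bd: "bounded_vecs (Defs.polyhedron A b)" and ne: "Defs.polyhedron A b \<noteq> {}"
  shows "\<exists>z\<in>Defs.polyhedron A b. \<forall>x\<in>Defs.polyhedron A b. (\<Prod>j<n. x $ j) \<le> (\<Prod>j<n. z $ j)"
proof -
  obtain M where M: "\<And>x. x \<in> Defs.polyhedron A b \<Longrightarrow> sqrt (x \<bullet> x) \<le> M"
    using bd by (auto simp: bounded_vecs_def)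
  define S where "S j = (if j < n then {0..M} else {0::real})" for j :: nat
  have comp: "compact (PiE UNIV S)"
  proof -
    have "compactin (product_topology (\<lambda>_. euclidean) UNIV) (PiE UNIV S)"
      by (subst compactin_PiE) (auto simp: S_def compactin_euclidean_iff)
    then show ?thesis by (simp add: euclidean_product_topology compactin_euclidean_iff)
  qed
  define T where "T = PiE UNIV S \<inter> (\<Inter>i<m. {x. (\<Sum>j<n. A $$ (i, j) * x j) = b $ i})"
  have "compact T"
    unfolding T_def
  proof (rule compact_Int_closed[OF comp], rule closed_INT, rule ballI)
    fix i
    show "closed {x. (\<Sum>j<n. A $$ (i, j) * x j) = b $ i}"
      by (intro closed_Collect_eq continuous_intros continuous_on_product_coordinates)
  qed
  define lift where "lift x j = (if j < n then x $ j else 0)" for x :: "real Matrix.vec" and j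
  have liftT: "lift x \<in> T" if x: "x \<in> Defs.polyhedron A b" for x
  proof -
    have x': "x \<in> carrier_vec n" using x by (simp add: polyhedron_iff[OF A b])
    have "x $ j \<le> M" if "j < n" for j using vec_le_norm[OF x' that] M[OF x] by simp
    then show ?thesis using x by (auto simp: T_def S_def lift_def polyhedron_iff[OF A b])
  qed
  then have "T \<noteq> {}" using ne by auto
  moreover have "continuous_on T (\<lambda>x. \<Prod>j<n. x j)"
    by (intro continuous_intros continuous_on_subset[OF continuous_on_product_coordinates]) auto
  ultimately obtain x where x: "x \<in> T" and mx: "\<And>y. y \<in> T \<Longrightarrow> (\<Prod>j<n. y j) \<le> (\<Prod>j<n. x j)"
    using continuous_attains_sup[OF \<open>compact T\<close>, of "\<lambda>x. \<Prod>j<n. x j"] by blast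
  define z where "z = Matrix.vec n x"
  have "0 \<le> x j" if "j < n" for j
  proof -
    have "x j \<in> S j" using x by (auto simp: T_def)
    then show ?thesis using that by (simp add: S_def)
  qed
  then have "z \<in> Defs.polyhedron A b" using x by (auto simp: polyhedron_iff[OF A b] z_def T_def)
  moreover have "(\<Prod>j<n. y $ j) \<le> (\<Prod>j<n. z $ j)" if y: "y \<in> Defs.polyhedron A b" for y
    using mx[OF liftT[OF y]] by (simp add: lift_def z_def)
  ultimately show ?thesis by blast
qed

text \<open>
  A maximiser of the product of the coordinates has positive coordinates, because the product is positive
  at an interior point. So it also maximises the sum of the logarithms among interior points, and the choice
  made by \<open>arg_max_on\<close> is a genuine maximiser.
\<close>
lemma analytic_center_maximal:
  assumes data: "polytope_data m n A b"
  defines "z \<equiv> analytic_center A b"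
  shows "z \<in> interior_points A b"
    and "x \<in> interior_points A b \<Longrightarrow> (\<Sum>j<n. ln (x $ j)) \<le> (\<Sum>j<n. ln (z $ j))"
proof -
  have A: "A \<in> carrier_mat m n" and b: "b \<in> carrier_vec m" and bd: "bounded_vecs (Defs.polyhedron A b)"
    and ne: "interior_points A b \<noteq> {}" using data by (auto simp: polytope_data_def)
  have dA: "dim_col A = n" using A by simp
  define f where "f x = real (dim_col A) + (\<Sum>j<dim_col A. ln (x $ j))" for x :: "real Matrix.vec"
  obtain x0 where x0: "x0 \<in> interior_points A b" using ne by auto
  have ip: "x \<in> Defs.polyhedron A b" "\<forall>j<n. 0 < x $ j" if "x \<in> interior_points A b" for x
    using that dA by (auto simp: interior_points_def)
  obtain w where w: "w \<in> Defs.polyhedron A b" and mx: "\<And>x. x \<in> Defs.polyhedron A b \<Longrightarrow> (\<Prod>j<n. x $ j) \<le> (\<Prod>j<n. w $ j)"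
    using exists_max_coordinate_product[OF A b bd] ip(1)[OF x0] by blast
  have lnprod: "(\<Sum>j<n. ln (x $ j)) = ln (\<Prod>j<n. x $ j)" if "\<forall>j<n. 0 < x $ j" for x :: "real Matrix.vec"
    using that by (subst ln_prod) auto
  have "0 < (\<Prod>j<n. x0 $ j)" using ip(2)[OF x0] by (intro prod_pos) auto
  then have "0 < (\<Prod>j<n. w $ j)" using mx[OF ip(1)[OF x0]] by simp
  then have "w $ j \<noteq> 0" if "j < n" for j
    using that prod_zero[of "{..<n}" "\<lambda>j. w $ j"] by (auto simp del: prod_zero_iff)
  moreover have "0 \<le> w $ j" if "j < n" for j using w that by (simp add: polyhedron_iff[OF A b])
  ultimately have wpos: "\<forall>j<n. 0 < w $ j" by (simp add: less_le)
  then have wI: "w \<in> interior_points A b" using w dA by (simp add: interior_points_def)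
  have "is_arg_max f (\<lambda>x. x \<in> interior_points A b) w"
    unfolding is_arg_max_def
  proof (intro conjI wI notI)
    assume "\<exists>y. y \<in> interior_points A b \<and> f w < f y"
    then obtain y where y: "y \<in> interior_points A b" "f w < f y" by auto
    have "ln (\<Prod>j<n. y $ j) \<le> ln (\<Prod>j<n. w $ j)"
      using mx[OF ip(1)[OF y(1)]] ip(2)[OF y(1)] by (intro ln_mono prod_pos) auto
    then show False using y(2) lnprod[OF ip(2)[OF y(1)]] lnprod[OF wpos] by (simp add: f_def dA)
  qed
  then have "is_arg_max f (\<lambda>x. x \<in> interior_points A b) z"
    unfolding z_def analytic_center_def arg_max_on_def arg_max_def f_def by (rule someI)
  then show "z \<in> interior_points A b"
    and "x \<in> interior_points A b \<Longrightarrow> (\<Sum>j<n. ln (x $ j)) \<le> (\<Sum>j<n. ln (z $ j))"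
    by (auto simp: is_arg_max_def f_def dA not_less)
qed

text \<open>Small moves along d stay among the interior points, so t \<mapsto> sum of ln (z_j + t d_j) has a local maximum at 0.\<close>
lemma analytic_center_stationary:
  assumes data: "polytope_data m n A b" and d: "d \<in> carrier_vec n" "A *\<^sub>v d = 0\<^sub>v m"
  defines "z \<equiv> analytic_center A b"
  shows "(\<Sum>j<n. d $ j / z $ j) = 0"
proof -
  have A: "A \<in> carrier_mat m n" and b: "b \<in> carrier_vec m" using data by (auto simp: polytope_data_def)
  have dA: "dim_col A = n" using A by simp
  have zI: "z \<in> interior_points A b" unfolding z_def by (rule analytic_center_maximal(1)[OF data])
  then have z: "z \<in> carrier_vec n" "A *\<^sub>v z = b" and zpos: "\<And>j. j < n \<Longrightarrow> 0 < z $ j"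
    using dA by (auto simp: interior_points_def Defs.polyhedron_def affine_solutions_def)
  \<comment> \<open>moving from z by less than \<delta> along d keeps all coordinates positive\<close>
  define \<delta> where "\<delta> = Min (insert 1 ((\<lambda>j. z $ j / (1 + \<bar>d $ j\<bar>)) ` {..<n}))"
  have \<delta>: "0 < \<delta>" using zpos by (auto simp: \<delta>_def add_pos_nonneg)
  have small: "0 < z $ j + t * d $ j" if t: "\<bar>t\<bar> < \<delta>" and j: "j < n" for t j
  proof -
    have "\<delta> \<le> z $ j / (1 + \<bar>d $ j\<bar>)" using j by (auto simp: \<delta>_def)
    then have "\<bar>t\<bar> * (1 + \<bar>d $ j\<bar>) < z $ j" using t by (simp add: pos_le_divide_eq add_pos_nonneg) (smt (verit) mult_strict_right_mono abs_ge_zero)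
    moreover have "\<bar>t * d $ j\<bar> \<le> \<bar>t\<bar> * (1 + \<bar>d $ j\<bar>)" by (simp add: abs_mult distrib_left)
    ultimately show ?thesis by linarith
  qed
  define \<phi> where "\<phi> t = (\<Sum>j<n. ln (z $ j + t * d $ j))" for t
  have "DERIV \<phi> 0 :> (\<Sum>j<n. d $ j / z $ j)"
    unfolding \<phi>_def using zpos by (auto intro!: derivative_eq_intros sum.cong)
  moreover have "\<phi> t \<le> \<phi> 0" if t: "\<bar>0 - t\<bar> < \<delta>" for t
  proof -
    define x where "x = z + t \<cdot>\<^sub>v d"
    have xc: "x \<in> carrier_vec n" using z d by (simp add: x_def)
    have "A *\<^sub>v x = A *\<^sub>v z + t \<cdot>\<^sub>v (A *\<^sub>v d)"
      unfolding x_def using A z d by (simp add: mult_add_distrib_mat_vec[OF A] mult_mat_vec[OF A])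
    also have "\<dots> = b" unfolding z(2) d(2) using b by (auto intro!: eq_vecI)
    finally have "x \<in> interior_points A b"
      using small t xc dA z d by (auto simp: interior_points_def Defs.polyhedron_def affine_solutions_def x_def intro: less_imp_le)
    then have "(\<Sum>j<n. ln (x $ j)) \<le> (\<Sum>j<n. ln (z $ j))"
      unfolding z_def by (rule analytic_center_maximal(2)[OF data])
    then show ?thesis using z d by (simp add: \<phi>_def x_def)
  qed
  ultimately show ?thesis using DERIV_local_max[OF _ \<delta>] by blast
qed

section \<open>The volume of the polytope\<close>

text \<open>Guarantees that the choice in \<open>affine_volume\<close> is an isometric chart.\<close>
lemma kernel_chart_exists:
  assumes data: "polytope_data m n A b"
  shows "\<exists>c. isometric_chart n (n - m) (affine_solutions A b) c"
proof -
  have A: "A \<in> carrier_mat m n" and b: "b \<in> carrier_vec m" and rk: "vec_space.rank m A = m"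
    using data by (auto simp: polytope_data_def)
  obtain p where p: "p \<in> affine_solutions A b"
    using data by (auto simp: polytope_data_def interior_points_def Defs.polyhedron_def)
  then have pc: "p \<in> carrier_vec n" "A *\<^sub>v p = b" using A by (auto simp: affine_solutions_def)
  obtain U where U: "U \<in> carrier_mat n (n - m)" "U\<^sup>T * U = 1\<^sub>m (n - m)"
    "(\<lambda>y. U *\<^sub>v y) ` carrier_vec (n - m) = {x \<in> carrier_vec n. A *\<^sub>v x = 0\<^sub>v m}"
    using orthonormal_kernel_basis[OF A full_rank_transpose_injective[OF A rk]] by blast
  have "(\<lambda>y. p + U *\<^sub>v y) ` carrier_vec (n - m) = affine_solutions A b"
  proof (intro equalityI subsetI)
    fix x assume "x \<in> (\<lambda>y. p + U *\<^sub>v y) ` carrier_vec (n - m)"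
    then obtain y where y: "y \<in> carrier_vec (n - m)" "x = p + U *\<^sub>v y" by auto
    have Uy: "U *\<^sub>v y \<in> carrier_vec n" "A *\<^sub>v (U *\<^sub>v y) = 0\<^sub>v m" using U(3) y by auto
    have "A *\<^sub>v x = A *\<^sub>v p + A *\<^sub>v (U *\<^sub>v y)"
      unfolding y(2) by (rule mult_add_distrib_mat_vec[OF A pc(1) Uy(1)])
    also have "\<dots> = b" unfolding pc(2) Uy(2) using b by (auto intro!: eq_vecI)
    finally show "x \<in> affine_solutions A b" using A pc Uy y(2) by (simp add: affine_solutions_def)
  next
    fix x assume "x \<in> affine_solutions A b"
    then have x: "x \<in> carrier_vec n" "A *\<^sub>v x = b" using A by (auto simp: affine_solutions_def)
    have "A *\<^sub>v (x - p) = 0\<^sub>v m"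
      unfolding mult_minus_distrib_mat_vec[OF A x(1) pc(1)] x(2) pc(2) using b by (auto intro!: eq_vecI)
    then have "x - p \<in> (\<lambda>y. U *\<^sub>v y) ` carrier_vec (n - m)" unfolding U(3) using x pc by simp
    then obtain y where y: "y \<in> carrier_vec (n - m)" "x - p = U *\<^sub>v y" by auto
    have "x = p + (x - p)" using x pc by (auto intro!: eq_vecI)
    then show "x \<in> (\<lambda>y. p + U *\<^sub>v y) ` carrier_vec (n - m)" using y by (intro image_eqI[of _ _ y]) auto
  qed
  then show ?thesis
    using pc U by (intro exI[of _ "(p, U)"]) (simp add: isometric_chart_def)
qed

lemma chart_directions_in_kernel:
  assumes A: "A \<in> carrier_mat m n" and ch: "isometric_chart n k (affine_solutions A b) (p, U)"
  shows "A * U = 0\<^sub>m m k"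
proof -
  have p: "p \<in> carrier_vec n" and U: "U \<in> carrier_mat n k"
    and im: "(\<lambda>y. p + U *\<^sub>v y) ` carrier_vec k = affine_solutions A b"
    using ch by (auto simp: isometric_chart_def)
  have sol: "A *\<^sub>v (p + U *\<^sub>v y) = b" if "y \<in> carrier_vec k" for y
    using that im by (auto simp: affine_solutions_def)
  have lin: "A *\<^sub>v (p + U *\<^sub>v y) = A *\<^sub>v p + A *\<^sub>v (U *\<^sub>v y)" if "y \<in> carrier_vec k" for y
    using that U by (intro mult_add_distrib_mat_vec[OF A p]) auto
  have "A *\<^sub>v (U *\<^sub>v y) = b - A *\<^sub>v p" if y: "y \<in> carrier_vec k" for y
    using sol[OF y] lin[OF y] A U p y by (intro eq_vecI) auto
  note diff = this
  have U0: "U *\<^sub>v 0\<^sub>v k = 0\<^sub>v n" using U by (intro eq_vecI) (auto simp: mult_mat_vec_nth[OF U])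
  have "A *\<^sub>v 0\<^sub>v n = 0\<^sub>v m" using A by (intro eq_vecI) (auto simp: mult_mat_vec_nth[OF A])
  then have "b - A *\<^sub>v p = 0\<^sub>v m" using diff[of "0\<^sub>v k"] U0 by simp
  then have zero: "A *\<^sub>v (U *\<^sub>v y) = 0\<^sub>v m" if "y \<in> carrier_vec k" for y using diff[OF that] by simp
  show ?thesis
  proof (rule eq_matI)
    fix i l assume "i < dim_row (0\<^sub>m m k :: real mat)" "l < dim_col (0\<^sub>m m k :: real mat)"
    then have il: "i < m" "l < k" by auto
    have "(A * U) $$ (i, l) = (\<Sum>j<n. A $$ (i, j) * U $$ (j, l))" by (rule mult_mat_nth[OF A U il])
    also have "\<dots> = (\<Sum>j<n. A $$ (i, j) * (U *\<^sub>v unit_vec k l) $ j)"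
    proof (intro sum.cong refl)
      fix j assume "j \<in> {..<n}"
      then have "(U *\<^sub>v unit_vec k l) $ j = (\<Sum>i<k. U $$ (j, i) * unit_vec k l $ i)"
        by (intro mult_mat_vec_nth[OF U]) auto
      also have "\<dots> = (\<Sum>i<k. if i = l then U $$ (j, i) else 0)"
        using il by (intro sum.cong) auto
      also have "\<dots> = U $$ (j, l)" using il by simp
      finally show "A $$ (i, j) * U $$ (j, l) = A $$ (i, j) * (U *\<^sub>v unit_vec k l) $ j" by simp
    qed
    also have "\<dots> = (A *\<^sub>v (U *\<^sub>v unit_vec k l)) $ i"
      using U il by (intro mult_mat_vec_nth[OF A, symmetric]) auto
    also have "\<dots> = 0" using il by (simp add: zero)
    finally show "(A * U) $$ (i, l) = 0\<^sub>m m k $$ (i, l)" using il by simp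
  qed (use A U in auto)
qed

text \<open>
  In the chosen chart the polytope is a translate, by the chart coordinates y0 of z, of the set S of all h
  with 1 + W h \<ge> 0. The columns of W sum to 0, so the exponential density equals e^(-n) on S and the fibre
  mass at 1 is e^(-n) vol P. The bounds on this fibre mass carry over, and the determinant identity
  expresses det (W^T W) through A, B and z.
\<close>
theorem polytope_volume_bounds:
  assumes data: "polytope_data m n A b"
  shows "vol A b \<le> vol_estimate A b"
    and "(1 / sqrt (2 * pi * exp 1)) ^ m * vol_estimate A b \<le> vol A b"
    and "0 \<le> vol_estimate A b"
proof -
  define k where "k = n - m"
  have A: "A \<in> carrier_mat m n" and b: "b \<in> carrier_vec m" and mn: "m < n" and rk: "vec_space.rank m A = m"
    using data by (auto simp: polytope_data_def)
  have dA: "dim_col A = n" "dim_row A = m" using A by auto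
  have mk: "m + k = n" using mn by (simp add: k_def)
  obtain p U where pU: "(SOME c. isometric_chart n k (affine_solutions A b) c) = (p, U)" by fastforce
  have ch: "isometric_chart n k (affine_solutions A b) (p, U)"
    using someI_ex[OF kernel_chart_exists[OF data]] unfolding k_def[symmetric] pU .
  then have p: "p \<in> carrier_vec n" and U: "U \<in> carrier_mat n k" and UU: "U\<^sup>T * U = 1\<^sub>m k"
    and im: "(\<lambda>y. p + U *\<^sub>v y) ` carrier_vec k = affine_solutions A b"
    by (auto simp: isometric_chart_def)
  have AU: "A * U = 0\<^sub>m m k" by (rule chart_directions_in_kernel[OF A ch])
  define zv where "zv = analytic_center A b"
  define z where "z j = zv $ j" for j
  have zI: "zv \<in> interior_points A b" unfolding zv_def by (rule analytic_center_maximal(1)[OF data])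
  then have zpos: "0 < z j" if "j < n" for j using that dA by (simp add: interior_points_def z_def)
  have "zv \<in> affine_solutions A b" using zI by (simp add: interior_points_def Defs.polyhedron_def)
  then obtain y0 where y0: "y0 \<in> carrier_vec k" "zv = p + U *\<^sub>v y0" using im by auto
  have z_eq: "z j = p $ j + (\<Sum>l<k. U $$ (j, l) * y0 $ l)" if "j < n" for j
    unfolding z_def y0(2) using that U p y0(1) by (simp del: index_mult_mat_vec add: mult_mat_vec_nth[OF U])
  define Wm where "Wm = mat n k (\<lambda>(j, l). U $$ (j, l) / z j)"
  define W where "W j l = Wm $$ (j, l)" for j l
  have Wc: "Wm \<in> carrier_mat n k" by (simp add: Wm_def)
  have W: "W j l = U $$ (j, l) / z j" if "j < n" "l < k" for j l using that by (simp add: W_def Wm_def)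
  have stat: "(\<Sum>j<n. W j l) = 0" if l: "l < k" for l
  proof -
    have "A *\<^sub>v col U l = col (A * U) l" using A U l by (auto intro!: eq_vecI)
    also have "\<dots> = 0\<^sub>v m" unfolding AU using l by auto
    finally have "(\<Sum>j<n. col U l $ j / zv $ j) = 0"
      unfolding zv_def using U l by (intro analytic_center_stationary[OF data]) auto
    then show ?thesis using U l by (simp add: W z_def)
  qed
  have Winj: "v = 0\<^sub>v k" if v: "v \<in> carrier_vec k" "Wm *\<^sub>v v = 0\<^sub>v n" for v
  proof -
    have "U *\<^sub>v v = 0\<^sub>v n"
    proof (rule eq_vecI)
      fix j assume "j < dim_vec (0\<^sub>v n :: real Matrix.vec)"
      then have j: "j < n" by simp
      have "(U *\<^sub>v v) $ j = z j * (Wm *\<^sub>v v) $ j"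
        unfolding mult_mat_vec_nth[OF U v(1) j] mult_mat_vec_nth[OF Wc v(1) j] sum_distrib_left
        using zpos[OF j] j by (intro sum.cong) (auto simp: Wm_def)
      then show "(U *\<^sub>v v) $ j = 0\<^sub>v n $ j" using j v(2) by simp
    qed (use U in auto)
    have "v = (U\<^sup>T * U) *\<^sub>v v" using v(1) UU by simp
    also have "\<dots> = U\<^sup>T *\<^sub>v (U *\<^sub>v v)" using U v(1) by (intro assoc_mult_mat_vec) auto
    also have "\<dots> = 0\<^sub>v k" unfolding \<open>U *\<^sub>v v = 0\<^sub>v n\<close> using U by (intro eq_vecI) (auto simp: mult_mat_vec_nth[of _ k n])
    finally show ?thesis .
  qed
  obtain Lm where Lm: "Lm \<in> carrier_mat k n" "Lm * Wm = 1\<^sub>m k" "(Wm * Lm)\<^sup>T = Wm * Lm"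
    using left_inverse_of_injective[OF Wc Winj] by blast
  define L where "L l j = Lm $$ (l, j)" for l j
  define dM where "dM = det (Wm\<^sup>T * Wm)"
  have dM: "0 < dM" unfolding dM_def by (rule gram_gaussian(1)[OF Wc Winj])
  define \<zeta> where "\<zeta> = sqrt (2 * pi) ^ k / sqrt dM"
  have \<zeta>: "0 < \<zeta>" using dM by (simp add: \<zeta>_def)
  interpret G: gauss_section n k W L \<zeta>
  proof
    show "(\<Sum>j<n. L l j * W j l') = (if l = l' then 1 else 0)" if "l < k" "l' < k" for l l'
      using mult_mat_nth[OF Lm(1) Wc that] that by (simp add: Lm(2) L_def W_def)
    show "(\<Sum>l<k. W i l * L l j) = (\<Sum>l<k. W j l * L l i)" if "i < n" "j < n" for i j
    proof -
      have "(Wm * Lm) $$ (i, j) = (Wm * Lm) $$ (j, i)"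
        using arg_cong[OF Lm(3), of "\<lambda>M. M $$ (i, j)"] that Wc Lm(1) by simp
      then show ?thesis
        using mult_mat_nth[OF Wc Lm(1) that] mult_mat_nth[OF Wc Lm(1) that(2,1)] by (simp add: L_def W_def)
    qed
    show "(\<integral>\<^sup>+ h. ennreal (exp (- (1 / 2) * (\<Sum>j<n. (lin_app k W h j)\<^sup>2))) \<partial>lborel_on {..<k}) = ennreal \<zeta>"
      unfolding \<zeta>_def dM_def W_def by (rule gram_gaussian(2)[OF Wc Winj])
  qed (rule \<zeta>)
  have sumW: "(\<Sum>j<n. 1 + lin_app k W h j) = real n" for h
  proof -
    have "(\<Sum>j<n. lin_app k W h j) = (\<Sum>l<k. (\<Sum>j<n. W j l) * h l)"
      unfolding lin_app_def sum_distrib_right by (rule sum.swap)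
    then show ?thesis by (simp add: stat sum.distrib)
  qed
  define S where "S = {h \<in> space (lborel_on {..<k}). \<forall>j\<in>{..<n}. 0 \<le> 1 + lin_app k W h j}"
  have S[measurable]: "S \<in> sets (lborel_on {..<k})" unfolding S_def by measurable
  have mass: "fiber_mass n k W (\<lambda>_. 1) = ennreal (exp (- real n)) * emeasure (lborel_on {..<k}) S"
  proof -
    have "fiber_mass n k W (\<lambda>_. 1) = (\<integral>\<^sup>+ h. ennreal (exp (- real n)) * indicator S h \<partial>lborel_on {..<k})"
      unfolding fiber_mass_def by (intro nn_integral_cong) (auto simp: expd_def sumW S_def indicator_def)
    then show ?thesis by (simp add: nn_integral_cmult_indicator)
  qed
  define T where "T = {y \<in> space (lborel_on {..<k}). p + U *\<^sub>v Matrix.vec k y \<in> Defs.polyhedron A b}"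
  have T_iff: "y \<in> T \<longleftrightarrow> y \<in> space (lborel_on {..<k}) \<and> (\<forall>j\<in>{..<n}. 0 \<le> p $ j + (\<Sum>l<k. U $$ (j, l) * y l))" for y
  proof -
    have "p + U *\<^sub>v Matrix.vec k y \<in> affine_solutions A b" using im by (auto intro!: image_eqI[of _ _ "Matrix.vec k y"])
    moreover have "(p + U *\<^sub>v Matrix.vec k y) $ j = p $ j + (\<Sum>l<k. U $$ (j, l) * y l)" if "j < n" for j
      using that U p by (simp del: index_mult_mat_vec add: mult_mat_vec_nth[OF U])
    ultimately show ?thesis by (auto simp: T_def Defs.polyhedron_def dA)
  qed
  have T[measurable]: "T \<in> sets (lborel_on {..<k})"
  proof -
    have "T = {y \<in> space (lborel_on {..<k}). \<forall>j\<in>{..<n}. 0 \<le> p $ j + (\<Sum>l<k. U $$ (j, l) * y l)}"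
      using T_iff by auto
    also have "\<dots> \<in> sets (lborel_on {..<k})" by measurable
    finally show ?thesis .
  qed
  have shift: "(\<lambda>l\<in>{..<k}. h l + y0 $ l) \<in> T \<longleftrightarrow> h \<in> S" if h: "h \<in> space (lborel_on {..<k})" for h
  proof -
    have "p $ j + (\<Sum>l<k. U $$ (j, l) * (\<lambda>l\<in>{..<k}. h l + y0 $ l) l) = z j * (1 + lin_app k W h j)" if j: "j < n" for j
    proof -
      have "z j * lin_app k W h j = (\<Sum>l<k. U $$ (j, l) * h l)"
        unfolding lin_app_def sum_distrib_left using zpos[OF j] j by (intro sum.cong) (auto simp: W)
      then show ?thesis using z_eq[OF j] by (simp add: distrib_left sum.distrib)
    qed
    then have "0 \<le> p $ j + (\<Sum>l<k. U $$ (j, l) * (\<lambda>l\<in>{..<k}. h l + y0 $ l) l) \<longleftrightarrow> 0 \<le> 1 + lin_app k W h j"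
      if "j \<in> {..<n}" for j
      using that zpos[of j] by (simp only: lessThan_iff) (simp add: zero_le_mult_iff not_le)
    then have "(\<forall>j\<in>{..<n}. 0 \<le> p $ j + (\<Sum>l<k. U $$ (j, l) * (\<lambda>l\<in>{..<k}. h l + y0 $ l) l)) \<longleftrightarrow> (\<forall>j\<in>{..<n}. 0 \<le> 1 + lin_app k W h j)"
      by (rule ball_cong[OF refl])
    moreover have "(\<lambda>l\<in>{..<k}. h l + y0 $ l) \<in> space (lborel_on {..<k})" by (simp add: space_PiM)
    ultimately show ?thesis unfolding T_iff S_def mem_Collect_eq using h by blast
  qed
  have emT: "emeasure (lborel_on {..<k}) T = emeasure (lborel_on {..<k}) S"
  proof -
    have "emeasure (lborel_on {..<k}) T = (\<integral>\<^sup>+ h. indicator T h \<partial>lborel_on {..<k})" by simp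
    also have "\<dots> = (\<integral>\<^sup>+ h. indicator T (\<lambda>l\<in>{..<k}. h l + y0 $ l) \<partial>lborel_on {..<k})"
      by (rule nn_integral_lborel_on_translate[symmetric]) auto
    also have "\<dots> = (\<integral>\<^sup>+ h. indicator S h \<partial>lborel_on {..<k})"
      using shift by (intro nn_integral_cong) (auto simp: indicator_def)
    finally show ?thesis by simp
  qed
  have vol: "vol A b = measure (lborel_on {..<k}) T"
    unfolding vol_def affine_volume_def dA k_def[symmetric] pU T_def by (simp add: Let_def)
  have upper: "fiber_mass n k W (\<lambda>_. 1) \<le> ennreal (1 / sqrt dM)"
    using G.fiber_mass_upper by (simp add: \<zeta>_def)
  have fin: "emeasure (lborel_on {..<k}) T < top"
  proof (rule ccontr)
    assume "\<not> ?thesis"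
    then have "emeasure (lborel_on {..<k}) S = top" unfolding emT by (meson top.not_eq_extremum)
    then have "fiber_mass n k W (\<lambda>_. 1) = top" unfolding mass by (simp add: ennreal_mult_top)
    then show False using upper by (simp add: top_unique)
  qed
  define V where "V = vol A b"
  have V: "emeasure (lborel_on {..<k}) T = ennreal V" "0 \<le> V"
    unfolding V_def vol using fin by (auto simp: emeasure_eq_ennreal_measure)
  have massV: "fiber_mass n k W (\<lambda>_. 1) = ennreal (exp (- real n) * V)"
    unfolding mass emT[symmetric] V(1) using V(2) by (simp add: ennreal_mult)
  have est: "vol_estimate A b = exp (real n) / sqrt dM"
  proof -
    define B where "B = scale_cols A zv"
    have B: "B = mat m n (\<lambda>(i, j). z j * A $$ (i, j))" by (simp add: B_def scale_cols_def dA z_def)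
    have Bt: "v = 0\<^sub>v m" if v: "v \<in> carrier_vec m" "B\<^sup>T *\<^sub>v v = 0\<^sub>v n" for v
    proof (rule full_rank_transpose_injective[OF A rk v(1)], rule eq_vecI)
      fix j assume "j < dim_vec (0\<^sub>v n :: real Matrix.vec)"
      then have j: "j < n" by simp
      have c: "A\<^sup>T \<in> carrier_mat n m" "B\<^sup>T \<in> carrier_mat n m" using A by (auto simp: B)
      have "z j * (A\<^sup>T *\<^sub>v v) $ j = (B\<^sup>T *\<^sub>v v) $ j"
        unfolding mult_mat_vec_nth[OF c(1) v(1) j] mult_mat_vec_nth[OF c(2) v(1) j] sum_distrib_left
        using j A by (intro sum.cong) (auto simp: B)
      then show "(A\<^sup>T *\<^sub>v v) $ j = 0\<^sub>v n $ j" using j v(2) zpos[OF j] by simp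
    qed (use A in auto)
    have dAA: "0 < det (A * A\<^sup>T)"
      using gram_gaussian(1)[of "A\<^sup>T" n m] A full_rank_transpose_injective[OF A rk] by simp
    have dBB: "0 < det (B * B\<^sup>T)"
      using gram_gaussian(1)[of "B\<^sup>T" n m] Bt by (simp add: B)
    have id: "det (A * A\<^sup>T) * (\<Prod>j<n. z j)\<^sup>2 * dM = det (B * B\<^sup>T)"
      unfolding dM_def Wm_def B
      by (rule det_gram_kernel_identity[OF A U mk UU AU]) (use zpos dBB in \<open>auto simp: B less_imp_neq[symmetric]\<close>)
    define pr where "pr = (\<Prod>j<n. z j)"
    have pz: "0 < pr" unfolding pr_def using zpos by (intro prod_pos) auto
    have "sqrt (det (B * B\<^sup>T)) = sqrt (det (A * A\<^sup>T)) * pr * sqrt dM"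
      unfolding id[symmetric] pr_def[symmetric] using pz by (simp add: real_sqrt_mult)
    then have "pr * sqrt (det (A * A\<^sup>T)) / sqrt (det (B * B\<^sup>T)) = 1 / sqrt dM"
      using pz dAA dM by (simp add: field_simps)
    then have "exp (real n) * (pr * sqrt (det (A * A\<^sup>T)) / sqrt (det (B * B\<^sup>T))) = exp (real n) / sqrt dM"
      by simp
    then show ?thesis
      unfolding vol_estimate_def Let_def zv_def[symmetric] B_def[symmetric] dA z_def[symmetric] pr_def[symmetric]
      by (simp only: mult.assoc times_divide_eq_right)
  qed
  have cancel: "exp (real n) * (exp (- real n) * V) = V" by (simp add: exp_minus)
  have "exp (- real n) * V \<le> 1 / sqrt dM"
    using upper dM unfolding massV by (subst (asm) ennreal_le_iff) auto
  then have "exp (real n) * (exp (- real n) * V) \<le> exp (real n) * (1 / sqrt dM)"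
    by (intro mult_left_mono) auto
  then show "vol A b \<le> vol_estimate A b"
    unfolding est V_def[symmetric] cancel by simp
  have "ennreal (exp (- (real n - real k) / 2) * \<zeta> / sqrt (2 * pi) ^ n) \<le> ennreal (exp (- real n) * V)"
    using G.fiber_mass_lower unfolding massV .
  then have low: "exp (- real m / 2) * \<zeta> / sqrt (2 * pi) ^ n \<le> exp (- real n) * V"
    using V(2) mk by (subst (asm) ennreal_le_iff) auto
  have "exp (- real m / 2) * \<zeta> / sqrt (2 * pi) ^ n = (1 / sqrt (2 * pi * exp 1)) ^ m / sqrt dM"
  proof -
    have "exp (- real m / 2) = (1 / sqrt (exp 1)) ^ m"
    proof -
      have "exp (- real m / 2) = exp (real m * (- (1 / 2)))" by simp
      also have "\<dots> = exp (- (1 / 2)) ^ m" by (rule exp_of_nat_mult)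
      also have "exp (- (1 / 2)) = 1 / sqrt (exp 1 :: real)"
      proof -
        have "sqrt (exp 1) = exp (1 / 2 :: real)"
          by (rule real_sqrt_unique) (simp_all add: power2_eq_square flip: exp_add)
        then show ?thesis by (simp add: exp_minus inverse_eq_divide)
      qed
      finally show ?thesis .
    qed
    moreover have "\<zeta> / sqrt (2 * pi) ^ n = (1 / sqrt (2 * pi)) ^ m / sqrt dM"
      unfolding \<zeta>_def mk[symmetric] by (simp add: power_add power_one_over)
    ultimately have "exp (- real m / 2) * (\<zeta> / sqrt (2 * pi) ^ n) = (1 / sqrt (exp 1)) ^ m * ((1 / sqrt (2 * pi)) ^ m / sqrt dM)"
      by (simp only:)
    also have "\<dots> = (1 / sqrt (2 * pi * exp 1)) ^ m / sqrt dM"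
      by (simp add: real_sqrt_mult power_mult_distrib power_one_over mult_ac)
    finally show ?thesis by (simp only: times_divide_eq_right)
  qed
  then have "exp (real n) * ((1 / sqrt (2 * pi * exp 1)) ^ m / sqrt dM) \<le> exp (real n) * (exp (- real n) * V)"
    using low by (intro mult_left_mono) auto
  then show "(1 / sqrt (2 * pi * exp 1)) ^ m * vol_estimate A b \<le> vol A b"
    unfolding est V_def[symmetric] cancel by (simp add: mult.commute)
  show "0 \<le> vol_estimate A b" unfolding est using dM by simp
qed

section \<open>The equation for the number \<alpha>0\<close>

lemma nn_integral_Gamma_scaled:
  fixes x a :: real
  assumes x: "0 < x" and a: "0 < a"
  shows "(\<integral>\<^sup>+ l. ennreal (indicator {0..} l * (l powr (x - 1) * exp (- a * l))) \<partial>lborel) = ennreal (Gamma x * a powr (- x))"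
proof -
  have one: "(\<integral>\<^sup>+ l. ennreal (indicator {0..} l * (l powr (x - 1) * exp (- l))) \<partial>lborel) = ennreal (Gamma x)"
  proof -
    have "((\<lambda>l. l powr (x - 1) / exp l) has_integral Gamma x) {0..}"
      by (rule Gamma_integral_real[OF x])
    then have "((\<lambda>l. indicator {0..} l * (l powr (x - 1) * exp (- l))) has_integral Gamma x) UNIV"
    proof (subst (asm) has_integral_restrict_UNIV[symmetric])
      have "(\<lambda>l. if l \<in> {0..} then l powr (x - 1) / exp l else 0) = (\<lambda>l. indicator {0..} l * (l powr (x - 1) * exp (- l)))"
        by (auto simp: fun_eq_iff indicator_def exp_minus divide_inverse)
      then show "((\<lambda>l. if l \<in> {0..} then l powr (x - 1) / exp l else 0) has_integral Gamma x) UNIV \<Longrightarrow> ?thesis"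
        by (simp only:)
    qed
    then show ?thesis by (intro nn_integral_has_integral_lborel) auto
  qed
  have "(\<integral>\<^sup>+ l. ennreal (indicator {0..} l * (l powr (x - 1) * exp (- a * l))) \<partial>lborel)
    = ennreal \<bar>1 / a\<bar> * (\<integral>\<^sup>+ l. ennreal (indicator {0..} (0 + 1 / a * l) * ((0 + 1 / a * l) powr (x - 1) * exp (- a * (0 + 1 / a * l)))) \<partial>lborel)"
    using a by (intro nn_integral_real_affine) auto
  also have "(\<lambda>l. ennreal (indicator {0..} (0 + 1 / a * l) * ((0 + 1 / a * l) powr (x - 1) * exp (- a * (0 + 1 / a * l)))))
    = (\<lambda>l. ennreal (a powr (1 - x)) * ennreal (indicator {0..} l * (l powr (x - 1) * exp (- l))))"
  proof
    fix l
    show "ennreal (indicator {0..} (0 + 1 / a * l) * ((0 + 1 / a * l) powr (x - 1) * exp (- a * (0 + 1 / a * l))))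
      = ennreal (a powr (1 - x)) * ennreal (indicator {0..} l * (l powr (x - 1) * exp (- l)))"
    proof (cases "0 \<le> l")
      case True
      have "a powr (1 - x) = 1 / a powr (x - 1)" using powr_minus_divide[of a "x - 1"] by simp
      then show ?thesis using True a
        by (subst ennreal_mult[symmetric]) (auto simp: indicator_def powr_divide)
    qed (use a in \<open>auto simp: indicator_def zero_le_divide_iff\<close>)
  qed
  also have "ennreal \<bar>1 / a\<bar> * (\<integral>\<^sup>+ l. ennreal (a powr (1 - x)) * ennreal (indicator {0..} l * (l powr (x - 1) * exp (- l))) \<partial>lborel)
    = ennreal \<bar>1 / a\<bar> * (ennreal (a powr (1 - x)) * ennreal (Gamma x))"
    by (subst nn_integral_cmult, measurable) (simp only: one)
  also have "\<dots> = ennreal (\<bar>1 / a\<bar> * (a powr (1 - x) * Gamma x))"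
    using Gamma_real_pos[OF x] by (subst ennreal_mult[symmetric], simp, simp, subst ennreal_mult[symmetric]) auto
  also have "\<bar>1 / a\<bar> * (a powr (1 - x) * Gamma x) = Gamma x * a powr (- x)"
  proof -
    have "a powr (- x) = a powr ((1 - x) + (- 1))" by simp
    also have "\<dots> = a powr (1 - x) * a powr (- 1)" by (rule powr_add)
    finally show ?thesis using a by (simp add: powr_minus_divide)
  qed
  finally show ?thesis .
qed

text \<open>
  Multiplied by Gamma(x), the integrand becomes a Gamma integral in an auxiliary variable l; after
  exchanging the integrals, the integral over s is Gaussian.
\<close>
lemma integral_one_plus_square_powr:
  fixes x :: real
  assumes x: "1 / 2 < x"
  shows "(LINT s|lborel. (1 + s\<^sup>2) powr (- x)) = sqrt pi * (Gamma (x - 1 / 2) / Gamma x)"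
proof -
  have G: "0 < Gamma x" "0 < Gamma (x - 1 / 2)" using x by (auto intro: Gamma_real_pos)
  define f :: "real \<Rightarrow> real \<Rightarrow> ennreal"
    where "f s l = ennreal (indicator {0..} l * (l powr (x - 1) * exp (- (1 + s\<^sup>2) * l)))" for s l
  have [measurable]: "(\<lambda>(s, l). f s l) \<in> borel_measurable (lborel \<Otimes>\<^sub>M lborel)" unfolding f_def by measurable
  have "ennreal (Gamma x) * (\<integral>\<^sup>+ s. ennreal ((1 + s\<^sup>2) powr (- x)) \<partial>lborel)
    = (\<integral>\<^sup>+ s. ennreal (Gamma x * (1 + s\<^sup>2) powr (- x)) \<partial>lborel)"
    using G by (subst nn_integral_cmult[symmetric]) (auto simp: ennreal_mult)
  also have "\<dots> = (\<integral>\<^sup>+ s. (\<integral>\<^sup>+ l. f s l \<partial>lborel) \<partial>lborel)"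
    unfolding f_def using x by (intro nn_integral_cong nn_integral_Gamma_scaled[symmetric]) (auto intro: add_pos_nonneg)
  also have "\<dots> = (\<integral>\<^sup>+ l. (\<integral>\<^sup>+ s. f s l \<partial>lborel) \<partial>lborel)"
    by (rule lborel_pair.Fubini'[symmetric]) measurable
  also have "\<dots> = (\<integral>\<^sup>+ l. ennreal (sqrt pi) * ennreal (indicator {0..} l * (l powr ((x - 1 / 2) - 1) * exp (- 1 * l))) \<partial>lborel)"
  proof (rule nn_integral_cong_AE, rule eventually_mono[OF AE_lborel_singleton[of 0]])
    fix l :: real assume l: "l \<noteq> 0"
    show "(\<integral>\<^sup>+ s. f s l \<partial>lborel) = ennreal (sqrt pi) * ennreal (indicator {0..} l * (l powr ((x - 1 / 2) - 1) * exp (- 1 * l)))"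
    proof (cases "0 < l")
      case True
      have "(\<integral>\<^sup>+ s. f s l \<partial>lborel) = (\<integral>\<^sup>+ s. ennreal (l powr (x - 1) * exp (- l)) * ennreal (exp (- l * s\<^sup>2)) \<partial>lborel)"
      proof (rule nn_integral_cong)
        fix s
        have "exp (- (1 + s\<^sup>2) * l) = exp (- l) * exp (- l * s\<^sup>2)"
          by (simp add: algebra_simps flip: exp_add)
        then show "f s l = ennreal (l powr (x - 1) * exp (- l)) * ennreal (exp (- l * s\<^sup>2))"
          unfolding f_def using True by (subst ennreal_mult[symmetric]) (auto simp: indicator_def)
      qed
      also have "\<dots> = ennreal (l powr (x - 1) * exp (- l)) * ennreal (sqrt (pi / l))"
        by (subst nn_integral_cmult, measurable) (simp only: nn_integral_gauss[OF True])
      also have "\<dots> = ennreal (sqrt pi * (l powr ((x - 1 / 2) - 1) * exp (- l)))"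
      proof -
        have "l powr (x - 1) = l powr ((x - 1 / 2) - 1) * l powr (1 / 2)" by (simp flip: powr_add)
        then have "l powr (x - 1) * exp (- l) * sqrt (pi / l) = sqrt pi * (l powr ((x - 1 / 2) - 1) * exp (- l))"
          using True by (simp add: powr_half_sqrt real_sqrt_divide)
        then show ?thesis using True by (subst ennreal_mult[symmetric]) auto
      qed
      finally show ?thesis using True by (simp add: ennreal_mult[symmetric])
    next
      case False
      then show ?thesis using l by (simp add: f_def indicator_def)
    qed
  qed
  also have "\<dots> = ennreal (sqrt pi) * ennreal (Gamma (x - 1 / 2) * 1 powr (- (x - 1 / 2)))"
  proof (subst nn_integral_cmult)
    have "(\<integral>\<^sup>+ l. ennreal (indicator {0..} l * (l powr (x - 1 / 2 - 1) * exp (- 1 * l))) \<partial>lborel) = ennreal (Gamma (x - 1 / 2) * 1 powr (- (x - 1 / 2)))"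
      by (rule nn_integral_Gamma_scaled) (use x in auto)
    then show "ennreal (sqrt pi) * (\<integral>\<^sup>+ l. ennreal (indicator {0..} l * (l powr (x - 1 / 2 - 1) * exp (- 1 * l))) \<partial>lborel)
      = ennreal (sqrt pi) * ennreal (Gamma (x - 1 / 2) * 1 powr (- (x - 1 / 2)))" by (simp only:)
  qed measurable
  also have "\<dots> = ennreal (Gamma x) * ennreal (sqrt pi * (Gamma (x - 1 / 2) / Gamma x))"
    using G by (simp add: ennreal_mult[symmetric])
  finally have "(\<integral>\<^sup>+ s. ennreal ((1 + s\<^sup>2) powr (- x)) \<partial>lborel) = ennreal (sqrt pi * (Gamma (x - 1 / 2) / Gamma x))"
    using G by (subst (asm) ennreal_mult_cancel_left) auto
  then have "has_bochner_integral lborel (\<lambda>s. (1 + s\<^sup>2) powr (- x)) (sqrt pi * (Gamma (x - 1 / 2) / Gamma x))"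
    using G by (intro has_bochner_integral_nn_integral) auto
  then show ?thesis by (rule has_bochner_integral_integral_eq)
qed

definition gratio :: "real \<Rightarrow> real" where "gratio x = Gamma (x - 1 / 2) / Gamma x"

lemma gratio_pos: "1 / 2 < x \<Longrightarrow> 0 < gratio x"
  by (simp add: gratio_def Gamma_real_pos)

lemma gratio_has_derivative:
  assumes "1 / 2 < x"
  shows "(gratio has_real_derivative gratio x * (Digamma (x - 1 / 2) - Digamma x)) (at x)"
proof -
  have n: "x \<notin> \<int>\<^sub>\<le>\<^sub>0" "x - 1 / 2 \<notin> \<int>\<^sub>\<le>\<^sub>0" using assms by (auto elim!: nonpos_Ints_cases)
  have "0 < Gamma x" using assms by (intro Gamma_real_pos) auto
  then show ?thesis unfolding gratio_def using n
    by (auto intro!: derivative_eq_intros simp: field_simps)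
qed

text \<open>The logarithmic derivative is Digamma(x - 1/2) - Digamma(x), and Digamma is strictly increasing.\<close>
lemma gratio_strict_antimono:
  assumes "1 / 2 < x" "x < y"
  shows "gratio y < gratio x"
proof (rule DERIV_neg_imp_decreasing[OF assms(2)])
  fix u assume u: "x \<le> u" "u \<le> y"
  have "Digamma (u - 1 / 2) < Digamma u" using assms u by (intro Digamma_real_strict_mono) auto
  then have "gratio u * (Digamma (u - 1 / 2) - Digamma u) < 0"
    using gratio_pos[of u] assms u by (simp add: mult_less_0_iff)
  then show "\<exists>D. (gratio has_real_derivative D) (at u) \<and> D < 0"
    using gratio_has_derivative[of u] assms u by (intro exI conjI) auto
qed

lemma gratio_plus1:
  assumes "1 / 2 < x"
  shows "gratio (x + 1) = (x - 1 / 2) / x * gratio x"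
proof -
  have n: "x \<notin> \<int>\<^sub>\<le>\<^sub>0" "x - 1 / 2 \<notin> \<int>\<^sub>\<le>\<^sub>0" using assms by (auto elim!: nonpos_Ints_cases)
  have "Gamma (x + 1) = x * Gamma x" by (rule Gamma_plus1[OF n(1)])
  moreover have "Gamma (x + 1 - 1 / 2) = (x - 1 / 2) * Gamma (x - 1 / 2)"
    using Gamma_plus1[OF n(2)] by (simp add: algebra_simps)
  ultimately show ?thesis by (simp add: gratio_def)
qed

lemma gratio_plus_nat:
  assumes "1 / 2 < x"
  shows "gratio x = (\<Prod>i<N. (x + real i) / (x + real i - 1 / 2)) * gratio (x + real N)"
proof (induction N)
  case (Suc N)
  have "gratio (x + real N + 1) = (x + real N - 1 / 2) / (x + real N) * gratio (x + real N)"
    using assms by (intro gratio_plus1) auto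
  then have "gratio (x + real N) = (x + real N) / (x + real N - 1 / 2) * gratio (x + real (Suc N))"
    using assms by (simp add: add_ac)
  then show ?case using Suc.IH by simp
qed simp

text \<open>
  Gauss's limit formula for Gamma at x and at x - 1/2: the quotient of the two formulas contains the
  factor sqrt n and the quotient of Pochhammer symbols, which is a shifted Gamma ratio.
\<close>
lemma gratio_asymptotic:
  assumes x: "1 / 2 < x"
  shows "(\<lambda>n. sqrt (real n) * gratio (x + real n)) \<longlonglongrightarrow> 1"
proof -
  have n: "x \<notin> \<int>\<^sub>\<le>\<^sub>0" "x - 1 / 2 \<notin> \<int>\<^sub>\<le>\<^sub>0" using x by (auto elim!: nonpos_Ints_cases)
  have G: "0 < Gamma x" "0 < Gamma (x - 1 / 2)" using x by (auto intro: Gamma_real_pos)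
  have "(\<lambda>n. Gamma_series (x - 1 / 2) n / Gamma_series x n) \<longlonglongrightarrow> Gamma (x - 1 / 2) / Gamma x"
    using G by (intro tendsto_divide Gamma_series_LIMSEQ) auto
  then have l1: "(\<lambda>n. Gamma_series x n / Gamma_series (x - 1 / 2) n * gratio x) \<longlonglongrightarrow> 1"
    using tendsto_mult[OF tendsto_inverse, of "\<lambda>n. Gamma_series (x - 1 / 2) n / Gamma_series x n" "gratio x" sequentially "\<lambda>_. gratio x" "gratio x"]
      gratio_pos[OF x] by (simp add: gratio_def[symmetric])
  have "eventually (\<lambda>n. Gamma_series x n / Gamma_series (x - 1 / 2) n * gratio x = sqrt (real n) * gratio (x + real (Suc n))) sequentially"
  proof (rule eventually_mono[OF eventually_gt_at_top[of 0]])
    fix n :: nat assume n0: "0 < n"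
    have p: "pochhammer x (n + 1) = Gamma (x + real (n + 1)) / Gamma x"
      using pochhammer_Gamma[OF n(1), of "n + 1"] by simp
    have q: "pochhammer (x - 1 / 2) (n + 1) = Gamma (x - 1 / 2 + real (n + 1)) / Gamma (x - 1 / 2)"
      using pochhammer_Gamma[OF n(2), of "n + 1"] by simp
    have e: "exp (x * ln (real n)) = exp ((x - 1 / 2) * ln (real n)) * sqrt (real n)"
    proof -
      have "exp (x * ln (real n)) = exp ((x - 1 / 2) * ln (real n)) * exp (1 / 2 * ln (real n))"
        by (simp add: algebra_simps flip: exp_add)
      also have "exp (1 / 2 * ln (real n)) = real n powr (1 / 2)" using n0 by (simp add: powr_def)
      also have "\<dots> = sqrt (real n)" by (simp add: powr_half_sqrt)
      finally show ?thesis .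
    qed
    have pos: "0 < Gamma (x + real (n + 1))" "0 < Gamma (x - 1 / 2 + real (n + 1))"
      using x by (auto intro!: Gamma_real_pos)
    have eq: "x - 1 / 2 + real (n + 1) = x + real (Suc n) - 1 / 2" by simp
    have "Gamma_series x n / Gamma_series (x - 1 / 2) n = sqrt (real n) * (pochhammer (x - 1 / 2) (n + 1) / pochhammer x (n + 1))"
      unfolding Gamma_series_def of_real_eq_id id_apply e by (simp add: field_simps)
    also have "\<dots> = sqrt (real n) * (gratio (x + real (Suc n)) / gratio x)"
      unfolding p q gratio_def eq using G pos by (simp add: field_simps)
    finally show "Gamma_series x n / Gamma_series (x - 1 / 2) n * gratio x = sqrt (real n) * gratio (x + real (Suc n))"
      using gratio_pos[OF x] by simp
  qed
  then have l2: "(\<lambda>n. sqrt (real n) * gratio (x + real (Suc n))) \<longlonglongrightarrow> 1"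
    using l1 by (rule Lim_transform_eventually[rotated])
  have "(\<lambda>n. sqrt (real (Suc n)) / sqrt (real n)) \<longlonglongrightarrow> 1" by real_asymp
  then have "(\<lambda>n. (sqrt (real (Suc n)) / sqrt (real n)) * (sqrt (real n) * gratio (x + real (Suc n)))) \<longlonglongrightarrow> 1 * 1"
    by (intro tendsto_mult l2)
  moreover have "eventually (\<lambda>n. (sqrt (real (Suc n)) / sqrt (real n)) * (sqrt (real n) * gratio (x + real (Suc n))) = sqrt (real (Suc n)) * gratio (x + real (Suc n))) sequentially"
    by (rule eventually_mono[OF eventually_gt_at_top[of 0]]) auto
  ultimately have "(\<lambda>n. sqrt (real (Suc n)) * gratio (x + real (Suc n))) \<longlonglongrightarrow> 1"
    by (auto intro: Lim_transform_eventually)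
  then show ?thesis by (rule LIMSEQ_imp_Suc)
qed

text \<open>
  Convergents of Brouncker's continued fraction
  v + 1 / (32 v + 9 / (2 v + 25 / (32 v + ...))) for (Gamma(v + 3/4) / Gamma(v + 1/4))^2. The first
  breaks off after 2 v, the second after the following 32 v.
\<close>
definition cf2 :: "real \<Rightarrow> real" where "cf2 v = v * (64 * v\<^sup>2 + 11) / (64 * v\<^sup>2 + 9)"

definition cf3 :: "real \<Rightarrow> real" where "cf3 v = (2048 * v ^ 4 + 1152 * v\<^sup>2 + 25) / (32 * v * (64 * v\<^sup>2 + 34))"

text \<open>
  The convergents satisfy the functional equation of (Gamma(v + 3/4) / Gamma(v + 1/4))^2 up to an
  error of fixed sign: after clearing denominators all powers of v cancel.
\<close>
lemma cf2_step: assumes "0 < v" shows "(v + 3 / 4)\<^sup>2 * cf2 v \<le> (v + 1 / 4)\<^sup>2 * cf2 (v + 1)"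
proof -
  have p: "0 < 64 * v\<^sup>2 + 9" "0 < 64 * (v + 1)\<^sup>2 + 9" by (auto intro: add_nonneg_pos)
  have "(v + 1 / 4)\<^sup>2 * ((v + 1) * (64 * (v + 1)\<^sup>2 + 11)) * (64 * v\<^sup>2 + 9) - (v + 3 / 4)\<^sup>2 * (v * (64 * v\<^sup>2 + 11)) * (64 * (v + 1)\<^sup>2 + 9) = 675 / 16"
    by (simp add: power2_eq_square field_simps)
  then have "(v + 3 / 4)\<^sup>2 * (v * (64 * v\<^sup>2 + 11)) * (64 * (v + 1)\<^sup>2 + 9) \<le> (v + 1 / 4)\<^sup>2 * ((v + 1) * (64 * (v + 1)\<^sup>2 + 11)) * (64 * v\<^sup>2 + 9)"
    by linarith
  then have "(v + 3 / 4)\<^sup>2 * (v * (64 * v\<^sup>2 + 11)) / (64 * v\<^sup>2 + 9) \<le> (v + 1 / 4)\<^sup>2 * ((v + 1) * (64 * (v + 1)\<^sup>2 + 11)) / (64 * (v + 1)\<^sup>2 + 9)"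
    using p by (simp only: pos_divide_le_eq times_divide_eq_left pos_le_divide_eq)
  then show ?thesis by (simp only: cf2_def times_divide_eq_right)
qed

lemma cf3_step: assumes "0 < v" shows "(v + 1 / 4)\<^sup>2 * cf3 (v + 1) \<le> (v + 3 / 4)\<^sup>2 * cf3 v"
proof -
  define n where "n w = 2048 * w ^ 4 + 1152 * w\<^sup>2 + (25::real)" for w
  define d where "d w = 32 * w * (64 * w\<^sup>2 + (34::real))" for w
  have p: "0 < d v" "0 < d (v + 1)" using assms by (auto simp: d_def intro!: mult_pos_pos add_nonneg_pos)
  have "(v + 3 / 4)\<^sup>2 * n v * d (v + 1) - (v + 1 / 4)\<^sup>2 * n (v + 1) * d v = 44100"
    by (simp add: n_def d_def power2_eq_square power4_eq_xxxx field_simps)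
  then have "(v + 1 / 4)\<^sup>2 * n (v + 1) * d v \<le> (v + 3 / 4)\<^sup>2 * n v * d (v + 1)" by linarith
  then have "(v + 1 / 4)\<^sup>2 * n (v + 1) / d (v + 1) \<le> (v + 3 / 4)\<^sup>2 * n v / d v"
    using p by (simp only: pos_divide_le_eq times_divide_eq_left pos_le_divide_eq)
  then show ?thesis by (simp only: cf3_def n_def d_def times_divide_eq_right)
qed

text \<open>
  Along x, x + 1, x + 2, ... the products of \<open>gratio\<close>^2 with the two convergents are increasing and
  decreasing respectively, by \<open>cf2_step\<close>, \<open>cf3_step\<close> and the functional equation of Gamma. Both tend to 1,
  because the convergents are asymptotic to the argument and \<open>gratio\<close> to its inverse square root.
\<close>
lemma gratio_bounds:
  assumes x: "3 / 4 < x"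
  shows "(gratio x)\<^sup>2 * cf2 (x - 3 / 4) \<le> 1" and "1 \<le> (gratio x)\<^sup>2 * cf3 (x - 3 / 4)"
proof -
  have rec: "(gratio (x + real (Suc n)))\<^sup>2 = ((x + real n - 1 / 2) / (x + real n))\<^sup>2 * (gratio (x + real n))\<^sup>2" for n
    using gratio_plus1[of "x + real n"] x by (simp add: add_ac power_mult_distrib power_divide)
  have vpos: "0 < x + real n - 3 / 4" for n using x by (simp add: add_pos_nonneg)
  have sh: "x + real (Suc n) - 3 / 4 = (x + real n - 3 / 4) + 1" "x + real n - 1 / 2 = (x + real n - 3 / 4) + 1 / 4"
    "x + real n = (x + real n - 3 / 4) + 3 / 4" for n by auto
  have step: "(gratio (x + real (Suc n)))\<^sup>2 * c ((x + real n - 3 / 4) + 1)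
    = (gratio (x + real n))\<^sup>2 * (((x + real n - 3 / 4) + 1 / 4)\<^sup>2 * c ((x + real n - 3 / 4) + 1)) / ((x + real n - 3 / 4) + 3 / 4)\<^sup>2" for n and c :: "real \<Rightarrow> real"
    unfolding rec by (simp add: power_divide)
  have same: "(gratio (x + real n))\<^sup>2 * c (x + real n - 3 / 4)
    = (gratio (x + real n))\<^sup>2 * (((x + real n - 3 / 4) + 3 / 4)\<^sup>2 * c (x + real n - 3 / 4)) / ((x + real n - 3 / 4) + 3 / 4)\<^sup>2" for n and c :: "real \<Rightarrow> real"
    using x by simp
  have inc: "incseq (\<lambda>n. (gratio (x + real n))\<^sup>2 * cf2 (x + real n - 3 / 4))"
  proof (rule incseq_SucI)
    fix n
    show "(gratio (x + real n))\<^sup>2 * cf2 (x + real n - 3 / 4) \<le> (gratio (x + real (Suc n)))\<^sup>2 * cf2 (x + real (Suc n) - 3 / 4)"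
      unfolding sh(1) step same[of n cf2] by (intro divide_right_mono mult_left_mono cf2_step vpos) auto
  qed
  have dec: "decseq (\<lambda>n. (gratio (x + real n))\<^sup>2 * cf3 (x + real n - 3 / 4))"
  proof (rule decseq_SucI)
    fix n
    show "(gratio (x + real (Suc n)))\<^sup>2 * cf3 (x + real (Suc n) - 3 / 4) \<le> (gratio (x + real n))\<^sup>2 * cf3 (x + real n - 3 / 4)"
      unfolding sh(1) step same[of n cf3] by (intro divide_right_mono mult_left_mono cf3_step vpos) auto
  qed
  have lim: "(\<lambda>n. (gratio (x + real n))\<^sup>2 * c (x + real n - 3 / 4)) \<longlonglongrightarrow> 1"
    if "(\<lambda>n. c (x + real n - 3 / 4) / real n) \<longlonglongrightarrow> 1" for c
  proof -
    have "(\<lambda>n. (sqrt (real n) * gratio (x + real n))\<^sup>2 * (c (x + real n - 3 / 4) / real n)) \<longlonglongrightarrow> 1\<^sup>2 * 1"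
      using x by (intro tendsto_mult tendsto_power gratio_asymptotic that) auto
    moreover have "eventually (\<lambda>n. (sqrt (real n) * gratio (x + real n))\<^sup>2 * (c (x + real n - 3 / 4) / real n) = (gratio (x + real n))\<^sup>2 * c (x + real n - 3 / 4)) sequentially"
      by (rule eventually_mono[OF eventually_gt_at_top[of 0]]) (auto simp: power_mult_distrib)
    ultimately show ?thesis by (auto intro: Lim_transform_eventually)
  qed
  have "(\<lambda>n. cf2 (x + real n - 3 / 4) / real n) \<longlonglongrightarrow> 1" unfolding cf2_def by real_asymp
  from incseq_le[OF inc lim[OF this], of 0] show "(gratio x)\<^sup>2 * cf2 (x - 3 / 4) \<le> 1" by simp
  have "(\<lambda>n. cf3 (x + real n - 3 / 4) / real n) \<longlonglongrightarrow> 1" unfolding cf3_def by real_asymp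
  from decseq_ge[OF dec lim[OF this], of 0] show "1 \<le> (gratio x)\<^sup>2 * cf3 (x - 3 / 4)" by simp
qed

lemma cf_pos: assumes "0 < v" shows "0 < cf2 v" "0 < cf3 v"
  using assms by (auto simp: cf2_def cf3_def intro!: divide_pos_pos mult_pos_pos add_nonneg_pos add_pos_pos)

lemma gratio_upper:
  assumes "1 / 2 < x" "3 / 4 < x + real N"
  shows "(gratio x)\<^sup>2 \<le> (\<Prod>i<N. (x + real i) / (x + real i - 1 / 2))\<^sup>2 / cf2 (x + real N - 3 / 4)"
proof -
  have "(gratio (x + real N))\<^sup>2 \<le> 1 / cf2 (x + real N - 3 / 4)"
    using gratio_bounds(1)[OF assms(2)] cf_pos[of "x + real N - 3 / 4"] assms(2) by (simp add: pos_le_divide_eq)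
  then have "(\<Prod>i<N. (x + real i) / (x + real i - 1 / 2))\<^sup>2 * (gratio (x + real N))\<^sup>2
    \<le> (\<Prod>i<N. (x + real i) / (x + real i - 1 / 2))\<^sup>2 * (1 / cf2 (x + real N - 3 / 4))"
    by (intro mult_left_mono) auto
  then show ?thesis unfolding gratio_plus_nat[OF assms(1), of N] by (simp add: power_mult_distrib)
qed

lemma gratio_lower:
  assumes "1 / 2 < x" "3 / 4 < x + real N"
  shows "(\<Prod>i<N. (x + real i) / (x + real i - 1 / 2))\<^sup>2 / cf3 (x + real N - 3 / 4) \<le> (gratio x)\<^sup>2"
proof -
  have "1 / cf3 (x + real N - 3 / 4) \<le> (gratio (x + real N))\<^sup>2"
    using gratio_bounds(2)[OF assms(2)] cf_pos[of "x + real N - 3 / 4"] assms(2) by (simp add: pos_divide_le_eq)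
  then have "(\<Prod>i<N. (x + real i) / (x + real i - 1 / 2))\<^sup>2 * (1 / cf3 (x + real N - 3 / 4))
    \<le> (\<Prod>i<N. (x + real i) / (x + real i - 1 / 2))\<^sup>2 * (gratio (x + real N))\<^sup>2"
    by (intro mult_left_mono) auto
  then show ?thesis unfolding gratio_plus_nat[OF assms(1), of N] by (simp add: power_mult_distrib)
qed

lemma gratio_1: "gratio 1 = sqrt pi"
  by (simp add: gratio_def Gamma_one_half_real)

text \<open>
  The two arguments are 1 / (2 \<alpha>) for \<alpha> = 0.7148659166 and \<alpha> = 0.7148659170. The number 2 sqrt pi is
  itself twice a value of \<open>gratio\<close>, so one and the same pair of convergents bounds both sides. They are
  evaluated after a shift by 12, where they agree to enough digits to separate the sides.
\<close>
lemma gratio_enclosure: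
  "gratio (5000000000 / 7148659166) < 2 * sqrt pi" "2 * sqrt pi < gratio (5000000000 / 7148659170)"
proof -
  define xl xu :: real where "xl = 5000000000 / 7148659166" and "xu = 5000000000 / 7148659170"
  have "(gratio xl)\<^sup>2 < (2 * gratio 1)\<^sup>2"
  proof -
    have "(gratio xl)\<^sup>2 \<le> (\<Prod>i<12. (xl + real i) / (xl + real i - 1 / 2))\<^sup>2 / cf2 (xl + real 12 - 3 / 4)"
      by (rule gratio_upper) (auto simp: xl_def)
    also have "\<dots> < 4 * ((\<Prod>i<12. (1 + real i) / (1 + real i - 1 / 2))\<^sup>2 / cf3 (1 + real 12 - 3 / 4))"
      unfolding xl_def cf2_def cf3_def by (simp add: lessThan_nat_numeral power2_eq_square power4_eq_xxxx)
    also have "\<dots> \<le> 4 * (gratio 1)\<^sup>2"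
      by (intro mult_left_mono gratio_lower) auto
    finally show ?thesis by (simp add: power_mult_distrib)
  qed
  then show "gratio (5000000000 / 7148659166) < 2 * sqrt pi"
    unfolding gratio_1 xl_def by (rule power_less_imp_less_base) simp
  have "(2 * gratio 1)\<^sup>2 < (gratio xu)\<^sup>2"
  proof -
    have "4 * (gratio 1)\<^sup>2 \<le> 4 * ((\<Prod>i<12. (1 + real i) / (1 + real i - 1 / 2))\<^sup>2 / cf2 (1 + real 12 - 3 / 4))"
      by (intro mult_left_mono gratio_upper) auto
    also have "\<dots> < (\<Prod>i<12. (xu + real i) / (xu + real i - 1 / 2))\<^sup>2 / cf3 (xu + real 12 - 3 / 4)"
      unfolding xu_def cf2_def cf3_def by (simp add: lessThan_nat_numeral power2_eq_square power4_eq_xxxx)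
    also have "\<dots> \<le> (gratio xu)\<^sup>2"
      by (rule gratio_lower) (auto simp: xu_def)
    finally show ?thesis by (simp add: power_mult_distrib)
  qed
  then show "2 * sqrt pi < gratio (5000000000 / 7148659170)"
    unfolding gratio_1 xu_def by (rule power_less_imp_less_base) (auto intro!: less_imp_le gratio_pos)
qed

text \<open>
  With u = 1 / (2 \<alpha>) the equation reads \<open>gratio u = 2 * sqrt pi\<close>; the intermediate value theorem gives
  a solution between the two enclosing arguments, and monotonicity makes it the only one.
\<close>
theorem alpha0_exists_unique:
  "\<exists>\<alpha>\<^sub>0 :: real. (\<forall>\<alpha> :: real. \<alpha> \<in> {0<..<1} \<and> 1 / (2 * pi) * (LINT s|lborel. (1 + s\<^sup>2) powr (- 1 / (2 * \<alpha>))) = 1 \<longleftrightarrow> \<alpha> = \<alpha>\<^sub>0)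
    \<and> \<bar>\<alpha>\<^sub>0 - 0.7148659168\<bar> \<le> 2 / 10 ^ 10"
proof -
  have cont: "isCont gratio u" if "1 / 2 < u" for u
    using gratio_has_derivative[OF that] by (rule DERIV_isCont)
  have "\<exists>u\<ge>5000000000 / 7148659170. u \<le> 5000000000 / 7148659166 \<and> gratio u = 2 * sqrt pi"
    using gratio_enclosure by (intro IVT2) (auto intro!: cont)
  then obtain u where u: "5000000000 / 7148659170 \<le> u" "u \<le> 5000000000 / 7148659166" "gratio u = 2 * sqrt pi" by blast
  define \<alpha>0 where "\<alpha>0 = 1 / (2 * u)"
  have u0: "1 / 2 < u" using u(1) by (simp add: less_le_trans)
  have solve: "1 / (2 * pi) * (LINT s|lborel. (1 + s\<^sup>2) powr (- 1 / (2 * \<alpha>))) = 1 \<longleftrightarrow> gratio (1 / (2 * \<alpha>)) = 2 * sqrt pi"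
    if a: "0 < \<alpha>" "\<alpha> < 1" for \<alpha> :: real
  proof -
    have "1 / 2 < 1 / (2 * \<alpha>)" using a by (simp add: field_simps)
    from integral_one_plus_square_powr[OF this]
    have "(LINT s|lborel. (1 + s\<^sup>2) powr (- 1 / (2 * \<alpha>))) = sqrt pi * gratio (1 / (2 * \<alpha>))"
      by (simp add: gratio_def)
    moreover have "1 / (2 * pi) * (sqrt pi * g) = g / (2 * sqrt pi)" for g
    proof -
      have "2 * pi = 2 * (sqrt pi * sqrt pi)" by simp
      then show ?thesis by (simp only:) (simp add: field_simps)
    qed
    ultimately have "1 / (2 * pi) * (LINT s|lborel. (1 + s\<^sup>2) powr (- 1 / (2 * \<alpha>))) = gratio (1 / (2 * \<alpha>)) / (2 * sqrt pi)"
      by (simp only:)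
    moreover have "g / (2 * sqrt pi) = 1 \<longleftrightarrow> g = 2 * sqrt pi" for g
      by (simp add: divide_eq_eq)
    ultimately show ?thesis by (simp only:)
  qed
  have "\<alpha> \<in> {0<..<1} \<and> 1 / (2 * pi) * (LINT s|lborel. (1 + s\<^sup>2) powr (- 1 / (2 * \<alpha>))) = 1 \<longleftrightarrow> \<alpha> = \<alpha>0" for \<alpha> :: real
  proof
    assume *: "\<alpha> \<in> {0<..<1} \<and> 1 / (2 * pi) * (LINT s|lborel. (1 + s\<^sup>2) powr (- 1 / (2 * \<alpha>))) = 1"
    then have a: "0 < \<alpha>" "\<alpha> < 1" by auto
    have g: "gratio (1 / (2 * \<alpha>)) = 2 * sqrt pi" using * solve[OF a] by blast
    have "1 / 2 < 1 / (2 * \<alpha>)" using a by (simp add: field_simps)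
    then have "1 / (2 * \<alpha>) = u"
      using gratio_strict_antimono[of u "1 / (2 * \<alpha>)"] gratio_strict_antimono[of "1 / (2 * \<alpha>)" u] u(3) g u0
      by (cases "1 / (2 * \<alpha>)" u rule: linorder_cases) auto
    then have "\<alpha>0 = 1 / (2 * (1 / (2 * \<alpha>)))" by (simp only: \<alpha>0_def)
    then show "\<alpha> = \<alpha>0" using a by simp
  next
    assume eq: "\<alpha> = \<alpha>0"
    have p: "0 < \<alpha>0" "\<alpha>0 < 1" using u0 by (auto simp: \<alpha>0_def field_simps)
    have "gratio (1 / (2 * \<alpha>0)) = 2 * sqrt pi" using u0 u(3) by (simp add: \<alpha>0_def)
    then have "1 / (2 * pi) * (LINT s|lborel. (1 + s\<^sup>2) powr (- 1 / (2 * \<alpha>0))) = 1"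
      using solve[OF p] by blast
    then show "\<alpha> \<in> {0<..<1} \<and> 1 / (2 * pi) * (LINT s|lborel. (1 + s\<^sup>2) powr (- 1 / (2 * \<alpha>))) = 1"
      unfolding eq using p by (intro conjI) (auto simp only: greaterThanLessThan_iff)
  qed
  moreover have "\<bar>\<alpha>0 - 0.7148659168\<bar> \<le> 2 / 10 ^ 10"
  proof -
    have "0.7148659166 \<le> \<alpha>0" using u u0 by (simp add: \<alpha>0_def field_simps)
    moreover have "\<alpha>0 \<le> 0.7148659170" using u u0 by (simp add: \<alpha>0_def field_simps)
    ultimately show ?thesis by (intro abs_leI) simp_all
  qed
  ultimately show ?thesis by blast
qed

text \<open>
  For a = (m + 2) / 2 this reads Gamma(a) \<le> a^(a-1), a bound that the functional equation carries from a
  to a + 1. The induction therefore starts at a = 1 and a = 3/2.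
\<close>
lemma Gamma_half_integer_le_powr: "Gamma ((real m + 2) / 2) \<le> ((real m + 2) / 2) powr (real m / 2)"
proof (induction m rule: induct_nat_012)
  case 0
  then show ?case by simp
next
  case 1
  have "(1 / 2 :: real) \<notin> \<int>\<^sub>\<le>\<^sub>0" using nonpos_Ints_nonpos[of "1 / 2 :: real"] by auto
  then have "Gamma (3 / 2 :: real) = 1 / 2 * sqrt pi"
    using Gamma_plus1[of "1 / 2 :: real"] by (simp add: Gamma_one_half_real)
  also have "\<dots> \<le> 1"
  proof -
    have "sqrt pi \<le> sqrt 4" using pi_less_4 by (intro real_sqrt_le_mono) simp
    then show ?thesis by simp
  qed
  also have "1 \<le> (3 / 2 :: real) powr (1 / 2)" by (simp add: powr_half_sqrt)
  finally show ?case by simp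
next
  case (ge2 m)
  define a where "a = (real m + 2) / 2"
  have a: "1 \<le> a" by (simp add: a_def)
  have "Gamma (a + 1) = a * Gamma a" using a by (intro Gamma_plus1) (auto elim!: nonpos_Ints_cases)
  also have "\<dots> \<le> a * a powr (real m / 2)" using ge2(1) a by (intro mult_left_mono) (auto simp: a_def)
  also have "\<dots> = a powr (real m / 2 + 1)" using a by (simp add: powr_add)
  also have "\<dots> \<le> (a + 1) powr (real m / 2 + 1)" using a by (intro powr_mono2) auto
  finally show ?case by (simp add: a_def add_divide_distrib add_ac)
qed

text \<open>The value pi = \<open>gratio 1\<close>^2 makes the bounds for the Gamma ratio a source of bounds for pi.\<close>
lemma pi_less_315: "pi < 315 / 100"
proof -
  have "pi = (gratio 1)\<^sup>2" by (simp add: gratio_1)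
  also have "\<dots> \<le> (\<Prod>i<2. (1 + real i) / (1 + real i - 1 / 2))\<^sup>2 / cf2 (1 + real 2 - 3 / 4)"
    by (rule gratio_upper) auto
  also have "\<dots> < 315 / 100"
    unfolding cf2_def by (simp add: lessThan_nat_numeral power2_eq_square)
  finally show ?thesis .
qed

section \<open>Constants and the volume estimates\<close>

lemma pi_exp_bound: "0.24 \<le> 1 / sqrt (2 * pi * exp 1)"
proof -
  have "2 * pi * exp 1 \<le> (2 * (315 / 100)) * (272 / 100 :: real)"
    using pi_less_315 e_less_272 by (intro mult_mono) auto
  also have "\<dots> \<le> (1 / 0.24)\<^sup>2" by (simp add: power2_eq_square)
  finally have "sqrt (2 * pi * exp 1) \<le> 1 / 0.24" by (intro real_le_lsqrt) auto
  moreover have "0 < sqrt (2 * pi * exp 1)" by simp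
  ultimately show ?thesis by (simp add: field_simps)
qed

text \<open>
  With a = (m + 2) / 2 the denominator is (2 pi e)^(m/2) e a^(m/2), so that the bound on Gamma(a) leaves
  2 / e \<le> 1 times the right-hand side.
\<close>
lemma Gamma_constant_le:
  "2 * Gamma ((real m + 2) / 2) / (pi powr (real m / 2) * exp ((real m + 2) / 2) * (real m + 2) powr (real m / 2))
    \<le> (1 / sqrt (2 * pi * exp 1)) ^ m"
proof -
  define h where "h = real m / 2"
  have e: "exp ((real m + 2) / 2) = exp 1 powr h * exp 1"
    by (simp add: h_def powr_def add_divide_distrib exp_add)
  have p: "(real m + 2) powr h = 2 powr h * ((real m + 2) / 2) powr h"
    by (subst powr_mult[symmetric]) (auto intro!: arg_cong[where f = "\<lambda>x. x powr h"])
  have c: "(1 / sqrt (2 * pi * exp 1)) ^ m = 1 / (2 powr h * pi powr h * exp 1 powr h)"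
  proof -
    have "sqrt (2 * pi * exp 1) ^ m = (2 * pi * exp 1) powr h"
      by (simp add: h_def powr_half_sqrt[symmetric] powr_powr flip: powr_realpow)
    then show ?thesis by (simp add: power_one_over powr_mult)
  qed
  have "2 * Gamma ((real m + 2) / 2) \<le> exp 1 * ((real m + 2) / 2) powr h"
    using Gamma_half_integer_le_powr[of m] exp_ge_add_one_self[of 1]
    by (intro mult_mono) (auto simp: h_def)
  then have "2 * Gamma ((real m + 2) / 2) / (pi powr h * (exp 1 powr h * exp 1) * (2 powr h * ((real m + 2) / 2) powr h))
    \<le> exp 1 * ((real m + 2) / 2) powr h / (pi powr h * (exp 1 powr h * exp 1) * (2 powr h * ((real m + 2) / 2) powr h))"
    by (intro divide_right_mono) auto
  also have "\<dots> = 1 / (2 powr h * pi powr h * exp 1 powr h)" by (simp add: field_simps)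
  finally show ?thesis unfolding c e h_def[symmetric] p .
qed

theorem theorem2p2:
  shows
    "(\<exists>\<alpha>\<^sub>0 :: real.
        (\<forall>\<alpha> :: real.
           \<alpha> \<in> {0<..<1} \<and>
           1 / (2 * pi) * (LINT s|lborel. (1 + s\<^sup>2) powr (- 1 / (2 * \<alpha>))) = 1
           \<longleftrightarrow> \<alpha> = \<alpha>\<^sub>0) \<and>
        \<bar>\<alpha>\<^sub>0 - 0.7148659168\<bar> \<le> 2 / 10 ^ 10 \<and>
        (\<forall>m n A b. polytope_data m n A b \<longrightarrow>
           vol A b \<le> (1 / sqrt \<alpha>\<^sub>0) ^ m * vol_estimate A b \<and>
           (1 / sqrt \<alpha>\<^sub>0) ^ m * vol_estimate A b \<le> 1.19 ^ m * vol_estimate A b)) \<and>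
     (\<forall>m n A b. polytope_data m n A b \<longrightarrow>
        vol A b \<ge>
          2 * Gamma ((real m + 2) / 2) /
          (pi powr (real m / 2) * exp ((real m + 2) / 2) * (real m + 2) powr (real m / 2)) *
          vol_estimate A b) \<and>
     (\<forall>\<epsilon> :: real. 0 < \<epsilon> \<and> \<epsilon> < 1 / 2 \<longrightarrow>
        (\<exists>\<gamma> :: real. \<gamma> > 0 \<and>
           (\<forall>m n A b. polytope_data m n A b \<longrightarrow>
              vol A b \<ge>
                exp (- \<gamma> * sqrt (real m) * (ln (real m + 1)) ^ 4) *
                (1 / sqrt (2 * pi * exp 1)) ^ m * vol_estimate A b \<and>
              exp (- \<gamma> * sqrt (real m) * (ln (real m + 1)) ^ 4) *
                (1 / sqrt (2 * pi * exp 1)) ^ m * vol_estimate A b \<ge>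
              exp (- \<gamma> * sqrt (real m) * (ln (real m + 1)) ^ 4) *
                0.24 ^ m * vol_estimate A b)))"
proof (intro conjI)
  obtain \<alpha>\<^sub>0 :: real where
    eq: "\<And>\<alpha>. \<alpha> \<in> {0<..<1} \<and> 1 / (2 * pi) * (LINT s|lborel. (1 + s\<^sup>2) powr (- 1 / (2 * \<alpha>))) = 1 \<longleftrightarrow> \<alpha> = \<alpha>\<^sub>0"
    and approx: "\<bar>\<alpha>\<^sub>0 - 0.7148659168\<bar> \<le> 2 / 10 ^ 10"
    using alpha0_exists_unique by blast
  have \<alpha>\<^sub>0: "0 < \<alpha>\<^sub>0" "\<alpha>\<^sub>0 < 1" using eq[of \<alpha>\<^sub>0] by auto
  have ge: "(100 / 119)\<^sup>2 \<le> \<alpha>\<^sub>0"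
  proof -
    have "(100 / 119)\<^sup>2 \<le> 0.7148659168 - 2 / (10 :: real) ^ 10" by (simp add: power2_eq_square)
    also have "\<dots> \<le> \<alpha>\<^sub>0" using abs_le_D2[OF approx] by linarith
    finally show ?thesis .
  qed
  have one: "1 \<le> 1 / sqrt \<alpha>\<^sub>0" using \<alpha>\<^sub>0 by simp
  have le: "1 / sqrt \<alpha>\<^sub>0 \<le> 1.19" using real_le_rsqrt[OF ge] \<alpha>\<^sub>0 by (simp add: field_simps)
  have "vol A b \<le> (1 / sqrt \<alpha>\<^sub>0) ^ m * vol_estimate A b \<and>
      (1 / sqrt \<alpha>\<^sub>0) ^ m * vol_estimate A b \<le> 1.19 ^ m * vol_estimate A b"
    if data: "polytope_data m n A b" for m n A b
  proof
    have "1 * vol_estimate A b \<le> (1 / sqrt \<alpha>\<^sub>0) ^ m * vol_estimate A b"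
      using polytope_volume_bounds(3)[OF data] one_le_power[OF one] by (intro mult_right_mono)
    then show "vol A b \<le> (1 / sqrt \<alpha>\<^sub>0) ^ m * vol_estimate A b"
      using polytope_volume_bounds(1)[OF data] by simp
    show "(1 / sqrt \<alpha>\<^sub>0) ^ m * vol_estimate A b \<le> 1.19 ^ m * vol_estimate A b"
      using polytope_volume_bounds(3)[OF data] le \<alpha>\<^sub>0 by (intro mult_right_mono power_mono) auto
  qed
  with eq approx show "\<exists>\<alpha>\<^sub>0 :: real.
        (\<forall>\<alpha> :: real.
           \<alpha> \<in> {0<..<1} \<and>
           1 / (2 * pi) * (LINT s|lborel. (1 + s\<^sup>2) powr (- 1 / (2 * \<alpha>))) = 1
           \<longleftrightarrow> \<alpha> = \<alpha>\<^sub>0) \<and>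
        \<bar>\<alpha>\<^sub>0 - 0.7148659168\<bar> \<le> 2 / 10 ^ 10 \<and>
        (\<forall>m n A b. polytope_data m n A b \<longrightarrow>
           vol A b \<le> (1 / sqrt \<alpha>\<^sub>0) ^ m * vol_estimate A b \<and>
           (1 / sqrt \<alpha>\<^sub>0) ^ m * vol_estimate A b \<le> 1.19 ^ m * vol_estimate A b)"
    by blast
next
  show "\<forall>m n A b. polytope_data m n A b \<longrightarrow>
        vol A b \<ge>
          2 * Gamma ((real m + 2) / 2) /
          (pi powr (real m / 2) * exp ((real m + 2) / 2) * (real m + 2) powr (real m / 2)) *
          vol_estimate A b"
  proof (intro allI impI)
    fix m n A b
    assume data: "polytope_data m n A b"
    show "2 * Gamma ((real m + 2) / 2) /
          (pi powr (real m / 2) * exp ((real m + 2) / 2) * (real m + 2) powr (real m / 2)) *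
          vol_estimate A b \<le> vol A b"
      using mult_right_mono[OF Gamma_constant_le polytope_volume_bounds(3)[OF data]]
        polytope_volume_bounds(2)[OF data] by (rule order_trans)
  qed
next
  show "\<forall>\<epsilon> :: real. 0 < \<epsilon> \<and> \<epsilon> < 1 / 2 \<longrightarrow>
        (\<exists>\<gamma> :: real. \<gamma> > 0 \<and>
           (\<forall>m n A b. polytope_data m n A b \<longrightarrow>
              vol A b \<ge>
                exp (- \<gamma> * sqrt (real m) * (ln (real m + 1)) ^ 4) *
                (1 / sqrt (2 * pi * exp 1)) ^ m * vol_estimate A b \<and>
              exp (- \<gamma> * sqrt (real m) * (ln (real m + 1)) ^ 4) *
                (1 / sqrt (2 * pi * exp 1)) ^ m * vol_estimate A b \<ge>
              exp (- \<gamma> * sqrt (real m) * (ln (real m + 1)) ^ 4) *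
                0.24 ^ m * vol_estimate A b))"
  proof (intro allI impI, rule exI[of _ 1], intro conjI allI impI)
    fix m n A b
    assume data: "polytope_data m n A b"
    define q where "q = exp (- 1 * sqrt (real m) * (ln (real m + 1)) ^ 4)"
    have q: "0 \<le> q" "q \<le> 1" by (auto simp: q_def intro!: mult_nonneg_nonneg)
    have "q * ((1 / sqrt (2 * pi * exp 1)) ^ m * vol_estimate A b)
      \<le> 1 * ((1 / sqrt (2 * pi * exp 1)) ^ m * vol_estimate A b)"
      using q polytope_volume_bounds(3)[OF data] by (intro mult_right_mono) auto
    then show "exp (- 1 * sqrt (real m) * (ln (real m + 1)) ^ 4) *
        (1 / sqrt (2 * pi * exp 1)) ^ m * vol_estimate A b \<le> vol A b"
      using polytope_volume_bounds(2)[OF data] unfolding q_def[symmetric] mult.assoc[of q] by linarith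
    show "exp (- 1 * sqrt (real m) * (ln (real m + 1)) ^ 4) * 0.24 ^ m * vol_estimate A b
      \<le> exp (- 1 * sqrt (real m) * (ln (real m + 1)) ^ 4) * (1 / sqrt (2 * pi * exp 1)) ^ m * vol_estimate A b"
      unfolding q_def[symmetric]
      using q pi_exp_bound polytope_volume_bounds(3)[OF data]
      by (intro mult_right_mono mult_left_mono power_mono) auto
  qed simp
qed

end
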